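(* Let $M$ be a 7-manifold with a nearly parallel $\mathrm{G}_2$-structure $\varphi$, normalised by $d\varphi=4*_\varphi\varphi$, let $\mathcal P\to M$ be a principal bundle with adjoint bundle $\mathrm{Ad}_{\mathcal P}$, and let $A$ be a $\mathrm{G}_2$-instanton on $\mathcal P$. Then the space of infinitesimal deformations of $A$ is isomorphic to the kernel of the operator $$D^{-1,A}+2\,\mathrm{Id}\colon \Gamma(\Lambda^1\otimes \mathrm{Ad}_{\mathcal P})\to\Gamma(\Lambda^1\otimes \mathrm{Ad}_{\mathcal P}),$$ where $D^{-1,A}$ is regarded as acting on $\Lambda^1\otimes\mathrm{Ad}_{\mathcal P}$ through $D^{-1,A}(\epsilon\cdot\eta)=(D^{-1,A}\epsilon)\cdot\eta$; that is, it is isomorphic to the space of all $\epsilon\in\Gamma(\Lambda^1\otimes\mathrm{Ad}_{\mathcal P})$ with $D^{-1,A}(\epsilon\cdot\eta)=-2\,\epsilon\cdot\eta$.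
   Context: A $\mathrm{G}_2$-structure is a positive 3-form $\varphi$ on a 7-manifold $M$; it induces a Riemannian metric $g$, an orientation and a Hodge star $*$, and $\psi=*\varphi$. Orientation convention: $\Lambda^2=\Lambda^2_7\oplus\Lambda^2_{14}$ with $\Lambda^2_7=\{\beta: *(\varphi\wedge\beta)=-2\beta\}$, $\Lambda^2_{14}=\{\beta: *(\varphi\wedge\beta)=\beta\}$. The structure is nearly parallel (with the normalisation used here) if $d\varphi=4\psi$. Spinors: $M$ is spin with real rank-8 spinor bundle $S$; Clifford multiplication satisfies $v\cdot v=-|v|^2$, and a $p$-form $e_{i_1}\wedge\dots\wedge e_{i_p}$ (orthonormal $e_i$) acts as $e_{i_1}\cdots e_{i_p}$. The structure $\varphi$ corresponds to a real Killing spinor $\eta$ with $\nabla^{LC}_X\eta=-\tfrac12X\cdot\eta$ for all vector fields $X$ and $\varphi\cdot\eta=7\eta$. One has $S=(\Lambda^0\cdot\eta)\oplus(\Lambda^1\cdot\eta)\cong\Lambda^0\oplus\Lambda^1$ (forms and vectors are identified by $g$). Connections: for $t\in\mathbb R$, $\nabla^t$ is defined on $TM$ by $g(\nabla^t_XY,Z)=g(\nabla^{LC}_XY,Z)+\tfrac t3\varphi(X,Y,Z)$, and on $S$ by its lift $\nabla^t_X\mu=\nabla^{LC}_X\mu+\tfrac t6(i_X\varphi)\cdot\mu$. In particular $\nabla^{-1}\eta=0$. For a connection $A$ on $\mathcal P$, $\nabla^{t,A}$ is the connection on $S\otimes\mathrm{Ad}_{\mathcal P}$ induced by $\nabla^t$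 and $A$, and $D^{t,A}=\sum_a e_a\cdot\nabla^{t,A}_{e_a}$ is the associated Dirac operator. Instantons: $A$ is a $\mathrm{G}_2$-instanton if its curvature satisfies $F_A\cdot\eta=0$, equivalently $F_A\wedge\varphi=*F_A$. An infinitesimal deformation of $A$ is a section $\epsilon\in\Gamma(T^*M\otimes\mathrm{Ad}_{\mathcal P})$ with $(d^A\epsilon)\cdot\eta=0$ and $(d^A)^*\epsilon=0$. *)

theory Defs
  imports "HOL-Analysis.Analysis" "HOL-Library.Function_Algebras"
begin

section \<open>Function spaces as real vector spaces\<close>

instantiation "fun" :: (type, real_vector) real_vector
begin

definition scaleR_fun :: "real \<Rightarrow> ('a \<Rightarrow> 'b) \<Rightarrow> 'a \<Rightarrow> 'b"
  where "scaleR_fun r f = (\<lambda>x. r *\<^sub>R f x)"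

instance
  by standard (simp_all add: scaleR_fun_def fun_eq_iff scaleR_add_right scaleR_add_left)

end

definition isomorphic_spaces :: "'a::real_vector set \<Rightarrow> 'b::real_vector set \<Rightarrow> bool"
  where "isomorphic_spaces V W \<longleftrightarrow>
    subspace V \<and> subspace W \<and> (\<exists>F. linear F \<and> bij_betw F V W)"


section \<open>Smooth manifolds\<close>

text \<open>\<open>C_k k S f\<close> and \<open>smooth_on S f\<close> are meant for open \<open>S\<close> in a finite-dimensional space.\<close>

primrec C_k ::
  "nat \<Rightarrow> 'a::real_normed_vector set \<Rightarrow> ('a \<Rightarrow> 'b::real_normed_vector) \<Rightarrow> bool"
  where
    "C_k 0 S f \<longleftrightarrow> continuous_on S f"
  | "C_k (Suc k) S f \<longleftrightarrow> (\<forall>x\<in>S. f differentiable (at x)) \<and>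
       (\<forall>v. C_k k S (\<lambda>x. frechet_derivative f (at x) v))"

definition smooth_on :: "'a::real_normed_vector set \<Rightarrow> ('a \<Rightarrow> 'b::real_normed_vector) \<Rightarrow> bool"
  where "smooth_on S f \<longleftrightarrow> (\<forall>k. C_k k S f)"

type_synonym ('m, 'e) chart = "'m set \<times> ('m \<Rightarrow> 'e)"

definition chart_inv :: "('m, 'e) chart \<Rightarrow> 'e \<Rightarrow> 'm"
  where "chart_inv C = inv_into (fst C) (snd C)"

text \<open>The manifold is the whole type \<open>'m\<close>. The model space is a finite-dimensional normed space
  rather than a Euclidean space type, so that dimension \<open>0\<close> is allowed
  (discrete structure groups).\<close>

definition smooth_atlas ::
  "('m::{t2_space, second_countable_topology}, 'e::real_normed_vector) chart set \<Rightarrow> bool"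
  where "smooth_atlas \<A> \<longleftrightarrow>
    (\<exists>B::'e set. finite B \<and> span B = UNIV) \<and>
    (\<Union>(U, c)\<in>\<A>. U) = UNIV \<and>
    (\<forall>(U, c)\<in>\<A>. open U \<and> open (c ` U) \<and> homeomorphism U (c ` U) c (chart_inv (U, c))) \<and>
    (\<forall>(U, c)\<in>\<A>. \<forall>(V, d)\<in>\<A>. smooth_on (c ` (U \<inter> V)) (d \<circ> chart_inv (U, c)))"

definition prod_atlas :: "('m, 'e) chart set \<Rightarrow> ('n, 'f) chart set \<Rightarrow> ('m \<times> 'n, 'e \<times> 'f) chart set"
  where "prod_atlas \<A> \<B> = {(U \<times> V, map_prod c d) | U c V d. (U, c) \<in> \<A> \<and> (V, d) \<in> \<B>}"

text \<open>In the following two definitions the set \<open>U\<close> is meant to be open.\<close>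

definition smooth_map ::
  "('m::topological_space, 'e::real_normed_vector) chart set \<Rightarrow>
   ('n::topological_space, 'f::real_normed_vector) chart set \<Rightarrow> 'm set \<Rightarrow> ('m \<Rightarrow> 'n) \<Rightarrow> bool"
  where "smooth_map \<A> \<B> U f \<longleftrightarrow> continuous_on U f \<and>
    (\<forall>(V, c)\<in>\<A>. \<forall>(W, d)\<in>\<B>.
       smooth_on (c ` (U \<inter> V \<inter> f -` W)) (d \<circ> f \<circ> chart_inv (V, c)))"

definition smooth_fun ::
  "('m, 'e::real_normed_vector) chart set \<Rightarrow> 'm set \<Rightarrow> ('m \<Rightarrow> 'f::real_normed_vector) \<Rightarrow> bool"
  where "smooth_fun \<A> U f \<longleftrightarrow>
    (\<forall>(V, c)\<in>\<A>. smooth_on (c ` (U \<inter> V)) (f \<circ> chart_inv (V, c)))"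

text \<open>The tangent space at \<open>x\<close> is the model space, a tangent vector being given by its components
  with respect to the preferred chart \<open>chart_at \<A> x\<close>. Accordingly \<open>mderiv\<close> and \<open>fderiv\<close> are the
  differentials of a map between manifolds and of a function with values in a vector space.\<close>

definition chart_at :: "('m, 'e) chart set \<Rightarrow> 'm \<Rightarrow> ('m, 'e) chart"
  where "chart_at \<A> x = (SOME C. C \<in> \<A> \<and> x \<in> fst C)"

definition mderiv ::
  "('m, 'e::real_normed_vector) chart set \<Rightarrow> ('n, 'f::real_normed_vector) chart set \<Rightarrow>
   ('m \<Rightarrow> 'n) \<Rightarrow> 'm \<Rightarrow> 'e \<Rightarrow> 'f"
  where "mderiv \<A> \<B> f x =
    frechet_derivative (snd (chart_at \<B> (f x)) \<circ> f \<circ> chart_inv (chart_at \<A> x))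
      (at (snd (chart_at \<A> x) x))"

definition fderiv ::
  "('m, 'e::real_normed_vector) chart set \<Rightarrow> ('m \<Rightarrow> 'f::real_normed_vector) \<Rightarrow> 'm \<Rightarrow> 'e \<Rightarrow> 'f"
  where "fderiv \<A> f x =
    frechet_derivative (f \<circ> chart_inv (chart_at \<A> x)) (at (snd (chart_at \<A> x) x))"

text \<open>The vector field with constant components \<open>w\<close> in the chart \<open>C\<close>. For \<open>C = chart_at \<A> x\<close> its
  value at \<open>x\<close> is \<open>w\<close> itself.\<close>

definition coord_field ::
  "('m, 'e::real_normed_vector) chart set \<Rightarrow> ('m, 'e) chart \<Rightarrow> 'e \<Rightarrow> 'm \<Rightarrow> 'e"
  where "coord_field \<A> C w y =
    frechet_derivative (snd (chart_at \<A> y) \<circ> chart_inv C) (at (snd C y)) w"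


section \<open>Vector bundles and connections\<close>

text \<open>A vector bundle with typical fibre \<open>'f\<close> over \<open>'m\<close> has \<open>'m \<times> 'f\<close> as the underlying set of its
  total space, but its smooth structure is the one given by the local trivialisations
  \<open>(U, \<tau>)\<close>, where \<open>\<tau> x\<close> maps the fibre over \<open>x \<in> U\<close> to \<open>'f\<close>. Sections are thus functions
  \<open>'m \<Rightarrow> 'f\<close>, and the bundle need not be trivial. The tangent bundle has this form, with the
  trivialisations given by the differentials of the charts.\<close>

type_synonym ('m, 'f) triv = "'m set \<times> ('m \<Rightarrow> 'f \<Rightarrow> 'f)"

definition vector_bundle ::
  "('m::topological_space, 'e::real_normed_vector) chart set \<Rightarrow>
   ('m, 'f::real_normed_vector) triv set \<Rightarrow> bool"
  where "vector_bundle \<A> \<T> \<longleftrightarrow>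
    (\<Union>(U, \<tau>)\<in>\<T>. U) = UNIV \<and>
    (\<forall>(U, \<tau>)\<in>\<T>. open U \<and> (\<forall>x\<in>U. linear (\<tau> x) \<and> bij (\<tau> x))) \<and>
    (\<forall>(U, \<tau>)\<in>\<T>. \<forall>(V, \<rho>)\<in>\<T>. \<forall>w. smooth_fun \<A> (U \<inter> V) (\<lambda>x. \<rho> x (inv (\<tau> x) w)))"

definition smooth_section ::
  "('m, 'e::real_normed_vector) chart set \<Rightarrow> ('m, 'f::real_normed_vector) triv set \<Rightarrow>
   'm set \<Rightarrow> ('m \<Rightarrow> 'f) \<Rightarrow> bool"
  where "smooth_section \<A> \<T> U s \<longleftrightarrow> (\<forall>(V, \<tau>)\<in>\<T>. smooth_fun \<A> (U \<inter> V) (\<lambda>x. \<tau> x (s x)))"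

definition smooth_fun_near ::
  "('m::topological_space, 'e::real_normed_vector) chart set \<Rightarrow> 'm \<Rightarrow>
   ('m \<Rightarrow> 'f::real_normed_vector) \<Rightarrow> bool"
  where "smooth_fun_near \<A> x f \<longleftrightarrow> (\<exists>U. open U \<and> x \<in> U \<and> smooth_fun \<A> U f)"

definition smooth_section_near ::
  "('m::topological_space, 'e::real_normed_vector) chart set \<Rightarrow>
   ('m, 'f::real_normed_vector) triv set \<Rightarrow> 'm \<Rightarrow> ('m \<Rightarrow> 'f) \<Rightarrow> bool"
  where "smooth_section_near \<A> \<T> x s \<longleftrightarrow>
    (\<exists>U. open U \<and> x \<in> U \<and> smooth_section \<A> \<T> U s)"

definition tangent_triv :: "('m, 'e::real_normed_vector) chart set \<Rightarrow> ('m, 'e) triv set"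
  where "tangent_triv \<A> = {(U, fderiv \<A> c) | U c. (U, c) \<in> \<A>}"

text \<open>\<open>D x v s\<close> is the covariant derivative of \<open>s\<close> at \<open>x\<close> in the direction \<open>v\<close>; it is used for
  sections \<open>s\<close> that are smooth near \<open>x\<close>. That it depends only on the germ of \<open>s\<close> at \<open>x\<close> follows from
  the Leibniz rule, with \<open>f\<close> the indicator function of a neighbourhood of \<open>x\<close>.\<close>

definition connection ::
  "('m::topological_space, 'e::real_normed_vector) chart set \<Rightarrow>
   ('m, 'f::real_normed_vector) triv set \<Rightarrow> ('m \<Rightarrow> 'e \<Rightarrow> ('m \<Rightarrow> 'f) \<Rightarrow> 'f) \<Rightarrow> bool"
  where "connection \<A> \<T> D \<longleftrightarrow>
    (\<forall>x s. smooth_section_near \<A> \<T> x s \<longrightarrow> linear (\<lambda>v. D x v s)) \<and>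
    (\<forall>x v s t. smooth_section_near \<A> \<T> x s \<longrightarrow> smooth_section_near \<A> \<T> x t \<longrightarrow>
       D x v (\<lambda>y. s y + t y) = D x v s + D x v t) \<and>
    (\<forall>x v f s. smooth_fun_near \<A> x f \<longrightarrow> smooth_section_near \<A> \<T> x s \<longrightarrow>
       D x v (\<lambda>y. f y *\<^sub>R s y) = fderiv \<A> f x v *\<^sub>R s x + f x *\<^sub>R D x v s) \<and>
    (\<forall>U X s. open U \<longrightarrow> smooth_section \<A> (tangent_triv \<A>) U X \<longrightarrow> smooth_section \<A> \<T> U s \<longrightarrow>
       smooth_section \<A> \<T> U (\<lambda>y. D y (X y) s))"

definition lie_bracket ::
  "('m, 'e::real_normed_vector) chart set \<Rightarrow> ('m \<Rightarrow> 'e) \<Rightarrow> ('m \<Rightarrow> 'e) \<Rightarrow> 'm \<Rightarrow> 'e"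
  where "lie_bracket \<A> X Y x =
    (let comp = fderiv \<A> (snd (chart_at \<A> x))
     in fderiv \<A> (\<lambda>y. comp y (Y y)) x (X x) - fderiv \<A> (\<lambda>y. comp y (X y)) x (Y x))"

definition metric_connection ::
  "('m::topological_space, 'e::real_normed_vector) chart set \<Rightarrow>
   ('m, 'f::real_normed_vector) triv set \<Rightarrow> ('m \<Rightarrow> 'f \<Rightarrow> 'f \<Rightarrow> real) \<Rightarrow>
   ('m \<Rightarrow> 'e \<Rightarrow> ('m \<Rightarrow> 'f) \<Rightarrow> 'f) \<Rightarrow> bool"
  where "metric_connection \<A> \<T> h D \<longleftrightarrow> connection \<A> \<T> D \<and>
    (\<forall>x v s t. smooth_section_near \<A> \<T> x s \<longrightarrow> smooth_section_near \<A> \<T> x t \<longrightarrow>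
       fderiv \<A> (\<lambda>y. h y (s y) (t y)) x v = h x (D x v s) (t x) + h x (s x) (D x v t))"

definition levi_civita ::
  "('m::topological_space, 'e::real_normed_vector) chart set \<Rightarrow> ('m \<Rightarrow> 'e \<Rightarrow> 'e \<Rightarrow> real) \<Rightarrow>
   ('m \<Rightarrow> 'e \<Rightarrow> ('m \<Rightarrow> 'e) \<Rightarrow> 'e) \<Rightarrow> bool"
  where "levi_civita \<A> g D \<longleftrightarrow> metric_connection \<A> (tangent_triv \<A>) g D \<and>
    (\<forall>x X Y. smooth_section_near \<A> (tangent_triv \<A>) x X \<longrightarrow>
       smooth_section_near \<A> (tangent_triv \<A>) x Y \<longrightarrow>
       D x (X x) Y - D x (Y x) X = lie_bracket \<A> X Y x)"


section \<open>Nearly parallel G2-structures\<close>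

type_synonym form3 = "real^7 \<Rightarrow> real^7 \<Rightarrow> real^7 \<Rightarrow> real"

definition alternating3 :: "form3 \<Rightarrow> bool"
  where "alternating3 \<alpha> \<longleftrightarrow>
    (\<forall>u v. linear (\<lambda>w. \<alpha> u v w) \<and> linear (\<lambda>w. \<alpha> u w v) \<and> linear (\<lambda>w. \<alpha> w u v)) \<and>
    (\<forall>u v. \<alpha> u u v = 0 \<and> \<alpha> u v v = 0 \<and> \<alpha> u v u = 0)"

text \<open>The model 3-form is \<open>e123 + e145 - e167 + e246 + e257 + e347 - e356\<close>, with \<open>e1, \<dots>, e7\<close>
  positively oriented. With respect to this orientation the eigenvalues of
  \<open>\<beta> \<mapsto> *(\<phi> \<and> \<beta>)\<close> on 2-forms are \<open>-2\<close> (multiplicity 7) and \<open>1\<close> (multiplicity 14).\<close>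

definition model_coeff :: "nat \<Rightarrow> nat \<Rightarrow> nat \<Rightarrow> real"
  where "model_coeff i j k =
    (if (i, j, k) \<in> {(1,2,3), (1,4,5), (2,4,6), (2,5,7), (3,4,7)} then 1
     else if (i, j, k) \<in> {(1,6,7), (3,5,6)} then -1 else 0)"

definition adapted_frame :: "form3 \<Rightarrow> (nat \<Rightarrow> real^7) \<Rightarrow> bool"
  where "adapted_frame \<alpha> e \<longleftrightarrow>
    inj_on e {1..7} \<and> independent (e ` {1..7}) \<and>
    (\<forall>i\<in>{1..7}. \<forall>j\<in>{1..7}. \<forall>k\<in>{1..7}. i < j \<and> j < k \<longrightarrow>
       \<alpha> (e i) (e j) (e k) = model_coeff i j k)"

definition positive3 :: "form3 \<Rightarrow> bool"
  where "positive3 \<alpha> \<longleftrightarrow> alternating3 \<alpha> \<and> (\<exists>e. adapted_frame \<alpha> e)"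

text \<open>Two adapted frames differ by an element of \<open>G2\<close>, which lies in \<open>SO(7)\<close>; so the metric,
  the volume form and the Hodge star below do not depend on the choice made here.\<close>

definition g2_frame :: "form3 \<Rightarrow> nat \<Rightarrow> real^7"
  where "g2_frame \<alpha> = (SOME e. adapted_frame \<alpha> e)"

definition g2_coframe :: "form3 \<Rightarrow> nat \<Rightarrow> real^7 \<Rightarrow> real"
  where "g2_coframe \<alpha> i v = representation (g2_frame \<alpha> ` {1..7}) v (g2_frame \<alpha> i)"

definition g2_metric :: "form3 \<Rightarrow> real^7 \<Rightarrow> real^7 \<Rightarrow> real"
  where "g2_metric \<alpha> u v = (\<Sum>i=1..7. g2_coframe \<alpha> i u * g2_coframe \<alpha> i v)"

definition g2_volume :: "form3 \<Rightarrow> (real^7) list \<Rightarrow> real"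
  where "g2_volume \<alpha> ws =
    (\<Sum>p | p permutes {1..7::nat}. of_int (sign p) * (\<Prod>i=1..7. g2_coframe \<alpha> (p i) (ws ! (i - 1))))"

definition hodge3 :: "form3 \<Rightarrow> form3 \<Rightarrow> real^7 \<Rightarrow> real^7 \<Rightarrow> real^7 \<Rightarrow> real^7 \<Rightarrow> real"
  where "hodge3 \<alpha> \<beta> w1 w2 w3 w4 =
    (let e = g2_frame \<alpha> in
     (\<Sum>a=1..7. \<Sum>b=1..7. \<Sum>c=1..7.
        \<beta> (e a) (e b) (e c) * g2_volume \<alpha> [e a, e b, e c, w1, w2, w3, w4]) / 6)"

definition ext_deriv3 ::
  "('m, real^7) chart set \<Rightarrow> ('m \<Rightarrow> form3) \<Rightarrow> 'm \<Rightarrow>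
   real^7 \<Rightarrow> real^7 \<Rightarrow> real^7 \<Rightarrow> real^7 \<Rightarrow> real"
  where "ext_deriv3 \<A> \<phi> x v0 v1 v2 v3 =
    (let E = coord_field \<A> (chart_at \<A> x) in
       fderiv \<A> (\<lambda>y. \<phi> y (E v1 y) (E v2 y) (E v3 y)) x v0
     - fderiv \<A> (\<lambda>y. \<phi> y (E v0 y) (E v2 y) (E v3 y)) x v1
     + fderiv \<A> (\<lambda>y. \<phi> y (E v0 y) (E v1 y) (E v3 y)) x v2
     - fderiv \<A> (\<lambda>y. \<phi> y (E v0 y) (E v1 y) (E v2 y)) x v3)"

definition g2_structure :: "('m, real^7) chart set \<Rightarrow> ('m \<Rightarrow> form3) \<Rightarrow> bool"
  where "g2_structure \<A> \<phi> \<longleftrightarrow> (\<forall>x. positive3 (\<phi> x)) \<and>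
    (\<forall>C\<in>\<A>. \<forall>u v w. smooth_fun \<A> (fst C)
       (\<lambda>y. \<phi> y (coord_field \<A> C u y) (coord_field \<A> C v y) (coord_field \<A> C w y)))"

definition nearly_parallel :: "('m, real^7) chart set \<Rightarrow> ('m \<Rightarrow> form3) \<Rightarrow> bool"
  where "nearly_parallel \<A> \<phi> \<longleftrightarrow> g2_structure \<A> \<phi> \<and>
    (\<forall>x v0 v1 v2 v3. ext_deriv3 \<A> \<phi> x v0 v1 v2 v3 = 4 * hodge3 (\<phi> x) (\<phi> x) v0 v1 v2 v3)"


section \<open>Spinors\<close>

text \<open>The real spinor bundle of a Riemannian 7-manifold \<open>(M, g)\<close> with the lift of the Levi-Civita
  connection \<open>D\<close>: a rank 8 Euclidean bundle of Clifford modules with a metric connection for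
  which Clifford multiplication is parallel. As \<open>Cl_7\<close> acts on its 8-dimensional modules through
  all of \<open>End(R^8)\<close>, such a bundle comes from a spin structure and the connection is unique, hence
  it is the lift of \<open>D\<close>.\<close>

record 'm spinors =
  spin_triv :: "('m, real^8) triv set"
  spin_inner :: "'m \<Rightarrow> real^8 \<Rightarrow> real^8 \<Rightarrow> real"
  clifford :: "'m \<Rightarrow> real^7 \<Rightarrow> real^8 \<Rightarrow> real^8"
  spin_conn :: "'m \<Rightarrow> real^7 \<Rightarrow> ('m \<Rightarrow> real^8) \<Rightarrow> real^8"

definition spinor_bundle ::
  "('m::topological_space, real^7) chart set \<Rightarrow> ('m \<Rightarrow> real^7 \<Rightarrow> real^7 \<Rightarrow> real) \<Rightarrow>
   ('m \<Rightarrow> real^7 \<Rightarrow> ('m \<Rightarrow> real^7) \<Rightarrow> real^7) \<Rightarrow> 'm spinors \<Rightarrow> bool"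
  where "spinor_bundle \<A> g D S \<longleftrightarrow>
    vector_bundle \<A> (spin_triv S) \<and>
    (\<forall>x. bilinear (spin_inner S x) \<and> (\<forall>s t. spin_inner S x s t = spin_inner S x t s) \<and>
       (\<forall>s. s \<noteq> 0 \<longrightarrow> spin_inner S x s s > 0)) \<and>
    (\<forall>U s t. open U \<longrightarrow> smooth_section \<A> (spin_triv S) U s \<longrightarrow>
       smooth_section \<A> (spin_triv S) U t \<longrightarrow>
       smooth_fun \<A> U (\<lambda>y. spin_inner S y (s y) (t y))) \<and>
    (\<forall>x. bilinear (clifford S x) \<and>
       (\<forall>v s. clifford S x v (clifford S x v s) = - g x v v *\<^sub>R s) \<and>
       (\<forall>v s t. spin_inner S x (clifford S x v s) (clifford S x v t) = g x v v * spin_inner S x s t)) \<and>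
    (\<forall>U X s. open U \<longrightarrow> smooth_section \<A> (tangent_triv \<A>) U X \<longrightarrow>
       smooth_section \<A> (spin_triv S) U s \<longrightarrow>
       smooth_section \<A> (spin_triv S) U (\<lambda>y. clifford S y (X y) (s y))) \<and>
    metric_connection \<A> (spin_triv S) (spin_inner S) (spin_conn S) \<and>
    (\<forall>x v X s. smooth_section_near \<A> (tangent_triv \<A>) x X \<longrightarrow>
       smooth_section_near \<A> (spin_triv S) x s \<longrightarrow>
       spin_conn S x v (\<lambda>y. clifford S y (X y) (s y)) =
         clifford S x (D x v X) (s x) + clifford S x (X x) (spin_conn S x v s))"

definition clifford_form2 ::
  "('m \<Rightarrow> form3) \<Rightarrow> 'm spinors \<Rightarrow> 'm \<Rightarrow> (real^7 \<Rightarrow> real^7 \<Rightarrow> real) \<Rightarrow> real^8 \<Rightarrow> real^8"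
  where "clifford_form2 \<phi> S x \<beta> s =
    (let e = g2_frame (\<phi> x); c = clifford S x in
     \<Sum>a=1..7. \<Sum>b=a+1..7. \<beta> (e a) (e b) *\<^sub>R c (e a) (c (e b) s))"

definition clifford_form3 ::
  "('m \<Rightarrow> form3) \<Rightarrow> 'm spinors \<Rightarrow> 'm \<Rightarrow> form3 \<Rightarrow> real^8 \<Rightarrow> real^8"
  where "clifford_form3 \<phi> S x \<beta> s =
    (let e = g2_frame (\<phi> x); c = clifford S x in
     \<Sum>a=1..7. \<Sum>b=a+1..7. \<Sum>d=b+1..7.
       \<beta> (e a) (e b) (e d) *\<^sub>R c (e a) (c (e b) (c (e d) s)))"

text \<open>The real Killing spinor that corresponds to \<open>\<phi>\<close>.\<close>

definition killing_spinor ::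
  "('m::topological_space, real^7) chart set \<Rightarrow> ('m \<Rightarrow> form3) \<Rightarrow> 'm spinors \<Rightarrow> ('m \<Rightarrow> real^8) \<Rightarrow> bool"
  where "killing_spinor \<A> \<phi> S \<eta> \<longleftrightarrow>
    smooth_section \<A> (spin_triv S) UNIV \<eta> \<and> (\<forall>x. \<eta> x \<noteq> 0) \<and>
    (\<forall>x v. spin_conn S x v \<eta> = - (1/2) *\<^sub>R clifford S x v (\<eta> x)) \<and>
    (\<forall>x. clifford_form3 \<phi> S x (\<phi> x) (\<eta> x) = 7 *\<^sub>R \<eta> x)"

definition spin_conn_t ::
  "('m \<Rightarrow> form3) \<Rightarrow> 'm spinors \<Rightarrow> real \<Rightarrow> 'm \<Rightarrow> real^7 \<Rightarrow> ('m \<Rightarrow> real^8) \<Rightarrow> real^8"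
  where "spin_conn_t \<phi> S t x v s =
    spin_conn S x v s + (t/6) *\<^sub>R clifford_form2 \<phi> S x (\<phi> x v) (s x)"


section \<open>Principal bundles\<close>

text \<open>The group operation is written additively, following the type class \<open>group_add\<close>, which does
  not assume commutativity. The Lie algebra is the tangent space at the neutral element \<open>0\<close>.\<close>

definition lie_group ::
  "('g::{group_add, t2_space, second_countable_topology}, 'a::real_normed_vector) chart set \<Rightarrow> bool"
  where "lie_group \<G> \<longleftrightarrow> smooth_atlas \<G> \<and>
    smooth_map (prod_atlas \<G> \<G>) \<G> UNIV (\<lambda>(g, h). g + h) \<and>
    smooth_map \<G> \<G> UNIV (\<lambda>g. - g)"

definition Ad :: "('g::group_add, 'a::real_normed_vector) chart set \<Rightarrow> 'g \<Rightarrow> 'a \<Rightarrow> 'a"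
  where "Ad \<G> g = mderiv \<G> \<G> (\<lambda>h. g + h - g) 0"

record ('m, 'p, 'b, 'g, 'a) pbundle =
  total :: "('p, 'b) chart set"
  struct_grp :: "('g, 'a) chart set"
  act :: "'p \<Rightarrow> 'g \<Rightarrow> 'p"
  proj :: "'p \<Rightarrow> 'm"

text \<open>Local triviality: \<open>\<sigma>\<close> is a smooth section over \<open>U\<close>, and \<open>p \<mapsto> (proj P p, \<gamma> p)\<close> is a smooth
  inverse of \<open>U \<times> G \<rightarrow> proj P -` U\<close>, \<open>(y, g) \<mapsto> \<sigma>(y) g\<close>.\<close>

definition principal_bundle ::
  "('m::{t2_space, second_countable_topology}, 'e::real_normed_vector) chart set \<Rightarrow>
   ('m, 'p::{t2_space, second_countable_topology}, 'b::real_normed_vector,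
    'g::{group_add, t2_space, second_countable_topology}, 'a::real_normed_vector) pbundle \<Rightarrow> bool"
  where "principal_bundle \<A> P \<longleftrightarrow>
    smooth_atlas \<A> \<and> smooth_atlas (total P) \<and> lie_group (struct_grp P) \<and>
    smooth_map (total P) \<A> UNIV (proj P) \<and>
    smooth_map (prod_atlas (total P) (struct_grp P)) (total P) UNIV (\<lambda>(p, g). act P p g) \<and>
    (\<forall>p. act P p 0 = p) \<and>
    (\<forall>p g h. act P (act P p g) h = act P p (g + h)) \<and>
    (\<forall>p g. proj P (act P p g) = proj P p) \<and>
    (\<forall>x. \<exists>U \<sigma> \<gamma>. open U \<and> x \<in> U \<and>
       smooth_map \<A> (total P) U \<sigma> \<and> (\<forall>y\<in>U. proj P (\<sigma> y) = y) \<and>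
       smooth_map (total P) (struct_grp P) (proj P -` U) \<gamma> \<and>
       (\<forall>p. proj P p \<in> U \<longrightarrow> act P (\<sigma> (proj P p)) (\<gamma> p) = p) \<and>
       (\<forall>y\<in>U. \<forall>g. \<gamma> (act P (\<sigma> y) g) = g))"

text \<open>Connection 1-forms on the total space; the fundamental vector field of \<open>\<xi>\<close> has the value
  \<open>mderiv (struct_grp P) (total P) (act P p) 0 \<xi>\<close> at \<open>p\<close>.\<close>

definition principal_connection ::
  "('m, 'p::topological_space, 'b::real_normed_vector, 'g::group_add, 'a::real_normed_vector) pbundle \<Rightarrow>
   ('p \<Rightarrow> 'b \<Rightarrow> 'a) \<Rightarrow> bool"
  where "principal_connection P A \<longleftrightarrow>
    (\<forall>p. linear (A p)) \<and>
    (\<forall>C\<in>total P. \<forall>w. smooth_fun (total P) (fst C) (\<lambda>p. A p (coord_field (total P) C w p))) \<and>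
    (\<forall>p \<xi>. A p (mderiv (struct_grp P) (total P) (act P p) 0 \<xi>) = \<xi>) \<and>
    (\<forall>p g v. A (act P p g) (mderiv (total P) (total P) (\<lambda>q. act P q g) p v) =
       Ad (struct_grp P) (- g) (A p v))"

definition horizontal_lift ::
  "('m, 'e::real_normed_vector) chart set \<Rightarrow>
   ('m, 'p, 'b::real_normed_vector, 'g, 'a::real_normed_vector) pbundle \<Rightarrow>
   ('p \<Rightarrow> 'b \<Rightarrow> 'a) \<Rightarrow> 'p \<Rightarrow> 'e \<Rightarrow> 'b"
  where "horizontal_lift \<A> P A p v = (THE w. mderiv (total P) \<A> (proj P) p w = v \<and> A p w = 0)"

text \<open>Here and below, a section of \<open>E \<otimes> Ad_P\<close> is given by the corresponding equivariant function
  on \<open>'p\<close> whose value at \<open>p\<close> lies in \<open>E\<^sub>x \<otimes> 'a\<close>, where \<open>x = proj P p\<close> and \<open>'a\<close> is the Lie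
  algebra. This is the covariant derivative on \<open>Ad_P\<close>, at \<open>p\<close> and in the direction \<open>v \<in> T\<^sub>x M\<close>.\<close>

definition ad_deriv ::
  "('m, 'e::real_normed_vector) chart set \<Rightarrow>
   ('m, 'p, 'b::real_normed_vector, 'g, 'a::real_normed_vector) pbundle \<Rightarrow>
   ('p \<Rightarrow> 'b \<Rightarrow> 'a) \<Rightarrow> 'p \<Rightarrow> 'e \<Rightarrow> ('p \<Rightarrow> 'a) \<Rightarrow> 'a"
  where "ad_deriv \<A> P A p v f = fderiv (total P) f p (horizontal_lift \<A> P A p v)"

definition ext_deriv1 ::
  "('p, 'b::real_normed_vector) chart set \<Rightarrow> ('p \<Rightarrow> 'b \<Rightarrow> 'a::real_normed_vector) \<Rightarrow> 'p \<Rightarrow> 'b \<Rightarrow> 'b \<Rightarrow> 'a"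
  where "ext_deriv1 \<B> \<theta> p v w =
    (let E = coord_field \<B> (chart_at \<B> p)
     in fderiv \<B> (\<lambda>q. \<theta> q (E w q)) p v - fderiv \<B> (\<lambda>q. \<theta> q (E v q)) p w)"

definition curvature ::
  "('m, 'e::real_normed_vector) chart set \<Rightarrow>
   ('m, 'p, 'b::real_normed_vector, 'g, 'a::real_normed_vector) pbundle \<Rightarrow>
   ('p \<Rightarrow> 'b \<Rightarrow> 'a) \<Rightarrow> 'p \<Rightarrow> 'e \<Rightarrow> 'e \<Rightarrow> 'a"
  where "curvature \<A> P A p v w =
    ext_deriv1 (total P) A p (horizontal_lift \<A> P A p v) (horizontal_lift \<A> P A p w)"


section \<open>Instantons and their infinitesimal deformations\<close>

text \<open>\<open>R^8 \<otimes> 'a\<close> is identified with \<open>'a^8\<close> by means of the standard basis of \<open>R^8\<close>;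
  \<open>map_left L\<close> is \<open>L \<otimes> id\<close>.\<close>

definition tensor :: "real^8 \<Rightarrow> 'a::real_vector \<Rightarrow> 'a^8"
  where "tensor s a = (\<chi> i. s $ i *\<^sub>R a)"

definition map_left :: "(real^8 \<Rightarrow> real^8) \<Rightarrow> ('a::real_vector)^8 \<Rightarrow> 'a^8"
  where "map_left L \<mu> = (\<Sum>i\<in>UNIV. tensor (L (axis i 1)) (\<mu> $ i))"

definition ad_clifford1 ::
  "('m \<Rightarrow> form3) \<Rightarrow> 'm spinors \<Rightarrow> ('m \<Rightarrow> real^8) \<Rightarrow> ('m, 'p, 'b, 'g, 'a::real_vector) pbundle \<Rightarrow>
   ('p \<Rightarrow> real^7 \<Rightarrow> 'a) \<Rightarrow> 'p \<Rightarrow> 'a^8"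
  where "ad_clifford1 \<phi> S \<eta> P \<epsilon> p =
    (let x = proj P p; e = g2_frame (\<phi> x)
     in \<Sum>a=1..7. tensor (clifford S x (e a) (\<eta> x)) (\<epsilon> p (e a)))"

definition ad_clifford2 ::
  "('m \<Rightarrow> form3) \<Rightarrow> 'm spinors \<Rightarrow> ('m \<Rightarrow> real^8) \<Rightarrow> ('m, 'p, 'b, 'g, 'a::real_vector) pbundle \<Rightarrow>
   ('p \<Rightarrow> real^7 \<Rightarrow> real^7 \<Rightarrow> 'a) \<Rightarrow> 'p \<Rightarrow> 'a^8"
  where "ad_clifford2 \<phi> S \<eta> P \<beta> p =
    (let x = proj P p; e = g2_frame (\<phi> x)
     in \<Sum>a=1..7. \<Sum>b=a+1..7.
          tensor (clifford S x (e a) (clifford S x (e b) (\<eta> x))) (\<beta> p (e a) (e b)))"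

definition g2_instanton ::
  "('m, real^7) chart set \<Rightarrow> ('m \<Rightarrow> form3) \<Rightarrow> 'm spinors \<Rightarrow> ('m \<Rightarrow> real^8) \<Rightarrow>
   ('m, 'p::topological_space, 'b::real_normed_vector, 'g::group_add, 'a::real_normed_vector) pbundle \<Rightarrow>
   ('p \<Rightarrow> 'b \<Rightarrow> 'a) \<Rightarrow> bool"
  where "g2_instanton \<A> \<phi> S \<eta> P A \<longleftrightarrow>
    principal_connection P A \<and> ad_clifford2 \<phi> S \<eta> P (curvature \<A> P A) = (\<lambda>p. 0)"

text \<open>Smooth sections of \<open>T*M \<otimes> Ad_P\<close>.\<close>

definition ad_1forms ::
  "('m, real^7) chart set \<Rightarrow>
   ('m, 'p, 'b::real_normed_vector, 'g::group_add, 'a::real_normed_vector) pbundle \<Rightarrow>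
   ('p \<Rightarrow> real^7 \<Rightarrow> 'a) set"
  where "ad_1forms \<A> P = {\<epsilon>.
    (\<forall>p. linear (\<epsilon> p)) \<and>
    (\<forall>p g v. \<epsilon> (act P p g) v = Ad (struct_grp P) (- g) (\<epsilon> p v)) \<and>
    (\<forall>C\<in>\<A>. \<forall>w. smooth_fun (total P) (proj P -` fst C)
       (\<lambda>p. \<epsilon> p (coord_field \<A> C w (proj P p))))}"

text \<open>The exterior covariant derivative of a 1-form, evaluated by means of commuting coordinate
  fields, and the codifferential, which is minus the trace of the covariant derivative
  \<open>(\<nabla>\<^sub>v \<epsilon>)(w) = \<nabla>\<^sub>v (\<epsilon>(W)) - \<epsilon>(D\<^sub>v W)\<close>, with \<open>W\<close> extending \<open>w\<close>.\<close>

definition ad_ext_deriv1 ::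
  "('m, real^7) chart set \<Rightarrow>
   ('m, 'p, 'b::real_normed_vector, 'g, 'a::real_normed_vector) pbundle \<Rightarrow> ('p \<Rightarrow> 'b \<Rightarrow> 'a) \<Rightarrow>
   ('p \<Rightarrow> real^7 \<Rightarrow> 'a) \<Rightarrow> 'p \<Rightarrow> real^7 \<Rightarrow> real^7 \<Rightarrow> 'a"
  where "ad_ext_deriv1 \<A> P A \<epsilon> p v w =
    (let E = coord_field \<A> (chart_at \<A> (proj P p)) in
       ad_deriv \<A> P A p v (\<lambda>q. \<epsilon> q (E w (proj P q)))
     - ad_deriv \<A> P A p w (\<lambda>q. \<epsilon> q (E v (proj P q))))"

definition ad_codiff1 ::
  "('m, real^7) chart set \<Rightarrow> ('m \<Rightarrow> form3) \<Rightarrow> ('m \<Rightarrow> real^7 \<Rightarrow> ('m \<Rightarrow> real^7) \<Rightarrow> real^7) \<Rightarrow>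
   ('m, 'p, 'b::real_normed_vector, 'g, 'a::real_normed_vector) pbundle \<Rightarrow> ('p \<Rightarrow> 'b \<Rightarrow> 'a) \<Rightarrow>
   ('p \<Rightarrow> real^7 \<Rightarrow> 'a) \<Rightarrow> 'p \<Rightarrow> 'a"
  where "ad_codiff1 \<A> \<phi> D P A \<epsilon> p =
    (let x = proj P p; e = g2_frame (\<phi> x); E = coord_field \<A> (chart_at \<A> x) in
     - (\<Sum>a=1..7. ad_deriv \<A> P A p (e a) (\<lambda>q. \<epsilon> q (E (e a) (proj P q)))
                - \<epsilon> p (D x (e a) (E (e a)))))"

definition infinitesimal_deformations ::
  "('m, real^7) chart set \<Rightarrow> ('m \<Rightarrow> form3) \<Rightarrow> ('m \<Rightarrow> real^7 \<Rightarrow> ('m \<Rightarrow> real^7) \<Rightarrow> real^7) \<Rightarrow>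
   'm spinors \<Rightarrow> ('m \<Rightarrow> real^8) \<Rightarrow>
   ('m, 'p, 'b::real_normed_vector, 'g::group_add, 'a::real_normed_vector) pbundle \<Rightarrow>
   ('p \<Rightarrow> 'b \<Rightarrow> 'a) \<Rightarrow> ('p \<Rightarrow> real^7 \<Rightarrow> 'a) set"
  where "infinitesimal_deformations \<A> \<phi> D S \<eta> P A = {\<epsilon> \<in> ad_1forms \<A> P.
    ad_clifford2 \<phi> S \<eta> P (ad_ext_deriv1 \<A> P A \<epsilon>) = (\<lambda>p. 0) \<and>
    ad_codiff1 \<A> \<phi> D P A \<epsilon> = (\<lambda>p. 0)}"

text \<open>The connection on \<open>S \<otimes> Ad_P\<close> induced by \<open>\<nabla>^t\<close> and \<open>A\<close>: if \<open>\<mu> = \<Sum>\<^sub>i s\<^sub>i \<otimes> a\<^sub>i\<close>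
  for a local frame \<open>s\<^sub>i\<close> of \<open>S\<close> and local sections \<open>a\<^sub>i\<close> of \<open>Ad_P\<close>, then
  \<open>\<nabla>\<^sub>v \<mu> = \<Sum>\<^sub>i (\<nabla>\<^sub>v s\<^sub>i \<otimes> a\<^sub>i + s\<^sub>i \<otimes> \<nabla>\<^sub>v a\<^sub>i)\<close>. The frame used is the one of a local
  trivialisation around the point in question; the result does not depend on the frame.\<close>

definition twisted_conn ::
  "('m, real^7) chart set \<Rightarrow> ('m \<Rightarrow> form3) \<Rightarrow> 'm spinors \<Rightarrow>
   ('m, 'p, 'b::real_normed_vector, 'g, 'a::real_normed_vector) pbundle \<Rightarrow> ('p \<Rightarrow> 'b \<Rightarrow> 'a) \<Rightarrow>
   real \<Rightarrow> 'p \<Rightarrow> real^7 \<Rightarrow> ('p \<Rightarrow> 'a^8) \<Rightarrow> 'a^8"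
  where "twisted_conn \<A> \<phi> S P A t p v \<mu> =
    (let x = proj P p;
         \<tau> = snd (SOME T. T \<in> spin_triv S \<and> x \<in> fst T);
         s = (\<lambda>i y. inv (\<tau> y) (axis i 1));
         a = (\<lambda>i q. map_left (\<tau> (proj P q)) (\<mu> q) $ i)
     in \<Sum>i\<in>UNIV. tensor (spin_conn_t \<phi> S t x v (s i)) (a i p)
                 + tensor (s i x) (ad_deriv \<A> P A p v (a i)))"

definition twisted_dirac ::
  "('m, real^7) chart set \<Rightarrow> ('m \<Rightarrow> form3) \<Rightarrow> 'm spinors \<Rightarrow>
   ('m, 'p, 'b::real_normed_vector, 'g, 'a::real_normed_vector) pbundle \<Rightarrow> ('p \<Rightarrow> 'b \<Rightarrow> 'a) \<Rightarrow>
   real \<Rightarrow> ('p \<Rightarrow> 'a^8) \<Rightarrow> 'p \<Rightarrow> 'a^8"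
  where "twisted_dirac \<A> \<phi> S P A t \<mu> p =
    (let x = proj P p; e = g2_frame (\<phi> x)
     in \<Sum>a=1..7. map_left (clifford S x (e a)) (twisted_conn \<A> \<phi> S P A t p (e a) \<mu>))"

end

theory Submission
  imports Defs
begin

text \<open>The two spaces are equal. For an \<open>Ad\<close>-valued 1-form \<open>\<epsilon>\<close> and an orthonormal frame \<open>e\<^sub>a\<close>,
  \<open>\<nabla>\<^sub>X \<eta> = - 1/2 X \<cdot> \<eta>\<close> and \<open>\<Sum>\<^sub>a e\<^sub>a \<cdot> \<epsilon> \<cdot> e\<^sub>a = 5 \<epsilon>\<close> give
  \<open>D^{0,A}(\<epsilon> \<cdot> \<eta>) = (d\<epsilon>) \<cdot> \<eta> + (d*\<epsilon>) \<eta> - 5/2 \<epsilon> \<cdot> \<eta>\<close>. Passing to \<open>t = -1\<close> adds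
  \<open>- 1/6 \<Sum>\<^sub>a e\<^sub>a \<cdot> (i\<^sub>a \<phi>) \<cdot> \<epsilon> \<cdot> \<eta> = - 1/2 \<phi> \<cdot> \<epsilon> \<cdot> \<eta> = 1/2 \<epsilon> \<cdot> \<eta>\<close>, because \<open>\<phi>\<close> acts on
  \<open>\<Lambda>^1 \<cdot> \<eta>\<close> by \<open>-1\<close>. Hence \<open>(D^{-1,A} + 2)(\<epsilon> \<cdot> \<eta>) = (d\<epsilon>) \<cdot> \<eta> + (d*\<epsilon>) \<eta>\<close>. As \<open>(d\<epsilon>) \<cdot> \<eta>\<close> is
  pointwise orthogonal to \<open>\<eta>\<close>, the right-hand side vanishes iff both summands do.

  The covariant derivative of \<open>\<epsilon> \<cdot> \<eta>\<close> is computed by pairing with the smooth sections \<open>\<eta>\<close> and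
  \<open>W \<cdot> \<eta>\<close>, which span the spinors: the pairings are \<open>0\<close> and \<open>|\<eta>|\<^sup>2 \<epsilon>(W)\<close>, so that no smooth
  orthonormal frame and no inverse metric is needed.\<close>

section \<open>Smooth functions\<close>

text \<open>The frame \<open>g2_frame\<close> is picked by \<open>SOME\<close> at each point
  separately, so no continuity in the point is available, yet \<open>ad_clifford1\<close>, and with
  it the coefficients that \<open>twisted_conn\<close> differentiates, is written in that frame.
  \<open>frechet_derivative\<close> says nothing about a function not known to be differentiable;
  hence differentiability of the coefficients must precede every Leibniz rule. It comes from
  Cramer's rule: the pairings with \<eta> and with seven sections \<open>W \<cdot> \<eta>\<close>
  form an 8 by 8 linear system for the coefficients, with differentiable data and a matrix
  invertible at the point. A second indirect term is \<open>horizontal_lift\<close>, a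
  \<open>THE\<close> expression whose meaning rests on local triviality of the bundle.\<close>

lemma C_k_imp_continuous_on: "C_k k S f \<Longrightarrow> continuous_on S f"
  by (cases k) (auto intro!: continuous_at_imp_continuous_on differentiable_imp_continuous_within)

lemma C_k_SucD: "C_k (Suc k) S f \<Longrightarrow> C_k k S f"
proof (induction k arbitrary: f)
  case 0
  then show ?case using C_k_imp_continuous_on C_k.simps(1) by blast
next
  case (Suc k)
  then show ?case by (metis C_k.simps(2))
qed

lemma C_k_subset: "C_k k S f \<Longrightarrow> T \<subseteq> S \<Longrightarrow> C_k k T f"
  by (induction k arbitrary: f) (auto intro: continuous_on_subset)

text \<open>\<open>C_k\<close> uses the derivative \<open>at x\<close>, not within \<open>S\<close>.
  Since \<open>S\<close> is open, the values on \<open>S\<close> already determine it.\<close>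

lemma C_k_cong:
  assumes "open S" "\<And>x. x \<in> S \<Longrightarrow> f x = g x" "C_k k S f"
  shows "C_k k S g"
  using assms(2,3)
proof (induction k arbitrary: f g)
  case 0
  then show ?case by (auto cong: continuous_on_cong)
next
  case (Suc k)
  have d: "(g has_derivative frechet_derivative f (at x)) (at x)" if "x \<in> S" for x
    using Suc.prems that assms(1)
    by (auto simp: frechet_derivative_works intro: has_derivative_transform_within_open)
  then have e: "frechet_derivative f (at x) = frechet_derivative g (at x)" if "x \<in> S" for x
    using that by (blast intro: frechet_derivative_at)
  show ?case
  proof -
    have "C_k k S (\<lambda>x. frechet_derivative g (at x) v)" for v
    proof (rule Suc.IH)
      show "C_k k S (\<lambda>x. frechet_derivative f (at x) v)" using Suc.prems(2) by simp
    qed (simp only: e)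
    then show ?thesis using d by (auto simp: differentiable_def)
  qed
qed

text \<open>Lets the sum, product and chain rules enter with whatever formula they give for the
  derivative; uniqueness of derivatives identifies it with
  \<open>frechet_derivative\<close>.\<close>

lemma C_k_SucI:
  assumes "open S" "\<And>x. x \<in> S \<Longrightarrow> (f has_derivative f' x) (at x)"
    and "\<And>v. C_k k S (\<lambda>x. f' x v)"
  shows "C_k (Suc k) S f"
proof -
  have "C_k k S (\<lambda>x. frechet_derivative f (at x) v)" for v
    using assms by (intro C_k_cong[OF assms(1) _ assms(3)[of v]]) (metis frechet_derivative_at)
  then show ?thesis using assms(2) by (auto simp: differentiable_def)
qed

lemma C_k_SucE:
  assumes "C_k (Suc k) S f" "x \<in> S"
  shows "(f has_derivative frechet_derivative f (at x)) (at x)"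
  using assms by (simp add: frechet_derivative_works)

lemma C_k_const: "open S \<Longrightarrow> C_k k S (\<lambda>x. a)"
proof (induction k arbitrary: a)
  case (Suc k)
  show ?case by (rule C_k_SucI[OF Suc.prems has_derivative_const]) (rule Suc.IH[OF Suc.prems])
qed simp

lemma C_k_bounded_linear:
  assumes "bounded_linear L" "open S"
  shows "C_k k S f \<Longrightarrow> C_k k S (\<lambda>x. L (f x))"
proof (induction k arbitrary: f)
  case 0
  then show ?case using bounded_linear.continuous_on[OF assms(1)] by simp
next
  case (Suc k)
  show ?case
    by (rule C_k_SucI[OF assms(2) bounded_linear.has_derivative[OF assms(1) C_k_SucE[OF Suc.prems]]])
      (use Suc in simp_all)
qed

lemma C_k_add:
  assumes "open S"
  shows "C_k k S f \<Longrightarrow> C_k k S g \<Longrightarrow> C_k k S (\<lambda>x. f x + g x)"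
proof (induction k arbitrary: f g)
  case 0
  then show ?case by (simp add: continuous_on_add)
next
  case (Suc k)
  show ?case
    by (rule C_k_SucI[OF assms has_derivative_add[OF C_k_SucE[OF Suc.prems(1)] C_k_SucE[OF Suc.prems(2)]]])
      (use Suc in simp_all)
qed

lemma C_k_sum:
  assumes "open S" "\<And>i. i \<in> I \<Longrightarrow> C_k k S (f i)"
  shows "C_k k S (\<lambda>x. \<Sum>i\<in>I. f i x)"
  using assms(2)
  by (induction I rule: infinite_finite_induct) (auto intro: C_k_const C_k_add assms(1))

lemma C_k_scaleR:
  assumes "open S"
  shows "C_k k S f \<Longrightarrow> C_k k S g \<Longrightarrow> C_k k S (\<lambda>x. f x *\<^sub>R g x)"
proof (induction k arbitrary: f g)
  case 0
  then show ?case by (simp add: continuous_on_scaleR)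
next
  case (Suc k)
  have "C_k k S f" "C_k k S g" using Suc.prems by (auto intro: C_k_SucD)
  then have "C_k k S (\<lambda>x. f x *\<^sub>R frechet_derivative g (at x) v + frechet_derivative f (at x) v *\<^sub>R g x)" for v
    using Suc.prems by (intro C_k_add[OF assms] Suc.IH) simp_all
  with Suc.prems show ?case
    by - (rule C_k_SucI[OF assms has_derivative_scaleR[OF C_k_SucE[OF Suc.prems(1)] C_k_SucE[OF Suc.prems(2)]]])
qed

text \<open>\<open>C_k\<close> controls derivatives in fixed directions only, while the chain rule
  differentiates \<open>f\<close> in the moving direction given by the derivative of
  \<open>g\<close>. Expanding that direction in the finite \<open>Basis\<close> of the middle space
  turns the derivative of the composite into a sum of products covered by the induction
  hypothesis.\<close>

lemma C_k_compose:
  fixes f :: "'b::euclidean_space \<Rightarrow> 'c::real_normed_vector"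
    and g :: "'a::real_normed_vector \<Rightarrow> 'b"
  assumes "open S" "g ` S \<subseteq> T"
  shows "C_k k T f \<Longrightarrow> C_k k S g \<Longrightarrow> C_k k S (f \<circ> g)"
proof (induction k arbitrary: f)
  case 0
  then show ?case
    using assms continuous_on_compose[of S g f] continuous_on_subset[of T f "g ` S"] by simp
next
  case (Suc k)
  have lin: "frechet_derivative f (at (g x)) u =
      (\<Sum>b\<in>Basis. (u \<bullet> b) *\<^sub>R frechet_derivative f (at (g x)) b)" if "x \<in> S" for x u
  proof -
    have "linear (frechet_derivative f (at (g x)))"
      using Suc.prems(1) that assms(2) by (intro linear_frechet_derivative) auto
    then have "frechet_derivative f (at (g x)) (\<Sum>b\<in>Basis. (u \<bullet> b) *\<^sub>R b) =
      (\<Sum>b\<in>Basis. (u \<bullet> b) *\<^sub>R frechet_derivative f (at (g x)) b)"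
      by (simp add: linear_sum linear_scale)
    then show ?thesis by (simp add: euclidean_representation)
  qed
  have "((f \<circ> g) has_derivative
      (\<lambda>v. \<Sum>b\<in>Basis. (frechet_derivative g (at x) v \<bullet> b) *\<^sub>R frechet_derivative f (at (g x)) b)) (at x)"
    if "x \<in> S" for x
  proof -
    have "(f has_derivative frechet_derivative f (at (g x))) (at (g x))"
      using C_k_SucE[OF Suc.prems(1)] that assms(2) by blast
    from diff_chain_at[OF C_k_SucE[OF Suc.prems(2) that] this]
    show ?thesis by (simp add: o_def lin[OF that, symmetric])
  qed
  moreover have "C_k k S (\<lambda>x. \<Sum>b\<in>Basis. (frechet_derivative g (at x) v \<bullet> b) *\<^sub>R
      frechet_derivative f (at (g x)) b)" for v
  proof (intro C_k_sum C_k_scaleR assms(1))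
    fix b :: 'b
    show "C_k k S (\<lambda>x. frechet_derivative g (at x) v \<bullet> b)"
      by (rule C_k_bounded_linear[OF bounded_linear_inner_left assms(1)]) (use Suc.prems in auto)
    show "C_k k S (\<lambda>x. frechet_derivative f (at (g x)) b)"
      using Suc.IH[of "\<lambda>y. frechet_derivative f (at y) b"] Suc.prems C_k_SucD[OF Suc.prems(2)]
      by (simp add: o_def)
  qed
  ultimately show ?case by (rule C_k_SucI[OF assms(1)])
qed

lemma smooth_on_compose:
  fixes f :: "'b::euclidean_space \<Rightarrow> 'c::real_normed_vector"
  shows "open S \<Longrightarrow> g ` S \<subseteq> T \<Longrightarrow> smooth_on T f \<Longrightarrow> smooth_on S g \<Longrightarrow> smooth_on S (f \<circ> g)"
  unfolding smooth_on_def using C_k_compose by blast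

lemma smooth_on_subset: "smooth_on S f \<Longrightarrow> T \<subseteq> S \<Longrightarrow> smooth_on T f"
  unfolding smooth_on_def using C_k_subset by blast

lemma smooth_on_differentiable: "smooth_on S f \<Longrightarrow> x \<in> S \<Longrightarrow> f differentiable (at x)"
  unfolding smooth_on_def by (metis C_k.simps(2))

lemma smooth_on_frechet_derivative:
  "smooth_on S f \<Longrightarrow> smooth_on S (\<lambda>x. frechet_derivative f (at x) v)"
  unfolding smooth_on_def by (metis C_k.simps(2))

lemma smooth_on_cong:
  "open S \<Longrightarrow> (\<And>x. x \<in> S \<Longrightarrow> f x = g x) \<Longrightarrow> smooth_on S f \<Longrightarrow> smooth_on S g"
  unfolding smooth_on_def using C_k_cong by blast

section \<open>Differentiation on manifolds\<close>

lemma smooth_fun_subset: "smooth_fun \<A> U f \<Longrightarrow> V \<subseteq> U \<Longrightarrow> smooth_fun \<A> V f"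
  unfolding smooth_fun_def by (fastforce intro: smooth_on_subset)

lemma smooth_section_subset: "smooth_section \<A> \<T> U s \<Longrightarrow> V \<subseteq> U \<Longrightarrow> smooth_section \<A> \<T> V s"
  unfolding smooth_section_def
  by (auto elim!: ballE intro: smooth_fun_subset[OF _ Int_mono])

lemma smooth_section_nearI:
  "smooth_section \<A> \<T> U s \<Longrightarrow> open U \<Longrightarrow> x \<in> U \<Longrightarrow> smooth_section_near \<A> \<T> x s"
  unfolding smooth_section_near_def by blast

lemma
  assumes "smooth_atlas \<A>"
  shows chart_at_in_atlas: "chart_at \<A> x \<in> \<A>"
    and in_chart_at: "x \<in> fst (chart_at \<A> x)"
proof -
  have "(\<Union>(U, c)\<in>\<A>. U) = UNIV" using assms by (simp add: smooth_atlas_def)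
  then have "\<exists>C. C \<in> \<A> \<and> x \<in> fst C" by (metis UNIV_I UN_E case_prod_unfold)
  from someI_ex[OF this] show "chart_at \<A> x \<in> \<A>" "x \<in> fst (chart_at \<A> x)"
    by (simp_all add: chart_at_def)
qed

lemma
  assumes "smooth_atlas \<A>" "C \<in> \<A>"
  shows open_chart: "open (fst C)"
    and open_chart_image: "open (snd C ` fst C)"
    and homeomorphism_chart: "homeomorphism (fst C) (snd C ` fst C) (snd C) (chart_inv C)"
proof -
  have "\<forall>(U, c)\<in>\<A>. open U \<and> open (c ` U) \<and> homeomorphism U (c ` U) c (chart_inv (U, c))"
    using assms(1) by (simp add: smooth_atlas_def)
  from bspec[OF this assms(2)]
  show "open (fst C)" "open (snd C ` fst C)"
    "homeomorphism (fst C) (snd C ` fst C) (snd C) (chart_inv C)"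
    by (simp_all add: case_prod_unfold)
qed

lemma chart_inv_chart:
  assumes "smooth_atlas \<A>" "C \<in> \<A>" "y \<in> fst C"
  shows "chart_inv C (snd C y) = y"
  using homeomorphism_chart[OF assms(1,2)] assms(3) by (simp add: homeomorphism_def)

lemma open_chart_image_subset:
  assumes "smooth_atlas \<A>" "C \<in> \<A>" "open W" "W \<subseteq> fst C"
  shows "open (snd C ` W)"
proof -
  have "openin (top_of_set (snd C ` fst C)) (snd C ` W)"
    using homeomorphism_imp_open_map[OF homeomorphism_chart[OF assms(1,2)]] assms(3,4)
    by (metis inf.absorb_iff2 openin_open_Int)
  then show ?thesis using open_chart_image[OF assms(1,2)] openin_open_trans by blast
qed

lemma filterlim_nhds_of_continuous_on:
  assumes "continuous_on U f" "open U" "x \<in> U"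
  shows "filterlim f (nhds (f x)) (nhds x)"
proof -
  have "(f \<longlongrightarrow> f x) (at x)"
    using assms by (metis at_within_open continuous_on_def)
  then show ?thesis using tendsto_at_within_iff_tendsto_nhds[of f x UNIV] by simp
qed

lemma chart_inv_tendsto:
  assumes "smooth_atlas \<A>" "C \<in> \<A>" "y \<in> fst C"
  shows "filterlim (chart_inv C) (nhds y) (nhds (snd C y))"
  using filterlim_nhds_of_continuous_on[of "snd C ` fst C" "chart_inv C" "snd C y"]
    homeomorphism_chart[OF assms(1,2)] open_chart_image[OF assms(1,2)] chart_inv_chart[OF assms] assms(3)
  by (simp add: homeomorphism_def)

lemma smooth_transition:
  assumes "smooth_atlas \<A>" "C \<in> \<A>" "C' \<in> \<A>"
  shows "smooth_on (snd C ` (fst C \<inter> fst C')) (snd C' \<circ> chart_inv C)"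
proof -
  have "\<forall>(U, c)\<in>\<A>. \<forall>(V, d)\<in>\<A>. smooth_on (c ` (U \<inter> V)) (d \<circ> chart_inv (U, c))"
    using assms(1) by (simp add: smooth_atlas_def)
  from bspec[OF this assms(2)] have
    "\<forall>(V, d)\<in>\<A>. smooth_on (snd C ` (fst C \<inter> V)) (d \<circ> chart_inv C)"
    by (simp add: case_prod_unfold)
  from bspec[OF this assms(3)] show ?thesis by (simp add: case_prod_unfold)
qed

lemma smooth_funD:
  "smooth_fun \<A> U f \<Longrightarrow> C \<in> \<A> \<Longrightarrow> smooth_on (snd C ` (U \<inter> fst C)) (f \<circ> chart_inv C)"
  unfolding smooth_fun_def by (drule (1) bspec) (simp add: case_prod_unfold)

text \<open>Differentiability in the very chart that \<open>fderiv\<close> uses; only under it does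
  \<open>frechet_derivative\<close> carry information. It follows from smoothness, and the Leibniz
  rules below are stated in terms of it.\<close>

definition fdiff ::
  "('m, 'e::real_normed_vector) chart set \<Rightarrow> ('m \<Rightarrow> 'f::real_normed_vector) \<Rightarrow> 'm \<Rightarrow> bool"
  where "fdiff \<A> f x \<longleftrightarrow> (f \<circ> chart_inv (chart_at \<A> x)) differentiable (at (snd (chart_at \<A> x) x))"

lemma fdiff_has_derivative:
  "fdiff \<A> f x \<Longrightarrow>
    ((\<lambda>z. f (chart_inv (chart_at \<A> x) z)) has_derivative fderiv \<A> f x) (at (snd (chart_at \<A> x) x))"
  unfolding fdiff_def fderiv_def by (simp add: frechet_derivative_works o_def)

lemma has_derivative_fdiff:
  assumes "((\<lambda>z. f (chart_inv (chart_at \<A> x) z)) has_derivative L) (at (snd (chart_at \<A> x) x))"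
  shows "fdiff \<A> f x" "fderiv \<A> f x = L"
  using assms frechet_derivative_at[OF assms]
  unfolding fdiff_def fderiv_def by (auto simp: differentiable_def o_def)

lemma smooth_fun_fdiff:
  assumes "smooth_atlas \<A>" "smooth_fun \<A> U f" "x \<in> U"
  shows "fdiff \<A> f x"
  unfolding fdiff_def
  by (rule smooth_on_differentiable[OF smooth_funD[OF assms(2) chart_at_in_atlas[OF assms(1), of x]]])
    (use assms(3) in_chart_at[OF assms(1), of x] in blast)

lemma fderiv_add:
  assumes "fdiff \<A> f x" "fdiff \<A> g x"
  shows "fderiv \<A> (\<lambda>y. f y + g y) x v = fderiv \<A> f x v + fderiv \<A> g x v"
  using has_derivative_fdiff[where f = "\<lambda>y. f y + g y", OF has_derivative_add[OF fdiff_has_derivative[OF assms(1)] fdiff_has_derivative[OF assms(2)]]]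
  by auto

lemma fdiff_const: "fdiff \<A> (\<lambda>y. a) x" and fderiv_const: "fderiv \<A> (\<lambda>y. a) x v = 0"
  using has_derivative_fdiff[where f = "\<lambda>y. a" and L = "\<lambda>v. 0" and \<A> = \<A> and x = x] by auto

lemma
  assumes "\<And>i. i \<in> I \<Longrightarrow> fdiff \<A> (f i) x"
  shows fdiff_sum: "fdiff \<A> (\<lambda>y. \<Sum>i\<in>I. f i y) x"
    and fderiv_sum: "fderiv \<A> (\<lambda>y. \<Sum>i\<in>I. f i y) x v = (\<Sum>i\<in>I. fderiv \<A> (f i) x v)"
  using has_derivative_fdiff[where f = "\<lambda>y. \<Sum>i\<in>I. f i y", OF has_derivative_sum[OF fdiff_has_derivative[OF assms]]]
  by auto

lemma
  assumes "fdiff \<A> f x" "fdiff \<A> g x" "chart_inv (chart_at \<A> x) (snd (chart_at \<A> x) x) = x"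
  shows fdiff_scaleR: "fdiff \<A> (\<lambda>y. f y *\<^sub>R g y) x"
    and fderiv_scaleR: "fderiv \<A> (\<lambda>y. f y *\<^sub>R g y) x v = fderiv \<A> f x v *\<^sub>R g x + f x *\<^sub>R fderiv \<A> g x v"
  using has_derivative_fdiff[where f = "\<lambda>y. f y *\<^sub>R g y", OF has_derivative_scaleR[OF fdiff_has_derivative[OF assms(1)] fdiff_has_derivative[OF assms(2)]]]
  by (auto simp: assms(3))

lemma chart_inv_chart_at: "smooth_atlas \<A> \<Longrightarrow> chart_inv (chart_at \<A> x) (snd (chart_at \<A> x) x) = x"
  by (meson chart_at_in_atlas chart_inv_chart in_chart_at)

lemma eventually_chart_inv:
  assumes "smooth_atlas \<A>" "eventually Q (nhds x)"
  shows "\<forall>\<^sub>F z in nhds (snd (chart_at \<A> x) x). Q (chart_inv (chart_at \<A> x) z)"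
  using assms(2) chart_inv_tendsto[OF assms(1) chart_at_in_atlas[OF assms(1)] in_chart_at[OF assms(1)]]
  by (auto simp: filterlim_iff)

lemma has_derivative_eventually_nhds:
  assumes "(f has_derivative L) (at x)" "\<forall>\<^sub>F z in nhds x. f z = g z"
  shows "(g has_derivative L) (at x)"
proof -
  have "\<forall>\<^sub>F z in at x. f z = g z"
    unfolding eventually_at_filter using assms(2) by (rule eventually_mono) simp
  from has_derivative_transform_eventually[OF assms(1) this eventually_nhds_x_imp_x[OF assms(2)]]
  show ?thesis by simp
qed

lemma fderiv_cong:
  assumes "smooth_atlas \<A>" "\<forall>\<^sub>F y in nhds x. f y = g y" "fdiff \<A> f x"
  shows "fderiv \<A> g x = fderiv \<A> f x"
  using has_derivative_fdiff[OF has_derivative_eventually_nhds[OF fdiff_has_derivative[OF assms(3)] eventually_chart_inv[OF assms(1,2)]]]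
  by auto

text \<open>Continuity at \<open>x\<close> is a separate conjunct because the chart expression alone
  does not confine the values of \<open>f\<close> to the domain of the chart at \<open>f x\<close>,
  and outside that domain \<open>chart_inv\<close> does not undo the chart.\<close>

definition mdiff ::
  "('m::topological_space, 'e::real_normed_vector) chart set \<Rightarrow>
   ('n::topological_space, 'f::real_normed_vector) chart set \<Rightarrow> ('m \<Rightarrow> 'n) \<Rightarrow> 'm \<Rightarrow> bool"
  where "mdiff \<A> \<B> f x \<longleftrightarrow> filterlim f (nhds (f x)) (nhds x) \<and>
    (snd (chart_at \<B> (f x)) \<circ> f \<circ> chart_inv (chart_at \<A> x)) differentiable (at (snd (chart_at \<A> x) x))"

lemma mdiff_tendsto: "mdiff \<A> \<B> f x \<Longrightarrow> filterlim f (nhds (f x)) (nhds x)"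
  by (simp add: mdiff_def)

lemma mdiff_has_derivative:
  "mdiff \<A> \<B> f x \<Longrightarrow>
    ((\<lambda>z. snd (chart_at \<B> (f x)) (f (chart_inv (chart_at \<A> x) z))) has_derivative mderiv \<A> \<B> f x)
      (at (snd (chart_at \<A> x) x))"
  unfolding mdiff_def mderiv_def by (simp add: frechet_derivative_works o_def)

lemma linear_mderiv: "mdiff \<A> \<B> f x \<Longrightarrow> linear (mderiv \<A> \<B> f x)"
  by (rule has_derivative_linear[OF mdiff_has_derivative])

lemma has_derivative_mdiff:
  assumes "filterlim f (nhds (f x)) (nhds x)"
    and "((\<lambda>z. snd (chart_at \<B> (f x)) (f (chart_inv (chart_at \<A> x) z))) has_derivative L)
      (at (snd (chart_at \<A> x) x))"
  shows "mdiff \<A> \<B> f x" "mderiv \<A> \<B> f x = L"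
  using assms frechet_derivative_at[OF assms(2)]
  unfolding mdiff_def mderiv_def by (auto simp: differentiable_def o_def)

lemma smooth_mapD:
  assumes "smooth_map \<A> \<B> U f" "C \<in> \<A>" "K \<in> \<B>"
  shows "smooth_on (snd C ` (U \<inter> fst C \<inter> f -` fst K)) (snd K \<circ> f \<circ> chart_inv C)"
proof -
  have "\<forall>(V, c)\<in>\<A>. \<forall>(W, d)\<in>\<B>.
       smooth_on (c ` (U \<inter> V \<inter> f -` W)) (d \<circ> f \<circ> chart_inv (V, c))"
    using assms(1) by (simp add: smooth_map_def)
  from bspec[OF this assms(2)] have
    "\<forall>(W, d)\<in>\<B>. smooth_on (snd C ` (U \<inter> fst C \<inter> f -` W)) (d \<circ> f \<circ> chart_inv C)"
    by (simp add: case_prod_unfold)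
  from bspec[OF this assms(3)] show ?thesis by (simp add: case_prod_unfold)
qed

lemma smooth_map_mdiff:
  assumes "smooth_atlas \<A>" "smooth_atlas \<B>" "smooth_map \<A> \<B> U f" "open U" "x \<in> U"
  shows "mdiff \<A> \<B> f x"
proof -
  let ?C = "chart_at \<A> x" and ?K = "chart_at \<B> (f x)"
  have "smooth_on (snd ?C ` (U \<inter> fst ?C \<inter> f -` fst ?K)) (snd ?K \<circ> f \<circ> chart_inv ?C)"
    by (rule smooth_mapD[OF assms(3) chart_at_in_atlas[OF assms(1)] chart_at_in_atlas[OF assms(2)]])
  moreover have "snd ?C x \<in> snd ?C ` (U \<inter> fst ?C \<inter> f -` fst ?K)"
    using assms(5) in_chart_at[OF assms(1), of x] in_chart_at[OF assms(2), of "f x"] by blast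
  ultimately have "(snd ?K \<circ> f \<circ> chart_inv ?C) differentiable (at (snd ?C x))"
    by (rule smooth_on_differentiable)
  moreover have "continuous_on U f" using assms(3) by (simp add: smooth_map_def)
  ultimately show ?thesis
    unfolding mdiff_def using filterlim_nhds_of_continuous_on[OF _ assms(4,5)] by simp
qed

lemma eventually_in_chart_at:
  "smooth_atlas \<A> \<Longrightarrow> \<forall>\<^sub>F y in nhds x. y \<in> fst (chart_at \<A> x)"
  by (meson chart_at_in_atlas eventually_nhds in_chart_at open_chart)

lemma eventually_chart_inv_chart:
  assumes "smooth_atlas \<A>" "mdiff \<B> \<A> f x"
  shows "\<forall>\<^sub>F y in nhds x. chart_inv (chart_at \<A> (f x)) (snd (chart_at \<A> (f x)) (f y)) = f y"
  using eventually_in_chart_at[OF assms(1), of "f x"] mdiff_tendsto[OF assms(2)]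
  by (auto simp: filterlim_iff elim!: eventually_mono
      intro: chart_inv_chart[OF assms(1) chart_at_in_atlas[OF assms(1)]])

text \<open>Near \<open>x\<close> the continuity in \<open>mdiff\<close> keeps \<open>f\<close>
  inside the chart domain at \<open>f x\<close>, so the chart and its inverse that stand between the
  two maps cancel there.\<close>

lemma
  assumes "smooth_atlas \<A>" "smooth_atlas \<B>" "mdiff \<A> \<B> f x" "fdiff \<B> h (f x)"
  shows fdiff_compose: "fdiff \<A> (\<lambda>y. h (f y)) x"
    and fderiv_compose: "fderiv \<A> (\<lambda>y. h (f y)) x v = fderiv \<B> h (f x) (mderiv \<A> \<B> f x v)"
proof -
  have "((\<lambda>z. h (chart_inv (chart_at \<B> (f x)) z)) has_derivative fderiv \<B> h (f x))
      (at (snd (chart_at \<B> (f x)) (f (chart_inv (chart_at \<A> x) (snd (chart_at \<A> x) x)))))"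
    using fdiff_has_derivative[OF assms(4)] by (simp add: chart_inv_chart_at[OF assms(1)])
  from has_derivative_compose[OF mdiff_has_derivative[OF assms(3)] this]
  have "((\<lambda>z. h (f (chart_inv (chart_at \<A> x) z))) has_derivative
      (\<lambda>v. fderiv \<B> h (f x) (mderiv \<A> \<B> f x v))) (at (snd (chart_at \<A> x) x))"
    by (rule has_derivative_eventually_nhds)
      (use eventually_chart_inv[OF assms(1) eventually_chart_inv_chart[OF assms(2,3)]] in
        \<open>auto elim!: eventually_mono\<close>)
  from has_derivative_fdiff[OF this]
  show "fdiff \<A> (\<lambda>y. h (f y)) x"
    "fderiv \<A> (\<lambda>y. h (f y)) x v = fderiv \<B> h (f x) (mderiv \<A> \<B> f x v)" by auto
qed

lemma
  assumes "smooth_atlas \<A>" "smooth_atlas \<B>" "mdiff \<A> \<B> f x" "mdiff \<B> \<C> h (f x)"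
  shows mdiff_compose: "mdiff \<A> \<C> (\<lambda>y. h (f y)) x"
    and mderiv_compose: "mderiv \<A> \<C> (\<lambda>y. h (f y)) x v = mderiv \<B> \<C> h (f x) (mderiv \<A> \<B> f x v)"
proof -
  let ?k = "snd (chart_at \<C> (h (f x)))"
  have fd: "fdiff \<B> (\<lambda>y. ?k (h y)) (f x)" and eq: "fderiv \<B> (\<lambda>y. ?k (h y)) (f x) = mderiv \<B> \<C> h (f x)"
    using has_derivative_fdiff[where f = "\<lambda>y. ?k (h y)", OF mdiff_has_derivative[OF assms(4)]] by auto
  have l: "filterlim (\<lambda>y. h (f y)) (nhds (h (f x))) (nhds x)"
    using filterlim_compose[OF mdiff_tendsto[OF assms(4)] mdiff_tendsto[OF assms(3)]] .
  note F = fdiff_has_derivative[OF fdiff_compose[OF assms(1-3) fd]]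
  show "mdiff \<A> \<C> (\<lambda>y. h (f y)) x" using has_derivative_mdiff(1)[OF l F] .
  show "mderiv \<A> \<C> (\<lambda>y. h (f y)) x v = mderiv \<B> \<C> h (f x) (mderiv \<A> \<B> f x v)"
    using has_derivative_mdiff(2)[OF l F] fderiv_compose[OF assms(1-3) fd] eq by simp
qed

lemma mderiv_cong:
  assumes "smooth_atlas \<A>" "\<forall>\<^sub>F y in nhds x. f y = g y" "mdiff \<A> \<B> f x"
  shows "mderiv \<A> \<B> g x = mderiv \<A> \<B> f x"
proof -
  have e: "g x = f x" using assms(2) eventually_nhds_x_imp_x by fastforce
  have "filterlim g (nhds (g x)) (nhds x)"
    using mdiff_tendsto[OF assms(3)] filterlim_cong[OF refl refl assms(2)] by (simp add: e)
  moreover have "((\<lambda>z. snd (chart_at \<B> (g x)) (g (chart_inv (chart_at \<A> x) z))) has_derivative mderiv \<A> \<B> f x)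
      (at (snd (chart_at \<A> x) x))"
    unfolding e by (rule has_derivative_eventually_nhds[OF mdiff_has_derivative[OF assms(3)]])
      (use eventually_chart_inv[OF assms(1,2)] in \<open>auto elim!: eventually_mono\<close>)
  ultimately show ?thesis by (rule has_derivative_mdiff)
qed

lemma mdiff_const: "mdiff \<A> \<B> (\<lambda>y. a) x" and mderiv_const: "mderiv \<A> \<B> (\<lambda>y. a) x v = 0"
  using has_derivative_mdiff[where f = "\<lambda>y. a" and L = "\<lambda>v. 0" and \<A> = \<A> and \<B> = \<B> and x = x] by auto

lemma eventually_chart_chart_inv:
  assumes "smooth_atlas \<A>"
  shows "\<forall>\<^sub>F z in nhds (snd (chart_at \<A> x) x). snd (chart_at \<A> x) (chart_inv (chart_at \<A> x) z) = z"
proof -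
  let ?C = "chart_at \<A> x"
  have C: "?C \<in> \<A>" "x \<in> fst ?C" using assms by (auto intro: chart_at_in_atlas in_chart_at)
  show ?thesis unfolding eventually_nhds
    by (rule exI[of _ "snd ?C ` fst ?C"])
      (use C open_chart_image[OF assms C(1)] chart_inv_chart[OF assms C(1)] in auto)
qed

lemma
  assumes "smooth_atlas \<A>"
  shows mdiff_ident: "mdiff \<A> \<A> (\<lambda>y. y) x" and mderiv_ident: "mderiv \<A> \<A> (\<lambda>y. y) x v = v"
proof -
  have "((\<lambda>z. snd (chart_at \<A> x) (chart_inv (chart_at \<A> x) z)) has_derivative (\<lambda>v. v))
     (at (snd (chart_at \<A> x) x))"
    by (rule has_derivative_eventually_nhds[OF has_derivative_ident])
      (use eventually_chart_chart_inv[OF assms, of x] in \<open>auto elim!: eventually_mono\<close>)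
  from has_derivative_mdiff[where f = "\<lambda>y. y", OF filterlim_ident this]
  show "mdiff \<A> \<A> (\<lambda>y. y) x" "mderiv \<A> \<A> (\<lambda>y. y) x v = v" by auto
qed

text \<open>The atlas of a product may prefer a chart unrelated to the preferred charts of the
  factors, so no \<open>mderiv\<close> on \<open>prod_atlas\<close> is used. The differential of
  \<open>F\<close> is taken in the product of the two preferred charts instead; it is a linear map
  that depends on \<open>f\<close> and \<open>h\<close> only through their values at
  \<open>x\<close>.\<close>

lemma
  fixes F :: "'m::{t2_space, second_countable_topology} \<times> 'n::{t2_space, second_countable_topology}
      \<Rightarrow> 'k::{t2_space, second_countable_topology}"
    and \<A> :: "('m, 'e::real_normed_vector) chart set"
    and \<B> :: "('n, 'f::real_normed_vector) chart set"
    and \<C> :: "('k, 'c::real_normed_vector) chart set"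
    and \<X> :: "('x::{t2_space, second_countable_topology}, 'd::real_normed_vector) chart set"
  assumes \<A>: "smooth_atlas \<A>" and \<B>: "smooth_atlas \<B>" and \<C>: "smooth_atlas \<C>" and \<X>: "smooth_atlas \<X>"
    and F: "smooth_map (prod_atlas \<A> \<B>) \<C> UNIV F"
    and f: "mdiff \<X> \<A> f x" and h: "mdiff \<X> \<B> h x"
  shows mdiff_prod: "mdiff \<X> \<C> (\<lambda>y. F (f y, h y)) x" (is ?thesis1)
    and mderiv_prod_aux: "mderiv \<X> \<C> (\<lambda>y. F (f y, h y)) x v =
      frechet_derivative (\<lambda>z. snd (chart_at \<C> (F (f x, h x)))
          (F (chart_inv (chart_at \<A> (f x)) (fst z), chart_inv (chart_at \<B> (h x)) (snd z))))
        (at (snd (chart_at \<A> (f x)) (f x), snd (chart_at \<B> (h x)) (h x)))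
        (mderiv \<X> \<A> f x v, mderiv \<X> \<B> h x v)" (is ?thesis2)
    and linear_prod_aux: "linear
      (frechet_derivative (\<lambda>z. snd (chart_at \<C> (F (f x, h x)))
          (F (chart_inv (chart_at \<A> (f x)) (fst z), chart_inv (chart_at \<B> (h x)) (snd z))))
        (at (snd (chart_at \<A> (f x)) (f x), snd (chart_at \<B> (h x)) (h x))))" (is ?thesis3)
proof -
  let ?C = "chart_at \<A> (f x)" and ?D = "chart_at \<B> (h x)" and ?K = "chart_at \<C> (F (f x, h x))"
    and ?X = "chart_at \<X> x"
  let ?Q = "(fst ?C \<times> fst ?D, map_prod (snd ?C) (snd ?D))"
  let ?\<Phi> = "\<lambda>z. snd ?K (F (chart_inv ?C (fst z), chart_inv ?D (snd z)))"
  let ?z0 = "(snd ?C (f x), snd ?D (h x))"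
  have C: "?C \<in> \<A>" "f x \<in> fst ?C" and D: "?D \<in> \<B>" "h x \<in> fst ?D"
    and K: "?K \<in> \<C>" "F (f x, h x) \<in> fst ?K"
    using \<A> \<B> \<C> by (auto intro: chart_at_in_atlas in_chart_at)
  have Q: "?Q \<in> prod_atlas \<A> \<B>"
  proof -
    have "(fst ?C, snd ?C) \<in> \<A> \<and> (fst ?D, snd ?D) \<in> \<B>" using C(1) D(1) by simp
    then show ?thesis unfolding prod_atlas_def by blast
  qed
  have cF: "continuous_on UNIV F" using F by (simp add: smooth_map_def)
  have "smooth_on (snd ?Q ` (UNIV \<inter> fst ?Q \<inter> F -` fst ?K)) (snd ?K \<circ> F \<circ> chart_inv ?Q)"
    by (rule smooth_mapD[OF F Q K(1)])
  then have "(snd ?K \<circ> F \<circ> chart_inv ?Q) differentiable (at ?z0)"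
    by (rule smooth_on_differentiable) (use C(2) D(2) K(2) in force)
  then have d1: "((snd ?K \<circ> F \<circ> chart_inv ?Q) has_derivative
      frechet_derivative (snd ?K \<circ> F \<circ> chart_inv ?Q) (at ?z0)) (at ?z0)"
    by (simp add: frechet_derivative_works)
  \<comment> \<open>\<open>chart_inv\<close> of the product chart is an \<open>inv_into\<close>;
    injectivity identifies it with the pair of inverses.\<close>
  have inj: "inj_on (snd ?Q) (fst ?Q)"
    using chart_inv_chart[OF \<A> C(1)] chart_inv_chart[OF \<B> D(1)]
    by (auto simp: inj_on_def) (metis)+
  have "(snd ?K \<circ> F \<circ> chart_inv ?Q) z = ?\<Phi> z" if z: "z \<in> (snd ?C ` fst ?C) \<times> (snd ?D ` fst ?D)" for z
  proof -
    obtain a b where ab: "z = (snd ?C a, snd ?D b)" "a \<in> fst ?C" "b \<in> fst ?D" using z by auto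
    have "chart_inv ?Q (snd ?Q (a, b)) = (a, b)"
      unfolding chart_inv_def by (rule inv_into_f_f[OF inj]) (use ab in auto)
    then show ?thesis
      using ab by (simp add: chart_inv_chart[OF \<A> C(1)] chart_inv_chart[OF \<B> D(1)])
  qed
  moreover have "open ((snd ?C ` fst ?C) \<times> (snd ?D ` fst ?D))"
    by (intro open_Times open_chart_image[OF \<A> C(1)] open_chart_image[OF \<B> D(1)])
  moreover have "?z0 \<in> (snd ?C ` fst ?C) \<times> (snd ?D ` fst ?D)" using C(2) D(2) by simp
  ultimately have "(?\<Phi> has_derivative frechet_derivative (snd ?K \<circ> F \<circ> chart_inv ?Q) (at ?z0)) (at ?z0)"
    by - (rule has_derivative_transform_within_open[OF d1])
  then have "?\<Phi> differentiable (at ?z0)" by (rule differentiableI)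
  then have \<Phi>: "(?\<Phi> has_derivative frechet_derivative ?\<Phi> (at ?z0)) (at ?z0)"
    unfolding frechet_derivative_works .
  have l: "filterlim (\<lambda>y. F (f y, h y)) (nhds (F (f x, h x))) (nhds x)"
    by (rule filterlim_compose[OF filterlim_nhds_of_continuous_on[OF cF open_UNIV]])
      (auto intro!: tendsto_Pair mdiff_tendsto[OF f] mdiff_tendsto[OF h])
  have "((\<lambda>z. ?\<Phi> (snd ?C (f (chart_inv ?X z)), snd ?D (h (chart_inv ?X z)))) has_derivative
      (\<lambda>v. frechet_derivative ?\<Phi> (at ?z0) (mderiv \<X> \<A> f x v, mderiv \<X> \<B> h x v))) (at (snd ?X x))"
    by (rule has_derivative_compose[OF has_derivative_Pair[OF mdiff_has_derivative[OF f] mdiff_has_derivative[OF h]]])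
      (use \<Phi> in \<open>simp add: chart_inv_chart_at[OF \<X>]\<close>)
  then have "((\<lambda>z. snd ?K (F (f (chart_inv ?X z), h (chart_inv ?X z)))) has_derivative
      (\<lambda>v. frechet_derivative ?\<Phi> (at ?z0) (mderiv \<X> \<A> f x v, mderiv \<X> \<B> h x v))) (at (snd ?X x))"
    by (rule has_derivative_eventually_nhds)
      (use eventually_conj[OF eventually_chart_inv[OF \<X> eventually_chart_inv_chart[OF \<A> f]]
        eventually_chart_inv[OF \<X> eventually_chart_inv_chart[OF \<B> h]]] in \<open>auto elim!: eventually_mono\<close>)
  from has_derivative_mdiff[where f = "\<lambda>y. F (f y, h y)", OF l this]
  show ?thesis1 ?thesis2 by auto
  show ?thesis3 by (rule has_derivative_linear[OF \<Phi>])
qed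

text \<open>A linear map on a product is the sum of its restrictions to the factors. Each
  restriction is found from \<open>mderiv_prod_aux\<close> with one of the two maps constant and the
  other the identity.\<close>

lemma mderiv_prod:
  fixes F :: "'m::{t2_space, second_countable_topology} \<times> 'n::{t2_space, second_countable_topology}
      \<Rightarrow> 'k::{t2_space, second_countable_topology}"
    and \<A> :: "('m, 'e::real_normed_vector) chart set"
    and \<B> :: "('n, 'f::real_normed_vector) chart set"
    and \<C> :: "('k, 'c::real_normed_vector) chart set"
    and \<X> :: "('x::{t2_space, second_countable_topology}, 'd::real_normed_vector) chart set"
  assumes \<A>: "smooth_atlas \<A>" and \<B>: "smooth_atlas \<B>" and \<C>: "smooth_atlas \<C>" and \<X>: "smooth_atlas \<X>"
    and F: "smooth_map (prod_atlas \<A> \<B>) \<C> UNIV F"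
    and f: "mdiff \<X> \<A> f x" and h: "mdiff \<X> \<B> h x"
  shows "mderiv \<X> \<C> (\<lambda>y. F (f y, h y)) x v =
    mderiv \<A> \<C> (\<lambda>a. F (a, h x)) (f x) (mderiv \<X> \<A> f x v) +
    mderiv \<B> \<C> (\<lambda>b. F (f x, b)) (h x) (mderiv \<X> \<B> h x v)"
proof -
  let ?L = "frechet_derivative (\<lambda>z. snd (chart_at \<C> (F (f x, h x)))
          (F (chart_inv (chart_at \<A> (f x)) (fst z), chart_inv (chart_at \<B> (h x)) (snd z))))
        (at (snd (chart_at \<A> (f x)) (f x), snd (chart_at \<B> (h x)) (h x)))"
  have 1: "mderiv \<A> \<C> (\<lambda>a. F (a, h x)) (f x) u = ?L (u, 0)" for u
    using mderiv_prod_aux[OF \<A> \<B> \<C> \<A> F mdiff_ident[OF \<A>, of "f x"]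
        mdiff_const[where a = "h x"], where v = u]
    by (simp add: mderiv_ident[OF \<A>] mderiv_const)
  have 2: "mderiv \<B> \<C> (\<lambda>b. F (f x, b)) (h x) u = ?L (0, u)" for u
    using mderiv_prod_aux[OF \<A> \<B> \<C> \<B> F mdiff_const[where a = "f x"]
        mdiff_ident[OF \<B>, of "h x"], where v = u]
    by (simp add: mderiv_ident[OF \<B>] mderiv_const)
  have 3: "?L (u + 0, 0 + w) = ?L (u, 0) + ?L (0, w)" for u w
    using linear_add[OF linear_prod_aux[OF \<A> \<B> \<C> \<X> F f h], of "(u, 0)" "(0, w)"] by simp
  show ?thesis
    unfolding mderiv_prod_aux[OF \<A> \<B> \<C> \<X> F f h] 1 2
    using 3[of "mderiv \<X> \<A> f x v" "mderiv \<X> \<B> h x v"] by (simp only: add_0_left add_0_right)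
qed

section \<open>Coordinate fields\<close>

lemma transition_has_derivative:
  assumes "smooth_atlas \<A>" "C \<in> \<A>" "K \<in> \<A>" "y \<in> fst C" "y \<in> fst K"
  shows "((\<lambda>z. snd K (chart_inv C z)) has_derivative
    frechet_derivative (snd K \<circ> chart_inv C) (at (snd C y))) (at (snd C y))"
proof -
  have "(snd K \<circ> chart_inv C) differentiable (at (snd C y))"
    by (rule smooth_on_differentiable[OF smooth_transition[OF assms(1-3)]]) (use assms(4,5) in blast)
  then show ?thesis by (simp add: frechet_derivative_works o_def)
qed

text \<open>Both \<open>fderiv\<close> and \<open>coord_field\<close> refer to the preferred chart
  at \<open>y\<close>. By the chain rule it cancels, and what is left is the derivative of the
  transition map from \<open>C\<close> to \<open>K\<close>, an expression that can be differentiated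
  again as \<open>y\<close> varies.\<close>

lemma fderiv_chart_coord_field:
  assumes "smooth_atlas \<A>" "C \<in> \<A>" "K \<in> \<A>" "y \<in> fst C" "y \<in> fst K"
  shows "fderiv \<A> (snd K) y (coord_field \<A> C w y) =
    frechet_derivative (snd K \<circ> chart_inv C) (at (snd C y)) w"
proof -
  let ?Y = "chart_at \<A> y"
  have Y: "?Y \<in> \<A>" "y \<in> fst ?Y" using assms(1) by (auto intro: chart_at_in_atlas in_chart_at)
  have e: "snd ?Y (chart_inv C (snd C y)) = snd ?Y y"
    by (simp add: chart_inv_chart[OF assms(1,2,4)])
  have "((\<lambda>z. snd K (chart_inv ?Y (snd ?Y (chart_inv C z)))) has_derivative
      (\<lambda>w. frechet_derivative (snd K \<circ> chart_inv ?Y) (at (snd ?Y y))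
        (frechet_derivative (snd ?Y \<circ> chart_inv C) (at (snd C y)) w))) (at (snd C y))"
    by (rule has_derivative_compose[OF transition_has_derivative[OF assms(1,2) Y(1) assms(4) Y(2)]])
      (unfold e, rule transition_has_derivative[OF assms(1) Y(1) assms(3) Y(2) assms(5)])
  moreover have "\<forall>\<^sub>F z in nhds (snd C y). snd K (chart_inv ?Y (snd ?Y (chart_inv C z))) = (snd K \<circ> chart_inv C) z"
  proof -
    have "\<forall>\<^sub>F y' in nhds y. y' \<in> fst ?Y" by (rule eventually_in_chart_at[OF assms(1)])
    from eventually_compose_filterlim[OF this chart_inv_tendsto[OF assms(1,2,4)]]
    have "\<forall>\<^sub>F z in nhds (snd C y). chart_inv C z \<in> fst ?Y" .
    then show ?thesis by (rule eventually_mono) (simp add: chart_inv_chart[OF assms(1) Y(1)])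
  qed
  ultimately have "((snd K \<circ> chart_inv C) has_derivative
      (\<lambda>w. frechet_derivative (snd K \<circ> chart_inv ?Y) (at (snd ?Y y))
        (frechet_derivative (snd ?Y \<circ> chart_inv C) (at (snd C y)) w))) (at (snd C y))"
    by (rule has_derivative_eventually_nhds)
  from frechet_derivative_at[OF this, symmetric] show ?thesis
    by (simp add: fderiv_def coord_field_def)
qed

lemma coord_field_self:
  assumes "smooth_atlas \<A>"
  shows "coord_field \<A> (chart_at \<A> x) w x = w"
proof -
  let ?C = "chart_at \<A> x"
  have "((snd ?C \<circ> chart_inv ?C) has_derivative (\<lambda>w. w)) (at (snd ?C x))"
    by (rule has_derivative_eventually_nhds[OF has_derivative_ident])
      (use eventually_chart_chart_inv[OF assms, of x] in \<open>auto elim!: eventually_mono\<close>)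
  from frechet_derivative_at[OF this, symmetric] show ?thesis by (simp add: coord_field_def)
qed

text \<open>The components in a chart \<open>K\<close>, read in a further chart \<open>Q\<close>,
  are a directional derivative of one transition map composed with another.\<close>

lemma smooth_section_coord_field:
  fixes \<A> :: "('m::{t2_space, second_countable_topology}, 'e::euclidean_space) chart set"
  assumes "smooth_atlas \<A>" "C \<in> \<A>"
  shows "smooth_section \<A> (tangent_triv \<A>) (fst C) (coord_field \<A> C w)"
proof -
  have "smooth_on (snd Q ` (fst C \<inter> fst K \<inter> fst Q))
      ((\<lambda>x. fderiv \<A> (snd K) x (coord_field \<A> C w x)) \<circ> chart_inv Q)" if K: "K \<in> \<A>" and Q: "Q \<in> \<A>" for K Q
  proof -
    let ?S = "snd Q ` (fst C \<inter> fst K \<inter> fst Q)"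
    have op: "open ?S"
      by (rule open_chart_image_subset[OF assms(1) Q])
        (auto intro: open_chart[OF assms(1)] assms(2) K Q)
    have "smooth_on ?S ((\<lambda>z. frechet_derivative (snd K \<circ> chart_inv C) (at z) w) \<circ> (snd C \<circ> chart_inv Q))"
    proof (rule smooth_on_compose[OF op])
      show "(snd C \<circ> chart_inv Q) ` ?S \<subseteq> snd C ` (fst C \<inter> fst K)"
        by (auto simp: chart_inv_chart[OF assms(1) Q])
      show "smooth_on (snd C ` (fst C \<inter> fst K)) (\<lambda>z. frechet_derivative (snd K \<circ> chart_inv C) (at z) w)"
        by (rule smooth_on_frechet_derivative[OF smooth_transition[OF assms K]])
      show "smooth_on ?S (snd C \<circ> chart_inv Q)"
        by (rule smooth_on_subset[OF smooth_transition[OF assms(1) Q assms(2)]]) blast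
    qed
    then show ?thesis
      by (rule smooth_on_cong[OF op, rotated])
        (auto simp: chart_inv_chart[OF assms(1) Q] fderiv_chart_coord_field[OF assms K])
  qed
  then show ?thesis
    unfolding smooth_section_def smooth_fun_def tangent_triv_def by fastforce
qed

lemma smooth_section_near_coord_field:
  fixes \<A> :: "('m::{t2_space, second_countable_topology}, 'e::euclidean_space) chart set"
  assumes "smooth_atlas \<A>"
  shows "smooth_section_near \<A> (tangent_triv \<A>) x (coord_field \<A> (chart_at \<A> x) w)"
  by (rule smooth_section_nearI[OF smooth_section_coord_field[OF assms]])
    (auto intro: chart_at_in_atlas[OF assms] in_chart_at[OF assms] open_chart[OF assms])

text \<open>In its own chart a coordinate field has constant components, on the whole chart domain
  and not only at \<open>x\<close>, so their derivatives vanish.\<close>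

lemma lie_bracket_coord_field:
  assumes "smooth_atlas \<A>"
  shows "lie_bracket \<A> (coord_field \<A> (chart_at \<A> x) v) (coord_field \<A> (chart_at \<A> x) w) x = 0"
proof -
  let ?C = "chart_at \<A> x"
  have C: "?C \<in> \<A>" using assms by (rule chart_at_in_atlas)
  have "frechet_derivative (snd ?C \<circ> chart_inv ?C) (at (snd ?C y)) w = w" if "y \<in> fst ?C" for y w
  proof -
    have "((snd ?C \<circ> chart_inv ?C) has_derivative (\<lambda>w. w)) (at (snd ?C y))"
      by (rule has_derivative_transform_within_open[OF has_derivative_ident open_chart_image[OF assms C]])
        (use that in \<open>auto simp: chart_inv_chart[OF assms C]\<close>)
    from frechet_derivative_at[OF this, symmetric] show ?thesis by simp
  qed
  then have "\<forall>\<^sub>F y in nhds x. w = fderiv \<A> (snd ?C) y (coord_field \<A> ?C w y)" for w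
    using eventually_in_chart_at[OF assms, of x]
    by (auto elim!: eventually_mono simp: fderiv_chart_coord_field[OF assms C C])
  from fderiv_cong[OF assms this fdiff_const]
  have "fderiv \<A> (\<lambda>y. fderiv \<A> (snd ?C) y (coord_field \<A> ?C w y)) x u = 0" for w u
    by (simp add: fderiv_const)
  then show ?thesis by (simp add: lie_bracket_def)
qed

text \<open>Torsion-freeness with bracket zero. The symmetry later cancels the Levi-Civita terms in
  the antisymmetrised derivative of a 1-form.\<close>

lemma levi_civita_coord_field_commute:
  fixes \<A> :: "('m::{t2_space, second_countable_topology}, 'e::euclidean_space) chart set"
  assumes "smooth_atlas \<A>" "levi_civita \<A> g D"
  shows "D x v (coord_field \<A> (chart_at \<A> x) w) = D x w (coord_field \<A> (chart_at \<A> x) v)"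
proof -
  let ?E = "coord_field \<A> (chart_at \<A> x)"
  have "D x (?E v x) (?E w) - D x (?E w x) (?E v) = lie_bracket \<A> (?E v) (?E w) x"
    using assms(2) smooth_section_near_coord_field[OF assms(1)] unfolding levi_civita_def by blast
  then show ?thesis by (simp add: lie_bracket_coord_field[OF assms(1)] coord_field_self[OF assms(1)])
qed

section \<open>Horizontal lifts and sections of the adjoint bundle\<close>

lemma smooth_fun_add:
  assumes "smooth_atlas \<A>" "open U" "smooth_fun \<A> U f" "smooth_fun \<A> U g"
  shows "smooth_fun \<A> U (\<lambda>x. f x + g x)"
proof -
  have "smooth_on (snd C ` (U \<inter> fst C)) ((\<lambda>x. f x + g x) \<circ> chart_inv C)" if C: "C \<in> \<A>" for C
  proof -
    have "open (snd C ` (U \<inter> fst C))"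
      by (rule open_chart_image_subset[OF assms(1) C]) (auto intro: assms(2) open_chart[OF assms(1) C])
    then show ?thesis
      using smooth_funD[OF assms(3) C] smooth_funD[OF assms(4) C]
      by (simp add: smooth_on_def o_def C_k_add)
  qed
  then show ?thesis unfolding smooth_fun_def by auto
qed

lemma smooth_fun_scaleR_const:
  assumes "smooth_atlas \<A>" "open U" "smooth_fun \<A> U f"
  shows "smooth_fun \<A> U (\<lambda>x. r *\<^sub>R f x)"
proof -
  have "smooth_on (snd C ` (U \<inter> fst C)) ((\<lambda>x. r *\<^sub>R f x) \<circ> chart_inv C)" if C: "C \<in> \<A>" for C
  proof -
    have "open (snd C ` (U \<inter> fst C))"
      by (rule open_chart_image_subset[OF assms(1) C]) (auto intro: assms(2) open_chart[OF assms(1) C])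
    then show ?thesis
      using smooth_funD[OF assms(3) C]
      by (auto simp: smooth_on_def o_def intro!: C_k_bounded_linear[OF bounded_linear_scaleR_right])
  qed
  then show ?thesis unfolding smooth_fun_def by auto
qed

lemma smooth_fun_const:
  assumes "smooth_atlas \<A>" "open U"
  shows "smooth_fun \<A> U (\<lambda>x. a)"
proof -
  have "open (snd C ` (U \<inter> fst C))" if C: "C \<in> \<A>" for C
    by (rule open_chart_image_subset[OF assms(1) C]) (auto intro: assms(2) open_chart[OF assms(1) C])
  then show ?thesis unfolding smooth_fun_def smooth_on_def o_def by (fastforce intro: C_k_const)
qed

text \<open>Conjugation is built from two multiplications, each with one entry constant, hence it is
  differentiable at the neutral element. Linearity makes the equivariance condition in
  \<open>ad_1forms\<close> stable under linear combinations.\<close>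

lemma linear_Ad:
  assumes "lie_group \<G>"
  shows "linear (Ad \<G> g)"
proof -
  have \<G>: "smooth_atlas \<G>" and plus: "smooth_map (prod_atlas \<G> \<G>) \<G> UNIV (\<lambda>(g, h). g + h)"
    using assms by (simp_all add: lie_group_def)
  have 1: "mdiff \<G> \<G> (\<lambda>h. g + h) 0"
    using mdiff_prod[OF \<G> \<G> \<G> \<G> plus mdiff_const mdiff_ident[OF \<G>]] by simp
  have "mdiff \<G> \<G> (\<lambda>h. g + h - g) 0"
    using mdiff_prod[OF \<G> \<G> \<G> \<G> plus 1 mdiff_const[where a = "- g"]] by simp
  then show ?thesis unfolding Ad_def by (rule linear_mderiv)
qed

context
  fixes \<A> :: "('m::{t2_space, second_countable_topology}, 'e::real_normed_vector) chart set"
    and P :: "('m, 'p::{t2_space, second_countable_topology}, 'b::real_normed_vector,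
      'g::{group_add, t2_space, second_countable_topology}, 'a::real_normed_vector) pbundle"
    and \<theta> :: "'p \<Rightarrow> 'b \<Rightarrow> 'a"
  assumes P: "principal_bundle \<A> P" and \<theta>: "principal_connection P \<theta>"
begin

lemma
  shows base_atlas: "smooth_atlas \<A>"
    and total_atlas: "smooth_atlas (total P)"
    and struct_atlas: "smooth_atlas (struct_grp P)"
    and smooth_proj: "smooth_map (total P) \<A> UNIV (proj P)"
    and smooth_act: "smooth_map (prod_atlas (total P) (struct_grp P)) (total P) UNIV (\<lambda>(p, g). act P p g)"
    and smooth_plus: "smooth_map (prod_atlas (struct_grp P) (struct_grp P)) (struct_grp P) UNIV (\<lambda>(g, h). g + h)"
    and act_0: "act P p 0 = p"
    and act_act: "act P (act P p g) h = act P p (g + h)"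
    and proj_act: "proj P (act P p g) = proj P p"
  using P by (simp_all add: principal_bundle_def lie_group_def)

lemma mdiff_proj: "mdiff (total P) \<A> (proj P) p"
  by (rule smooth_map_mdiff[OF total_atlas base_atlas smooth_proj open_UNIV UNIV_I])

lemma proj_tendsto: "filterlim (proj P) (nhds (proj P p)) (nhds p)"
  by (rule mdiff_tendsto[OF mdiff_proj])

lemma open_proj_vimage: "open U \<Longrightarrow> open (proj P -` U)"
  using smooth_proj by (simp add: smooth_map_def open_vimage)

lemma mdiff_act: "mdiff (struct_grp P) (total P) (act P p) g"
  using mdiff_prod[OF total_atlas struct_atlas total_atlas struct_atlas smooth_act
      mdiff_const[where a = p] mdiff_ident[OF struct_atlas, of g]] by simp

lemma mderiv_proj_vertical:
  "mderiv (total P) \<A> (proj P) p (mderiv (struct_grp P) (total P) (act P p) 0 \<xi>) = 0"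
proof -
  have "mdiff (total P) \<A> (proj P) (act P p 0)" by (rule mdiff_proj)
  from mderiv_compose[OF struct_atlas total_atlas mdiff_act[of p 0] this, of \<xi>]
  show ?thesis by (simp add: act_0 proj_act mderiv_const)
qed

lemma local_section:
  obtains U \<sigma> \<gamma> where "open U" "x \<in> U" "mdiff \<A> (total P) \<sigma> x"
    "\<And>y. y \<in> U \<Longrightarrow> proj P (\<sigma> y) = y"
    "\<And>p. proj P p \<in> U \<Longrightarrow> mdiff (total P) (struct_grp P) \<gamma> p"
    "\<And>p. proj P p \<in> U \<Longrightarrow> act P (\<sigma> (proj P p)) (\<gamma> p) = p"
proof -
  from P obtain U \<sigma> \<gamma> where *: "open U" "x \<in> U" "smooth_map \<A> (total P) U \<sigma>"
    "\<forall>y\<in>U. proj P (\<sigma> y) = y" "smooth_map (total P) (struct_grp P) (proj P -` U) \<gamma>"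
    "\<forall>p. proj P p \<in> U \<longrightarrow> act P (\<sigma> (proj P p)) (\<gamma> p) = p"
    unfolding principal_bundle_def by metis
  show thesis
  proof (rule that[of U \<sigma> \<gamma>])
    show "mdiff \<A> (total P) \<sigma> x"
      by (rule smooth_map_mdiff[OF base_atlas total_atlas *(3,1,2)])
    show "mdiff (total P) (struct_grp P) \<gamma> p" if "proj P p \<in> U" for p
      by (rule smooth_map_mdiff[OF total_atlas struct_atlas *(5) open_proj_vimage[OF *(1)]])
        (use that in simp)
  qed (use * in auto)
qed

text \<open>The local section need not pass through \<open>p\<close>. Translating it by the constant
  group element \<open>\<gamma> p\<close> makes it do so, and the differential of the translated
  section is a right inverse of that of the projection.\<close>

lemma mderiv_proj_surj: "\<exists>w. mderiv (total P) \<A> (proj P) p w = v"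
proof -
  obtain U \<sigma> \<gamma> where *: "open U" "proj P p \<in> U" "mdiff \<A> (total P) \<sigma> (proj P p)"
    "\<And>y. y \<in> U \<Longrightarrow> proj P (\<sigma> y) = y" "act P (\<sigma> (proj P p)) (\<gamma> p) = p"
    using local_section[of "proj P p"] by metis
  let ?f = "\<lambda>y. act P (\<sigma> y) (\<gamma> p)"
  have f: "mdiff \<A> (total P) ?f (proj P p)"
    using mdiff_prod[OF total_atlas struct_atlas total_atlas base_atlas smooth_act *(3)
      mdiff_const[where a = "\<gamma> p"]] by simp
  have "\<forall>\<^sub>F y in nhds (proj P p). y = proj P (?f y)"
    unfolding eventually_nhds by (rule exI[of _ U]) (use * in \<open>auto simp: proj_act\<close>)
  from mderiv_cong[OF base_atlas this mdiff_ident[OF base_atlas]]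
  have "mderiv \<A> \<A> (\<lambda>y. proj P (?f y)) (proj P p) v = v" by (simp add: mderiv_ident[OF base_atlas])
  moreover have "mdiff (total P) \<A> (proj P) (?f (proj P p))" by (rule mdiff_proj)
  ultimately have "mderiv (total P) \<A> (proj P) p (mderiv \<A> (total P) ?f (proj P p) v) = v"
    using mderiv_compose[OF base_atlas total_atlas f, of \<A> "proj P" v] by (simp add: *(5))
  then show ?thesis by blast
qed

text \<open>The identity \<open>q = \<sigma>(\<pi> q) \<gamma>(q)\<close> is differentiated along
  \<open>w\<close> by the product rule. The section part passes through the projection and
  contributes nothing, so \<open>w\<close> is tangent to the orbit of \<open>p\<close>. Left
  translation by \<open>- \<gamma> p\<close> moves the group part to the neutral element.\<close>

lemma mderiv_proj_kernel:
  assumes w: "mderiv (total P) \<A> (proj P) p w = 0"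
  shows "\<exists>\<xi>. w = mderiv (struct_grp P) (total P) (act P p) 0 \<xi>"
proof -
  let ?x = "proj P p"
  obtain U \<sigma> \<gamma> where *: "open U" "?x \<in> U" "mdiff \<A> (total P) \<sigma> ?x"
    "mdiff (total P) (struct_grp P) \<gamma> p"
    "\<And>p. proj P p \<in> U \<Longrightarrow> act P (\<sigma> (proj P p)) (\<gamma> p) = p"
    using local_section[of ?x] by metis
  have s: "mdiff (total P) (total P) (\<lambda>q. \<sigma> (proj P q)) p"
    by (rule mdiff_compose[OF total_atlas base_atlas mdiff_proj *(3)])
  have s0: "mderiv (total P) (total P) (\<lambda>q. \<sigma> (proj P q)) p w = 0"
    using mderiv_compose[OF total_atlas base_atlas mdiff_proj *(3), of w] w
    by (simp add: linear_0[OF linear_mderiv[OF *(3)]])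
  have "\<forall>\<^sub>F q in nhds p. q = act P (\<sigma> (proj P q)) (\<gamma> q)"
    unfolding eventually_nhds
    by (rule exI[of _ "proj P -` U"]) (use * in \<open>auto simp: open_proj_vimage\<close>)
  from mderiv_cong[OF total_atlas this mdiff_ident[OF total_atlas]]
  have "w = mderiv (total P) (total P) (\<lambda>q. act P (\<sigma> (proj P q)) (\<gamma> q)) p w"
    by (simp add: mderiv_ident[OF total_atlas])
  also have "\<dots> = mderiv (total P) (total P) (\<lambda>a. act P a (\<gamma> p)) (\<sigma> ?x) 0 +
      mderiv (struct_grp P) (total P) (act P (\<sigma> ?x)) (\<gamma> p) (mderiv (total P) (struct_grp P) \<gamma> p w)"
    using mderiv_prod[OF total_atlas struct_atlas total_atlas total_atlas smooth_act s *(4), of w]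
    by (simp add: s0)
  also have "mderiv (total P) (total P) (\<lambda>a. act P a (\<gamma> p)) (\<sigma> ?x) 0 = 0"
  proof -
    have "mdiff (total P) (total P) (\<lambda>a. act P a (\<gamma> p)) (\<sigma> ?x)"
      using mdiff_prod[OF total_atlas struct_atlas total_atlas total_atlas smooth_act
          mdiff_ident[OF total_atlas] mdiff_const[where a = "\<gamma> p"]] by simp
    then show ?thesis by (rule linear_0[OF linear_mderiv])
  qed
  also have "act P (\<sigma> ?x) = (\<lambda>g. act P p (- \<gamma> p + g))"
  proof
    fix g
    have "act P p (- \<gamma> p + g) = act P (act P (\<sigma> ?x) (\<gamma> p)) (- \<gamma> p + g)"
      using *(2,5) by simp
    then show "act P (\<sigma> ?x) g = act P p (- \<gamma> p + g)" by (simp add: act_act)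
  qed
  also have "mderiv (struct_grp P) (total P) (\<lambda>g. act P p (- \<gamma> p + g)) (\<gamma> p) u =
      mderiv (struct_grp P) (total P) (act P p) 0 (mderiv (struct_grp P) (struct_grp P) (\<lambda>g. - \<gamma> p + g) (\<gamma> p) u)" for u
  proof -
    have l: "mdiff (struct_grp P) (struct_grp P) (\<lambda>g. - \<gamma> p + g) (\<gamma> p)"
      using mdiff_prod[OF struct_atlas struct_atlas struct_atlas struct_atlas smooth_plus
          mdiff_const[where a = "- \<gamma> p"] mdiff_ident[OF struct_atlas]] by simp
    show ?thesis using mderiv_compose[OF struct_atlas struct_atlas l mdiff_act, of p u] by simp
  qed
  finally show ?thesis by auto
qed

text \<open>The \<open>THE\<close> term is well defined. Existence: subtract from any preimage the
  fundamental vector of its connection value. Uniqueness: two candidates differ by a fundamental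
  vector, and the connection recovers its generator, here 0.\<close>

lemma mderiv_proj_horizontal_lift:
  "mderiv (total P) \<A> (proj P) p (horizontal_lift \<A> P \<theta> p v) = v"
proof -
  let ?\<pi> = "mderiv (total P) \<A> (proj P) p" and ?a = "mderiv (struct_grp P) (total P) (act P p) 0"
  have \<pi>: "linear ?\<pi>" by (rule linear_mderiv[OF mdiff_proj])
  have lin: "linear (\<theta> p)" and fund: "\<And>\<xi>. \<theta> p (?a \<xi>) = \<xi>"
    using \<theta> by (simp_all add: principal_connection_def)
  obtain w0 where w0: "?\<pi> w0 = v" using mderiv_proj_surj by blast
  have "\<exists>!w. ?\<pi> w = v \<and> \<theta> p w = 0"
  proof (rule ex_ex1I)
    show "\<exists>w. ?\<pi> w = v \<and> \<theta> p w = 0"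
      by (rule exI[of _ "w0 - ?a (\<theta> p w0)"])
        (simp add: linear_diff[OF \<pi>] linear_diff[OF lin] w0 mderiv_proj_vertical fund)
  next
    fix w w' assume w: "?\<pi> w = v \<and> \<theta> p w = 0" "?\<pi> w' = v \<and> \<theta> p w' = 0"
    then have "?\<pi> (w - w') = 0" by (simp add: linear_diff[OF \<pi>])
    then obtain \<xi> where \<xi>: "w - w' = ?a \<xi>" using mderiv_proj_kernel by blast
    have "\<xi> = 0" using fund[of \<xi>] w by (simp add: \<xi>[symmetric] linear_diff[OF lin])
    then show "w = w'" using \<xi> linear_0[OF linear_mderiv[OF mdiff_act[of p 0]]] by simp
  qed
  from theI'[OF this] show ?thesis by (simp add: horizontal_lift_def)
qed

lemma fdiff_proj: "fdiff \<A> f (proj P p) \<Longrightarrow> fdiff (total P) (\<lambda>q. f (proj P q)) p"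
  by (rule fdiff_compose[OF total_atlas base_atlas mdiff_proj])

text \<open>Functions pulled back from the base are differentiated along horizontal lifts as on the
  base itself. This brings metric compatibility of the spin connection to bear on the total
  space.\<close>

lemma ad_deriv_proj:
  "fdiff \<A> f (proj P p) \<Longrightarrow>
    fderiv (total P) (\<lambda>q. f (proj P q)) p (horizontal_lift \<A> P \<theta> p v) = fderiv \<A> f (proj P p) v"
  by (simp add: fderiv_compose[OF total_atlas base_atlas mdiff_proj] mderiv_proj_horizontal_lift)

lemma eventually_proj: "\<forall>\<^sub>F y in nhds (proj P p). Q y \<Longrightarrow> \<forall>\<^sub>F q in nhds p. Q (proj P q)"
  by (rule eventually_compose_filterlim[OF _ proj_tendsto])

end

lemma fdiff_ad_1form:
  assumes "principal_bundle \<A> P" "\<epsilon> \<in> ad_1forms \<A> P"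
  shows "fdiff (total P) (\<lambda>q. \<epsilon> q (coord_field \<A> (chart_at \<A> (proj P p)) w (proj P q))) p"
proof -
  have \<A>: "smooth_atlas \<A>" and \<P>: "smooth_atlas (total P)"
    using assms(1) by (simp_all add: principal_bundle_def)
  show ?thesis
  proof (rule smooth_fun_fdiff[OF \<P>])
    show "smooth_fun (total P) (proj P -` fst (chart_at \<A> (proj P p)))
        (\<lambda>q. \<epsilon> q (coord_field \<A> (chart_at \<A> (proj P p)) w (proj P q)))"
      using assms(2) chart_at_in_atlas[OF \<A>] by (simp add: ad_1forms_def)
  qed (simp add: in_chart_at[OF \<A>])
qed

lemma subspace_ad_1forms:
  fixes P :: "('m::{t2_space, second_countable_topology}, 'p::{t2_space, second_countable_topology},
    'b::real_normed_vector, 'g::{group_add, t2_space, second_countable_topology},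
    'a::real_normed_vector) pbundle"
  assumes "principal_bundle \<A> P"
  shows "subspace (ad_1forms \<A> P)"
proof -
  have \<A>: "smooth_atlas \<A>" and \<P>: "smooth_atlas (total P)"
    using assms by (simp_all add: principal_bundle_def)
  have op: "open (proj P -` fst C)" if "C \<in> \<A>" for C
    using assms open_chart[OF \<A> that] by (simp add: principal_bundle_def smooth_map_def open_vimage)
  have Ad: "linear (Ad (struct_grp P) g)" for g
    using assms by (simp add: principal_bundle_def linear_Ad)
  note lin = linear_add[OF Ad] linear_scale[OF Ad] linear_0[OF Ad]
  show ?thesis
  proof (rule subspaceI)
    show "0 \<in> ad_1forms \<A> P"
      by (simp add: ad_1forms_def zero_fun_def lin linear_zero smooth_fun_const[OF \<P> op])
  next
    fix \<epsilon> \<epsilon>' :: "'p \<Rightarrow> real^7 \<Rightarrow> 'a" and r :: real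
    assume \<epsilon>: "\<epsilon> \<in> ad_1forms \<A> P"
    show "r *\<^sub>R \<epsilon> \<in> ad_1forms \<A> P"
      using \<epsilon> by (simp add: ad_1forms_def scaleR_fun_def lin linear_compose_scale_right
          smooth_fun_scaleR_const[OF \<P> op])
    assume "\<epsilon>' \<in> ad_1forms \<A> P"
    with \<epsilon> show "\<epsilon> + \<epsilon>' \<in> ad_1forms \<A> P"
      by (simp add: ad_1forms_def plus_fun_def lin linear_compose_add smooth_fun_add[OF \<P> op])
  qed
qed

section \<open>Clifford algebra in a fibre\<close>

lemma
  shows tensor_add_left: "tensor (s + t) a = tensor s a + tensor t a"
    and tensor_add_right: "tensor s (a + b) = tensor s a + tensor s b"
    and tensor_scale_left: "tensor (r *\<^sub>R s) a = r *\<^sub>R tensor s a"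
    and tensor_scale_right: "tensor s (r *\<^sub>R a) = r *\<^sub>R tensor s a"
  by (simp_all add: tensor_def vec_eq_iff scaleR_left_distrib scaleR_right_distrib mult.commute)

lemma linear_tensor_left: "linear (\<lambda>s. tensor s a)"
  by (rule linearI) (simp_all add: tensor_add_left tensor_scale_left)

lemma linear_tensor_right: "linear (tensor s)"
  by (rule linearI) (simp_all add: tensor_add_right tensor_scale_right)

lemmas tensor_zero_right = linear_0[OF linear_tensor_right]
  and tensor_sum_left = linear_sum[OF linear_tensor_left]
  and tensor_minus_left = linear_neg[OF linear_tensor_left]
  and tensor_sum_right = linear_sum[OF linear_tensor_right]
  and tensor_minus_right = linear_neg[OF linear_tensor_right]
  and tensor_diff_right = linear_diff[OF linear_tensor_right]

lemma spinor_expand: "(\<Sum>i\<in>UNIV. s $ i *\<^sub>R axis i 1) = (s :: real^8)"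
  using basis_expansion[of s] by (simp add: scalar_mult_eq_scaleR)

lemma tensor_expand: "(\<Sum>i\<in>UNIV. tensor (axis i 1) (X $ i)) = X"
proof -
  have "axis i 1 $ k *\<^sub>R X $ i = (if k = i then X $ i else 0)" for i k
    by (simp add: axis_def)
  then show ?thesis by (simp add: vec_eq_iff tensor_def)
qed

lemma linear_map_left: "linear (map_left L)"
  by (rule linearI)
    (simp_all add: map_left_def tensor_add_right sum.distrib tensor_scale_right scaleR_sum_right)

lemma map_left_tensor:
  assumes "linear L"
  shows "map_left L (tensor s a) = tensor (L s) a"
proof -
  have "map_left L (tensor s a) = tensor (\<Sum>i\<in>UNIV. s $ i *\<^sub>R L (axis i 1)) a"
    by (simp add: map_left_def tensor_sum_left tensor_scale_left tensor_scale_right tensor_def[of s a])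
  also have "(\<Sum>i\<in>UNIV. s $ i *\<^sub>R L (axis i 1)) = L s"
    using linear_sum[OF assms, of "\<lambda>i. s $ i *\<^sub>R axis i 1" UNIV]
    by (simp add: spinor_expand linear_scale[OF assms])
  finally show ?thesis .
qed

text \<open>The contraction \<open>h(t, _) \<otimes> id\<close> from spinors tensor
  \<open>'a\<close> to \<open>'a\<close>, in the standard basis.\<close>

definition spinor_pair :: "(real^8 \<Rightarrow> real^8 \<Rightarrow> real) \<Rightarrow> real^8 \<Rightarrow> 'a::real_vector^8 \<Rightarrow> 'a"
  where "spinor_pair h t X = (\<Sum>i\<in>UNIV. h t (axis i 1) *\<^sub>R X $ i)"

lemma linear_spinor_pair: "linear (spinor_pair h t)"
  by (rule linearI)
    (simp_all add: spinor_pair_def scaleR_right_distrib sum.distrib scaleR_sum_right mult.commute)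

lemma spinor_pair_tensor:
  assumes "bilinear h"
  shows "spinor_pair h t (tensor s a) = h t s *\<^sub>R a"
proof -
  have l: "linear (h t)" using assms by (simp add: bilinear_def)
  have "spinor_pair h t (tensor s a) = (\<Sum>i\<in>UNIV. s $ i *\<^sub>R h t (axis i 1)) *\<^sub>R a"
    by (simp add: spinor_pair_def tensor_def scaleR_sum_left mult.commute)
  also have "(\<Sum>i\<in>UNIV. s $ i *\<^sub>R h t (axis i 1)) = h t s"
    using linear_sum[OF l, of "\<lambda>i. s $ i *\<^sub>R axis i 1" UNIV]
    by (simp add: spinor_expand linear_scale[OF l])
  finally show ?thesis .
qed

lemma sum_to_7:
  fixes f :: "nat \<Rightarrow> 'a::comm_monoid_add"
  shows "sum f {1..7} = f 1 + (f 2 + (f 3 + (f 4 + (f 5 + (f 6 + f 7)))))"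
    "sum f {2..7} = f 2 + (f 3 + (f 4 + (f 5 + (f 6 + f 7))))"
    "sum f {3..7} = f 3 + (f 4 + (f 5 + (f 6 + f 7)))"
    "sum f {4..7} = f 4 + (f 5 + (f 6 + f 7))"
    "sum f {5..7} = f 5 + (f 6 + f 7)"
    "sum f {6..7} = f 6 + f 7"
    "sum f {7..7} = f 7"
    "sum f {8..7} = 0"
  by (simp_all add: eval_nat_numeral add.assoc)

text \<open>Terms with a repeated index vanish and the others may be sorted without change. Each set
  of three indices is met three times, once for each choice of the member that plays
  \<open>b\<close>.\<close>

lemma sum_alternating_3:
  fixes F :: "nat \<Rightarrow> nat \<Rightarrow> nat \<Rightarrow> 'a::real_vector"
  assumes "\<And>b c d. 1 \<le> c \<Longrightarrow> c < b \<Longrightarrow> b \<le> 7 \<Longrightarrow> F b c d = F c b d"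
    and "\<And>b c d. 1 \<le> d \<Longrightarrow> d < c \<Longrightarrow> c \<le> 7 \<Longrightarrow> F b c d = F b d c"
    and "\<And>b d. F b b d = 0" "\<And>b d. F b d b = 0"
  shows "(\<Sum>b=1..7. \<Sum>c=1..7. \<Sum>d=c+1..7. F b c d) =
    3 *\<^sub>R (\<Sum>b=1..7. \<Sum>c=b+1..7. \<Sum>d=c+1..7. F b c d)"
proof -
  have 3: "3 *\<^sub>R x = x + x + x" for x :: 'a
    using scaleR_add_left[of 1 2 x] by (simp add: scaleR_2 add.assoc)
  show ?thesis
    unfolding 3
    by (simp add: sum_to_7 assms del: One_nat_def)
      (simp add: assms(1)[of 5 6] assms(2)[of 5 6])
qed

lemma sum_square_split:
  fixes F :: "nat \<Rightarrow> nat \<Rightarrow> 'a::comm_monoid_add"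
  shows "(\<Sum>b=1..7. \<Sum>a=1..7. F b a) = (\<Sum>a=1..7. F a a) + (\<Sum>b=1..7. \<Sum>a=b+1..7. F b a + F a b)"
  by (simp add: sum_to_7 add_ac del: One_nat_def)

section \<open>The Clifford module at one point\<close>

locale clifford_fibre =
  fixes c :: "real^7 \<Rightarrow> real^8 \<Rightarrow> real^8"
    and h :: "real^8 \<Rightarrow> real^8 \<Rightarrow> real"
    and g :: "real^7 \<Rightarrow> real^7 \<Rightarrow> real"
    and e :: "nat \<Rightarrow> real^7"
  assumes bilinear_c: "bilinear c" and bilinear_h: "bilinear h" and bilinear_g: "bilinear g"
    and h_sym: "h s t = h t s" and h_pos: "s \<noteq> 0 \<Longrightarrow> h s s > 0"
    and g_sym: "g u v = g v u"
    and c_square: "c v (c v s) = - g v v *\<^sub>R s"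
    and c_isometric: "h (c v s) (c v t) = g v v * h s t"
    and orthonormal: "i \<in> {1..7} \<Longrightarrow> j \<in> {1..7} \<Longrightarrow> g (e i) (e j) = (if i = j then 1 else 0)"
    and frame_expand: "(\<Sum>i=1..7. g v (e i) *\<^sub>R e i) = v"
begin

lemma linear_c: "linear (c v)" and linear_c_left: "linear (\<lambda>v. c v s)"
  and linear_h: "linear (h s)" and linear_h_left: "linear (\<lambda>s. h s t)"
  and linear_g: "linear (g u)" and linear_g_left: "linear (\<lambda>u. g u v)"
  using bilinear_c bilinear_h bilinear_g by (simp_all add: bilinear_def)

lemmas c_simps = linear_add[OF linear_c] linear_diff[OF linear_c] linear_neg[OF linear_c]
    linear_0[OF linear_c] linear_scale[OF linear_c]
  and h_simps = linear_add[OF linear_h] linear_diff[OF linear_h] linear_neg[OF linear_h]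
    linear_0[OF linear_h] linear_scale[OF linear_h] linear_add[OF linear_h_left]
    linear_diff[OF linear_h_left] linear_neg[OF linear_h_left] linear_0[OF linear_h_left]
    linear_scale[OF linear_h_left]

lemma h_eq_0_iff: "h s s = 0 \<longleftrightarrow> s = 0"
  using h_pos[of s] linear_0[OF linear_h] by (cases "s = 0") auto

lemma c_anticommute: "c u (c v s) = - c v (c u s) - (2 * g u v) *\<^sub>R s"
proof -
  have "c (u + v) (c (u + v) s) = - g (u + v) (u + v) *\<^sub>R s" by (rule c_square)
  then have "c u (c u s) + c u (c v s) + (c v (c u s) + c v (c v s)) =
      - (g u u + g u v + (g v u + g v v)) *\<^sub>R s"
    by (simp add: linear_add[OF linear_c_left] c_simps linear_add[OF linear_g] linear_add[OF linear_g_left]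
        algebra_simps)
  then have "c u (c v s) + (c v (c u s) + (2 * g u v) *\<^sub>R s) = 0"
    by (simp add: c_square g_sym[of v u] algebra_simps)
  then have "c u (c v s) = - (c v (c u s) + (2 * g u v) *\<^sub>R s)"
    by (rule eq_neg_iff_add_eq_0[THEN iffD2])
  then show ?thesis by simp
qed

lemma h_c_c: "h (c u s) (c v s) = g u v * h s s"
proof -
  have "h (c (u + v) s) (c (u + v) s) = g (u + v) (u + v) * h s s" by (rule c_isometric)
  then have "2 * h (c u s) (c v s) = 2 * (g u v * h s s)"
    by (simp add: linear_add[OF linear_c_left] h_simps linear_add[OF linear_g] linear_add[OF linear_g_left]
        c_isometric g_sym[of v u] h_sym[of "c v s" "c u s"] algebra_simps)
  then show ?thesis by simp
qed

text \<open>Applying \<open>c v\<close> to both arguments scales \<open>h\<close> by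
  \<open>g v v\<close> and turns \<open>c v (c v s)\<close> into a multiple of \<open>s\<close>;
  then \<open>g v v\<close> is cancelled. When it is 0, \<open>c v\<close> annihilates every spinor
  because its values have length 0.\<close>

lemma c_skew: "h (c v s) t = - h s (c v t)"
proof (cases "g v v = 0")
  case True
  then have "c v s = 0" for s using h_eq_0_iff[of "c v s"] by (simp add: c_isometric)
  then show ?thesis by (simp add: h_simps)
next
  case False
  have "g v v * h (c v s) t = h (c v (c v s)) (c v t)" by (simp add: c_isometric)
  also have "\<dots> = g v v * - h s (c v t)" by (simp add: c_square h_simps)
  finally show ?thesis using False by (metis mult_left_cancel)
qed

lemma h_c_self: "h s (c v s) = 0"
  using c_skew[of v s s] by (simp add: h_sym[of "c v s" s])

text \<open>By \<open>h_c_self\<close> and \<open>h_c_c\<close> the spinor \<eta> and its seven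
  products with the frame are pairwise orthogonal of equal nonzero length: 1 + 7 = 8 independent
  vectors in dimension 8.\<close>

lemma spinor_basis:
  assumes "\<eta> \<noteq> 0"
  shows "span (insert \<eta> ((\<lambda>i. c (e i) \<eta>) ` {1..7})) = UNIV"
proof -
  let ?f = "\<lambda>i. c (e i) \<eta>"
  let ?B = "insert \<eta> (?f ` {1..7})"
  have pos: "h \<eta> \<eta> \<noteq> 0" using assms h_eq_0_iff by blast
  have ff: "h (?f i) (?f j) = (if i = j then h \<eta> \<eta> else 0)" if "i \<in> {1..7}" "j \<in> {1..7}" for i j
    using that by (simp add: h_c_c orthonormal)
  have inj: "inj_on ?f {1..7}"
  proof (rule inj_onI)
    fix i j assume "i \<in> {1..7}" "j \<in> {1..7}" "?f i = ?f j"
    then show "i = j" using ff[of i j] ff[of j j] pos by (auto split: if_splits)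
  qed
  have ne: "\<eta> \<notin> ?f ` {1..7}" using h_c_self[of \<eta>] pos by auto metis
  have orth: "h b b' = (if b = b' then h \<eta> \<eta> else 0)" if "b \<in> ?B" "b' \<in> ?B" for b b'
  proof -
    have f\<eta>: "h \<eta> (?f i) = 0" "h (?f i) \<eta> = 0" for i
      using h_c_self[of \<eta> "e i"] h_sym[of \<eta> "?f i"] by simp_all
    have "\<eta> \<noteq> ?f i" "?f i \<noteq> \<eta>" if "i \<in> {1..7}" for i
      using ne that imageI[of i "{1..7}" ?f] by metis+
    with that ff inj_on_eq_iff[OF inj] f\<eta> show ?thesis by (elim insertE imageE) simp_all
  qed
  have "independent ?B"
  proof (rule independent_if_scalars_zero)
    fix f b assume f: "(\<Sum>x\<in>?B. f x *\<^sub>R x) = 0" and b: "b \<in> ?B"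
    have "0 = h b (\<Sum>x\<in>?B. f x *\<^sub>R x)" unfolding f by (simp add: h_simps)
    also have "\<dots> = (\<Sum>x\<in>?B. f x * h b x)"
      unfolding linear_sum[OF linear_h] by (simp only: linear_scale[OF linear_h] real_scaleR_def)
    also have "\<dots> = (\<Sum>x\<in>?B. if b = x then f x * h \<eta> \<eta> else 0)"
      by (rule sum.cong[OF refl]) (simp only: orth[OF b] if_distrib[of "(*) _"] mult_zero_right)
    also have "\<dots> = f b * h \<eta> \<eta>"
      using b by (subst sum.delta') (simp_all only: finite_insert finite_imageI finite_atLeastAtMost if_True)
    finally show "f b = 0" using pos by simp
  qed simp
  moreover have "card ?B = dim (UNIV :: (real^8) set)"
    using card_insert_disjoint[OF _ ne] card_image[OF inj] by simp
  ultimately show ?thesis using card_eq_dim[of ?B UNIV] by auto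
qed

lemma spinor_eq_0I:
  assumes "\<eta> \<noteq> 0" "h \<eta> s = 0" "\<And>i. i \<in> {1..7} \<Longrightarrow> h (c (e i) \<eta>) s = 0"
  shows "s = 0"
proof -
  have "h s s = 0"
  proof (rule linear_eq_0_on_span[OF linear_h_left])
    show "s \<in> span (insert \<eta> ((\<lambda>i. c (e i) \<eta>) ` {1..7}))" using spinor_basis[OF assms(1)] by simp
  qed (use assms(2,3) in auto)
  then show ?thesis by (simp add: h_eq_0_iff)
qed

text \<open>Linearity in the spinor extends the equality to pairings with all spinors. Nondegeneracy
  of \<open>h\<close> then yields a spinor dual to each standard basis vector, which reads off one
  component of \<open>X - Y\<close>.\<close>

lemma spinor_pair_eqI:
  assumes "\<eta> \<noteq> 0" "spinor_pair h \<eta> X = spinor_pair h \<eta> Y"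
    and "\<And>i. i \<in> {1..7} \<Longrightarrow> spinor_pair h (c (e i) \<eta>) X = spinor_pair h (c (e i) \<eta>) Y"
  shows "X = Y"
proof -
  let ?Z = "X - Y"
  have l: "linear (\<lambda>t. spinor_pair h t ?Z)"
    by (rule linearI) (simp_all add: spinor_pair_def h_simps scaleR_left_distrib sum.distrib scaleR_sum_right)
  have z: "spinor_pair h t ?Z = 0" for t
  proof (rule linear_eq_0_on_span[OF l])
    show "t \<in> span (insert \<eta> ((\<lambda>i. c (e i) \<eta>) ` {1..7}))" using spinor_basis[OF assms(1)] by simp
  qed (use assms(2,3) in \<open>auto simp: linear_diff[OF linear_spinor_pair]\<close>)
  let ?f = "\<lambda>t. (\<chi> i. h t (axis i 1)) :: real^8"
  have f: "linear ?f" by (rule linearI) (simp_all add: vec_eq_iff h_simps)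
  have "inj ?f"
  proof (subst linear_injective_0[OF f], intro allI impI)
    fix t assume "?f t = 0"
    then have "h t (axis i 1) = 0" for i by (simp add: vec_eq_iff)
    then have "h t (\<Sum>i\<in>UNIV. t $ i *\<^sub>R axis i 1) = 0"
      unfolding linear_sum[OF linear_h] by (simp add: h_simps)
    then show "t = 0" by (simp add: spinor_expand h_eq_0_iff)
  qed
  then have surj: "surj ?f" by (simp add: linear_injective_imp_surjective[OF f])
  have "?Z $ j = 0" for j
  proof -
    obtain t where ft: "axis j 1 = ?f t" using surjD[OF surj] by blast
    have t: "h t (axis i 1) = (if i = j then 1 else 0)" for i
      using arg_cong[OF ft, of "\<lambda>v. v $ i"] by (simp add: axis_def)
    show ?thesis using z[of t] by (simp add: spinor_pair_def t if_distrib[of "\<lambda>r. r *\<^sub>R _"] cong: if_cong)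
  qed
  then show ?thesis by (simp add: vec_eq_iff)
qed

lemma c_frame_square: "i \<in> {1..7} \<Longrightarrow> c (e i) (c (e i) s) = - s"
  by (simp add: c_square orthonormal)

lemma c_frame_anticommute:
  "i \<in> {1..7} \<Longrightarrow> j \<in> {1..7} \<Longrightarrow> i \<noteq> j \<Longrightarrow> c (e i) (c (e j) s) = - c (e j) (c (e i) s)"
  using c_anticommute[of "e i" "e j" s] by (simp add: orthonormal)

text \<open>For the six indices \<open>b \<noteq> a\<close> the product \<open>e_b e_a e_b\<close>
  equals \<open>- e_a e_b e_b = e_a\<close>, while \<open>b = a\<close> gives \<open>- e_a\<close>;
  hence 6 - 1 = 5.\<close>

lemma sum_c_frame_conjugate:
  assumes "a \<in> {1..7}"
  shows "(\<Sum>b=1..7. c (e b) (c (e a) (c (e b) s))) = 5 *\<^sub>R c (e a) s"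
proof -
  have "c (e b) (c (e a) (c (e b) s)) = (if b = a then - 1 else 1) *\<^sub>R c (e a) s" if "b \<in> {1..7}" for b
    using that assms c_frame_anticommute[of b a "c (e b) s"]
    by (auto simp: c_frame_square c_simps)
  then have "(\<Sum>b=1..7. c (e b) (c (e a) (c (e b) s))) = (\<Sum>b=1..7. if b = a then - 1 else 1 :: real) *\<^sub>R c (e a) s"
    by (simp add: scaleR_sum_left)
  also have "(\<Sum>b=1..7. if b = a then - 1 else 1 :: real) = (\<Sum>b=1..7. 1 - (if b = a then 2 else 0))"
    by (rule sum.cong) auto
  also have "\<dots> = 5" using assms by (simp add: sum_subtractf)
  finally show ?thesis .
qed

definition triple :: "nat \<Rightarrow> nat \<Rightarrow> nat \<Rightarrow> real^8 \<Rightarrow> real^8"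
  where "triple i j k s = c (e i) (c (e j) (c (e k) s))"

text \<open>\<open>e_a\<close> anticommutes with the generators other than itself: three sign
  changes if \<open>a\<close> lies outside the triple, two if it is a member.\<close>

lemma triple_c:
  assumes "i \<in> {1..7}" "j \<in> {1..7}" "k \<in> {1..7}" "a \<in> {1..7}" "i \<noteq> j" "i \<noteq> k" "j \<noteq> k"
  shows "triple i j k (c (e a) s) = (if a \<in> {i, j, k} then 1 else -1) *\<^sub>R c (e a) (triple i j k s)"
proof -
  have *: "c (e b) (c (e a) s) = - (c (e a) (c (e b) s))" if "b \<in> {1..7}" "a \<noteq> b" for b s
    using c_frame_anticommute[of b a] that assms(4) by simp
  consider "i = a" | "j = a" | "k = a" | "a \<notin> {i, j, k}" by blast
  then show ?thesis
    by cases (use assms in \<open>simp_all add: triple_def * c_simps\<close>)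
qed

lemma triple_isometric:
  "i \<in> {1..7} \<Longrightarrow> j \<in> {1..7} \<Longrightarrow> k \<in> {1..7} \<Longrightarrow> h (triple i j k s) (triple i j k s) = h s s"
  by (simp add: triple_def c_isometric orthonormal)

text \<open>Every summand \<open>T\<close> of \<open>\<phi>\<close> acts isometrically, so \<open>\<phi> \<cdot> \<eta> = 7 \<eta>\<close> is the equality case of
  the Cauchy-Schwarz inequality and forces \<open>T \<eta> = \<eta>\<close>. On \<open>e\<^sub>a \<cdot> \<eta>\<close> the three summands containing
  \<open>e\<^sub>a\<close> act by \<open>1\<close> and the remaining four by \<open>-1\<close>.\<close>

lemma model_form_c:
  assumes \<phi>: "\<And>s. \<phi> s = triple 1 2 3 s + triple 1 4 5 s - triple 1 6 7 s + triple 2 4 6 s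
      + triple 2 5 7 s + triple 3 4 7 s - triple 3 5 6 s"
    and eig: "\<phi> \<eta> = 7 *\<^sub>R \<eta>" and a: "a \<in> {1..7}"
  shows "\<phi> (c (e a) \<eta>) = - c (e a) \<eta>"
proof -
  let ?d = "\<lambda>s. h (s - \<eta>) (s - \<eta>)"
  have d: "?d (triple i j k \<eta>) = 2 * h \<eta> \<eta> - 2 * h \<eta> (triple i j k \<eta>)"
      "?d (- triple i j k \<eta>) = 2 * h \<eta> \<eta> + 2 * h \<eta> (triple i j k \<eta>)"
    if "i \<in> {1..7}" "j \<in> {1..7}" "k \<in> {1..7}" for i j k
    using triple_isometric[OF that, of \<eta>] h_sym[of "triple i j k \<eta>" \<eta>] by (simp_all add: h_simps)
  have "h \<eta> (\<phi> \<eta>) = 7 * h \<eta> \<eta>" by (simp add: eig h_simps)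
  then have "h \<eta> (triple 1 2 3 \<eta>) + h \<eta> (triple 1 4 5 \<eta>) - h \<eta> (triple 1 6 7 \<eta>) + h \<eta> (triple 2 4 6 \<eta>)
      + h \<eta> (triple 2 5 7 \<eta>) + h \<eta> (triple 3 4 7 \<eta>) - h \<eta> (triple 3 5 6 \<eta>) = 7 * h \<eta> \<eta>"
    by (simp only: \<phi> h_simps)
  \<comment> \<open>The seven squared distances add up to 14 times the square length of \<eta> minus
    twice the product of \<eta> with \<open>\<phi> \<eta>\<close>; the eigenvalue 7 makes this
    0.\<close>
  then have "?d (triple 1 2 3 \<eta>) + ?d (triple 1 4 5 \<eta>) + ?d (- triple 1 6 7 \<eta>) + ?d (triple 2 4 6 \<eta>)
      + ?d (triple 2 5 7 \<eta>) + ?d (triple 3 4 7 \<eta>) + ?d (- triple 3 5 6 \<eta>) = 0"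
    by (simp add: d)
  moreover have "?d s \<ge> 0" for s using h_pos[of "s - \<eta>"] h_eq_0_iff[of "s - \<eta>"] by fastforce
  ultimately have "?d (triple 1 2 3 \<eta>) = 0" "?d (triple 1 4 5 \<eta>) = 0" "?d (- triple 1 6 7 \<eta>) = 0"
    "?d (triple 2 4 6 \<eta>) = 0" "?d (triple 2 5 7 \<eta>) = 0" "?d (triple 3 4 7 \<eta>) = 0" "?d (- triple 3 5 6 \<eta>) = 0"
    by (smt (verit))+
  then have T: "triple 1 2 3 \<eta> = \<eta>" "triple 1 4 5 \<eta> = \<eta>" "triple 1 6 7 \<eta> = - \<eta>"
    "triple 2 4 6 \<eta> = \<eta>" "triple 2 5 7 \<eta> = \<eta>" "triple 3 4 7 \<eta> = \<eta>" "triple 3 5 6 \<eta> = - \<eta>"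
    by (simp_all add: h_eq_0_iff minus_equation_iff[of _ \<eta>])
  have "a \<in> {1, 2, 3, 4, 5, 6, 7}" using a by auto
  then show ?thesis unfolding \<phi>
    by (elim insertE emptyE) (simp_all add: triple_c T c_simps del: One_nat_def)
qed

end


section \<open>Differentiability of solutions of linear systems\<close>

lemma differentiable_prod_at:
  fixes f :: "'i \<Rightarrow> 'z::real_normed_vector \<Rightarrow> real"
  assumes "\<And>i. i \<in> I \<Longrightarrow> f i differentiable (at z)"
  shows "(\<lambda>z. \<Prod>i\<in>I. f i z) differentiable (at z)"
  using assms by (induction I rule: infinite_finite_induct) auto

lemma differentiable_det:
  fixes M :: "'z::real_normed_vector \<Rightarrow> real^'n^'n"
  assumes "\<And>i j. (\<lambda>z. M z $ i $ j) differentiable (at z)"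
  shows "(\<lambda>z. det (M z)) differentiable (at z)"
  unfolding det_def
  by (intro differentiable_sum ballI differentiable_mult differentiable_const differentiable_prod_at assms) simp

text \<open>The unknowns \<open>a i\<close> enter only as solutions, without any regularity. By
  Cramer's rule row \<open>k\<close> of the inverse matrix consists of quotients of determinants,
  which are differentiable; combining the right-hand sides with this row recovers
  \<open>a k\<close>.\<close>

lemma differentiable_linear_solution:
  fixes M :: "'z::real_normed_vector \<Rightarrow> real^'n^'n"
    and a m :: "'n \<Rightarrow> 'z \<Rightarrow> 'a::real_normed_vector"
  assumes M: "\<And>i j. (\<lambda>z. M z $ i $ j) differentiable (at z0)"
    and m: "\<And>j. m j differentiable (at z0)" and det: "det (M z0) \<noteq> 0"
    and eq: "\<forall>\<^sub>F z in nhds z0. \<forall>j. (\<Sum>i\<in>UNIV. M z $ j $ i *\<^sub>R a i z) = m j z"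
  shows "a k differentiable (at z0)"
proof -
  define N where "N z j = det (\<chi> i l. if l = k then axis j 1 $ i else M z $ i $ l) / det (M z)" for z and j :: 'n
  have dN: "(\<lambda>z. N z j) differentiable (at z0)" for j
    unfolding N_def
  proof (intro differentiable_divide differentiable_det det M)
    show "(\<lambda>z. (\<chi> i l. if l = k then axis j 1 $ i else M z $ i $ l) $ i $ l) differentiable (at z0)" for i l
      using M by (cases "l = k") simp_all
  qed
  have sol: "a k z = (\<Sum>j\<in>UNIV. N z j *\<^sub>R m j z)"
    if dz: "det (M z) \<noteq> 0" and ez: "\<forall>j. (\<Sum>i\<in>UNIV. M z $ j $ i *\<^sub>R a i z) = m j z" for z
  proof -
    obtain B where B: "M z ** B = mat 1" "B ** M z = mat 1"
      using dz unfolding invertible_det_nz[symmetric] invertible_def by blast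
    \<comment> \<open>Column \<open>j\<close> of the inverse solves the system with right-hand side
      \<open>axis j 1\<close>, to which \<open>cramer\<close> applies.\<close>
    have N: "N z j = B $ k $ j" for j
    proof -
      have "M z *v (B *v axis j 1) = axis j 1" by (simp add: matrix_vector_mul_assoc B(1))
      then have "B *v axis j 1 = (\<chi> k. det (\<chi> i l. if l = k then axis j 1 $ i else M z $ i $ l) / det (M z))"
        using cramer[OF dz] by blast
      from arg_cong[OF this, of "\<lambda>v. v $ k"] show ?thesis
        by (simp add: N_def matrix_vector_mult_basis column_def)
    qed
    have "(\<Sum>j\<in>UNIV. N z j *\<^sub>R m j z) = (\<Sum>j\<in>UNIV. \<Sum>i\<in>UNIV. (B $ k $ j * M z $ j $ i) *\<^sub>R a i z)"
      using ez by (simp add: N scaleR_sum_right[symmetric] flip: scaleR_scaleR)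
    also have "\<dots> = (\<Sum>i\<in>UNIV. (B ** M z) $ k $ i *\<^sub>R a i z)"
      by (subst sum.swap) (simp add: matrix_matrix_mult_def scaleR_sum_left)
    also have "\<dots> = (\<Sum>i\<in>UNIV. if k = i then a i z else 0)"
      by (rule sum.cong) (simp_all add: B(2) mat_def)
    finally show ?thesis by simp
  qed
  \<comment> \<open>The determinant is known to be nonzero at \<open>z0\<close> only; continuity
    extends this to a neighbourhood, on which the solution formula holds.\<close>
  have "isCont (\<lambda>z. det (M z)) z0"
    by (rule differentiable_imp_continuous_within) (rule differentiable_det[OF M])
  then have "\<forall>\<^sub>F z in at z0. det (M z) \<noteq> 0"
    using det unfolding isCont_def by (rule tendsto_imp_eventually_ne)
  then have "\<forall>\<^sub>F z in nhds z0. det (M z) \<noteq> 0"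
    using det by (simp add: eventually_at_filter) (auto elim!: eventually_mono)
  with eq have ev: "\<forall>\<^sub>F z in nhds z0. (\<Sum>j\<in>UNIV. N z j *\<^sub>R m j z) = a k z"
    by eventually_elim (simp add: sol)
  have "(\<lambda>z. \<Sum>j\<in>UNIV. N z j *\<^sub>R m j z) differentiable (at z0)"
    by (intro differentiable_sum ballI differentiable_scaleR dN m) simp
  then obtain L where "((\<lambda>z. \<Sum>j\<in>UNIV. N z j *\<^sub>R m j z) has_derivative L) (at z0)"
    by (auto simp: differentiable_def)
  from has_derivative_eventually_nhds[OF this ev] show ?thesis by (rule differentiableI)
qed

lemma fdiff_linear_solution:
  fixes M :: "'m::{t2_space, second_countable_topology} \<Rightarrow> real^'n^'n"
    and \<A> :: "('m, 'e::real_normed_vector) chart set"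
    and a m :: "'n \<Rightarrow> 'm \<Rightarrow> 'a::real_normed_vector"
  assumes \<A>: "smooth_atlas \<A>"
    and M: "\<And>i j. fdiff \<A> (\<lambda>y. M y $ i $ j) x"
    and m: "\<And>j. fdiff \<A> (m j) x" and det: "det (M x) \<noteq> 0"
    and eq: "\<forall>\<^sub>F y in nhds x. \<forall>j. (\<Sum>i\<in>UNIV. M y $ j $ i *\<^sub>R a i y) = m j y"
  shows "fdiff \<A> (a k) x"
  unfolding fdiff_def
proof (rule differentiable_linear_solution)
  let ?C = "chart_at \<A> x"
  show "(\<lambda>z. (M \<circ> chart_inv ?C) z $ i $ j) differentiable at (snd ?C x)" for i j
    using M[of i j] by (simp add: fdiff_def o_def)
  show "m j \<circ> chart_inv ?C differentiable at (snd ?C x)" for j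
    using m by (simp add: fdiff_def)
  show "det ((M \<circ> chart_inv ?C) (snd ?C x)) \<noteq> 0"
    using det by (simp add: chart_inv_chart_at[OF \<A>])
  show "\<forall>\<^sub>F z in nhds (snd ?C x). \<forall>j. (\<Sum>i\<in>UNIV. (M \<circ> chart_inv ?C) z $ j $ i *\<^sub>R (a i \<circ> chart_inv ?C) z)
      = (m j \<circ> chart_inv ?C) z"
    using eventually_chart_inv[OF \<A> eq] by simp
qed

section \<open>Alternating 3-forms and the frame of a positive form\<close>

lemma alternating3_swap:
  assumes "alternating3 \<alpha>"
  shows "\<alpha> u v w = - \<alpha> v u w" "\<alpha> u v w = - \<alpha> u w v"
proof -
  have l1: "linear (\<lambda>u. \<alpha> u v w)" and l2: "linear (\<lambda>u. \<alpha> v u w)" and l3: "linear (\<lambda>u. \<alpha> v w u)"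
    and z: "\<alpha> u u w = 0" "\<alpha> w u u = 0" for u v w
    using assms by (auto simp: alternating3_def)
  have "\<alpha> (u + v) (u + v) w = \<alpha> u u w + \<alpha> v u w + (\<alpha> u v w + \<alpha> v v w)"
    by (simp only: linear_add[OF l1] linear_add[OF l2])
  then show "\<alpha> u v w = - \<alpha> v u w" by (simp add: z)
  have "\<alpha> u (v + w) (v + w) = \<alpha> u v v + \<alpha> u w v + (\<alpha> u v w + \<alpha> u w w)"
    by (simp only: linear_add[OF l2] linear_add[OF l3])
  then show "\<alpha> u v w = - \<alpha> u w v" by (simp add: z)
qed

lemma
  assumes "adapted_frame \<alpha> e"
  shows span_adapted_frame: "span (e ` {1..7}) = UNIV"
    and representation_adapted_frame:
      "i \<in> {1..7} \<Longrightarrow> j \<in> {1..7} \<Longrightarrow> representation (e ` {1..7}) (e j) (e i) = (if i = j then 1 else 0)"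
    and sum_representation_adapted_frame:
      "(\<Sum>i=1..7. representation (e ` {1..7}) v (e i) *\<^sub>R e i) = v"
proof -
  have inj: "inj_on e {1..7}" and ind: "independent (e ` {1..7})"
    using assms by (simp_all add: adapted_frame_def)
  have "card (e ` {1..7}) = dim (UNIV :: (real^7) set)" using card_image[OF inj] by simp
  then show span: "span (e ` {1..7}) = UNIV" using card_eq_dim[of "e ` {1..7}" UNIV] ind by auto
  show "representation (e ` {1..7}) (e j) (e i) = (if i = j then 1 else 0)" if "i \<in> {1..7}" "j \<in> {1..7}"
    using representation_basis[OF ind imageI[OF that(2)]] inj_on_eq_iff[OF inj that] by simp
  have "(\<Sum>b\<in>e ` {1..7}. representation (e ` {1..7}) v b *\<^sub>R b) = v"
    by (rule real_vector.sum_representation_eq[OF ind]) (simp_all add: span del: One_nat_def)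
  then show "(\<Sum>i=1..7. representation (e ` {1..7}) v (e i) *\<^sub>R e i) = v"
    by (simp add: sum.reindex[OF inj] del: One_nat_def)
qed

lemma g2_frame_adapted: "positive3 \<alpha> \<Longrightarrow> adapted_frame \<alpha> (g2_frame \<alpha>)"
  unfolding positive3_def g2_frame_def by (simp add: someI_ex)

lemma linear_g2_coframe: "positive3 \<alpha> \<Longrightarrow> linear (g2_coframe \<alpha> i)"
  using span_adapted_frame[OF g2_frame_adapted, of \<alpha>] g2_frame_adapted[of \<alpha>]
  by (intro linearI)
    (simp_all add: g2_coframe_def adapted_frame_def real_vector.representation_add
      real_vector.representation_scale del: One_nat_def)

lemma g2_metric_frame:
  assumes "positive3 \<alpha>" "i \<in> {1..7}"
  shows "g2_metric \<alpha> v (g2_frame \<alpha> i) = g2_coframe \<alpha> i v"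
proof -
  have "g2_metric \<alpha> v (g2_frame \<alpha> i) = (\<Sum>k=1..7. if k = i then g2_coframe \<alpha> k v else 0)"
    unfolding g2_metric_def
    by (rule sum.cong)
      (use assms(2) representation_adapted_frame[OF g2_frame_adapted[OF assms(1)], of _ i] in
        \<open>simp_all add: g2_coframe_def\<close>)
  then show ?thesis using assms(2) by simp
qed

section \<open>Spinors of a G2-structure and the action of its 3-form\<close>

locale twisted_spinors =
  fixes \<A> :: "('m::{t2_space, second_countable_topology}, real^7) chart set"
    and \<phi> :: "'m \<Rightarrow> form3"
    and D :: "'m \<Rightarrow> real^7 \<Rightarrow> ('m \<Rightarrow> real^7) \<Rightarrow> real^7"
    and S :: "'m spinors"
    and \<eta> :: "'m \<Rightarrow> real^8"
    and P :: "('m, 'p::{t2_space, second_countable_topology}, 'b::real_normed_vector,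
      'g::{group_add, t2_space, second_countable_topology}, 'a::real_normed_vector) pbundle"
    and \<theta> :: "'p \<Rightarrow> 'b \<Rightarrow> 'a"
  assumes g2_structure: "g2_structure \<A> \<phi>"
    and levi_civita: "levi_civita \<A> (\<lambda>x. g2_metric (\<phi> x)) D"
    and spinor_bundle: "spinor_bundle \<A> (\<lambda>x. g2_metric (\<phi> x)) D S"
    and killing_spinor: "killing_spinor \<A> \<phi> S \<eta>"
    and principal_bundle: "principal_bundle \<A> P"
    and principal_connection: "principal_connection P \<theta>"
begin

abbreviation frame :: "'m \<Rightarrow> nat \<Rightarrow> real^7"
  where "frame x \<equiv> g2_frame (\<phi> x)"

lemma positive: "positive3 (\<phi> x)"
  using g2_structure by (simp add: g2_structure_def)

lemma adapted: "adapted_frame (\<phi> x) (frame x)"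
  by (rule g2_frame_adapted[OF positive])

lemmas spin_vector_bundle = spinor_bundle[unfolded spinor_bundle_def, THEN conjunct1]
  and spin_inner_fibre = spinor_bundle[unfolded spinor_bundle_def, THEN conjunct2, THEN conjunct1, rule_format]
  and smooth_spin_inner = spinor_bundle[unfolded spinor_bundle_def, THEN conjunct2, THEN conjunct2,
    THEN conjunct1, rule_format]
  and clifford_fibre = spinor_bundle[unfolded spinor_bundle_def, THEN conjunct2, THEN conjunct2,
    THEN conjunct2, THEN conjunct1, rule_format]
  and smooth_clifford = spinor_bundle[unfolded spinor_bundle_def, THEN conjunct2, THEN conjunct2,
    THEN conjunct2, THEN conjunct2, THEN conjunct1, rule_format]
  and spin_metric_connection = spinor_bundle[unfolded spinor_bundle_def, THEN conjunct2, THEN conjunct2,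
    THEN conjunct2, THEN conjunct2, THEN conjunct2, THEN conjunct1]
  and spin_conn_clifford = spinor_bundle[unfolded spinor_bundle_def, THEN conjunct2, THEN conjunct2,
    THEN conjunct2, THEN conjunct2, THEN conjunct2, THEN conjunct2, rule_format]

text \<open>The metric is the sum of products of the coordinates dual to \<open>frame x\<close>.
  Hence this frame is orthonormal, and \<open>frame_expand\<close> is the expansion of a vector in
  that basis.\<close>

sublocale fibre: clifford_fibre "clifford S x" "spin_inner S x" "g2_metric (\<phi> x)" "frame x" for x
proof
  have co: "linear (g2_coframe (\<phi> x) i)" for i by (rule linear_g2_coframe[OF positive])
  show "bilinear (clifford S x)" "bilinear (spin_inner S x)"
    using spin_inner_fibre[of x] clifford_fibre[of x] by simp_all
  show "bilinear (g2_metric (\<phi> x))"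
    unfolding bilinear_def g2_metric_def
    by (auto intro!: linearI simp: linear_add[OF co] linear_scale[OF co] algebra_simps sum.distrib sum_distrib_left)
  show "g2_metric (\<phi> x) u v = g2_metric (\<phi> x) v u" for u v
    by (simp add: g2_metric_def mult.commute)
  show "spin_inner S x s t = spin_inner S x t s" "s \<noteq> 0 \<Longrightarrow> spin_inner S x s s > 0" for s t
    using spin_inner_fibre[of x] by simp_all
  show "clifford S x v (clifford S x v s) = - g2_metric (\<phi> x) v v *\<^sub>R s"
    "spin_inner S x (clifford S x v s) (clifford S x v t) = g2_metric (\<phi> x) v v * spin_inner S x s t" for v s t
    using clifford_fibre[of x] by simp_all
  show "g2_metric (\<phi> x) (frame x i) (frame x j) = (if i = j then 1 else 0)"
    if "i \<in> {1..7}" "j \<in> {1..7}" for i j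
    using representation_adapted_frame[OF adapted, of j i x] that
    by (auto simp: g2_metric_frame[OF positive that(2)] g2_coframe_def)
  show "(\<Sum>i=1..7. g2_metric (\<phi> x) v (frame x i) *\<^sub>R frame x i) = v" for v
    using sum_representation_adapted_frame[OF adapted, of x v]
    by (simp add: g2_metric_frame[OF positive] g2_coframe_def)
qed

lemma clifford_form3_expand:
  "clifford_form3 \<phi> S x (\<phi> x) s =
    fibre.triple x 1 2 3 s + fibre.triple x 1 4 5 s - fibre.triple x 1 6 7 s + fibre.triple x 2 4 6 s
    + fibre.triple x 2 5 7 s + fibre.triple x 3 4 7 s - fibre.triple x 3 5 6 s"
proof -
  have "clifford_form3 \<phi> S x (\<phi> x) s =
      (\<Sum>a=1..7. \<Sum>b=a+1..7. \<Sum>d=b+1..7. model_coeff a b d *\<^sub>R fibre.triple x a b d s)"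
    unfolding clifford_form3_def Let_def
    by (intro sum.cong refl) (use adapted[of x] in \<open>simp add: adapted_frame_def fibre.triple_def\<close>)
  then show ?thesis by (simp add: sum_to_7 model_coeff_def del: One_nat_def)
qed

lemma clifford_form3_killing:
  assumes "a \<in> {1..7}"
  shows "clifford_form3 \<phi> S x (\<phi> x) (clifford S x (frame x a) (\<eta> x)) = - clifford S x (frame x a) (\<eta> x)"
  by (rule fibre.model_form_c[OF clifford_form3_expand _ assms])
    (use killing_spinor in \<open>simp add: killing_spinor_def\<close>)

text \<open>Multiplying the contraction by the frame vector again produces each monomial of the
  3-form three times, once for each of its factors taken to the front. A swap of two indices changes
  the sign of both the coefficient and the Clifford product, so the order of distinct indices does
  not matter.\<close>

lemma sum_clifford_form2:
  "(\<Sum>b=1..7. clifford S x (frame x b) (clifford_form2 \<phi> S x (\<phi> x (frame x b)) s)) =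
    3 *\<^sub>R clifford_form3 \<phi> S x (\<phi> x) s"
proof -
  have alt: "alternating3 (\<phi> x)" using positive[of x] by (simp add: positive3_def)
  let ?F = "\<lambda>b c d. \<phi> x (frame x b) (frame x c) (frame x d) *\<^sub>R fibre.triple x b c d s"
  have "(\<Sum>b=1..7. clifford S x (frame x b) (clifford_form2 \<phi> S x (\<phi> x (frame x b)) s)) =
      (\<Sum>b=1..7. \<Sum>c=1..7. \<Sum>d=c+1..7. ?F b c d)"
    by (simp add: clifford_form2_def Let_def linear_sum[OF fibre.linear_c] fibre.c_simps fibre.triple_def)
  also have "\<dots> = 3 *\<^sub>R (\<Sum>b=1..7. \<Sum>c=b+1..7. \<Sum>d=c+1..7. ?F b c d)"
  proof (rule sum_alternating_3)
    fix b c d :: nat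
    show "?F b c d = ?F c b d" if "1 \<le> c" "c < b" "b \<le> 7"
      using alternating3_swap(1)[OF alt, of "frame x b" "frame x c"]
        fibre.c_frame_anticommute[of b c x] that
      by (simp add: fibre.triple_def)
    show "?F b c d = ?F b d c" if "1 \<le> d" "d < c" "c \<le> 7"
      using alternating3_swap(2)[OF alt, of "frame x b" "frame x c" "frame x d"]
        fibre.c_frame_anticommute[of c d x] that
      by (simp add: fibre.triple_def fibre.c_simps)
    show "?F b b d = 0" "?F b d b = 0" using alt by (simp_all add: alternating3_def)
  qed
  finally show ?thesis by (simp add: clifford_form3_def Let_def fibre.triple_def)
qed

end

section \<open>The covariant derivative of a twisted spinor\<close>

context twisted_spinors
begin

lemma base: "smooth_atlas \<A>" and total: "smooth_atlas (total P)"
  using principal_bundle by (simp_all add: principal_bundle_def)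

lemmas bundle_conn = principal_bundle principal_connection

lemma eta_nonzero: "\<eta> x \<noteq> 0"
  and spin_conn_eta: "spin_conn S x v \<eta> = - (1/2) *\<^sub>R clifford S x v (\<eta> x)"
  and smooth_eta: "smooth_section \<A> (spin_triv S) UNIV \<eta>"
  using killing_spinor by (simp_all add: killing_spinor_def)

abbreviation cfield :: "'m \<Rightarrow> real^7 \<Rightarrow> 'm \<Rightarrow> real^7"
  where "cfield x \<equiv> coord_field \<A> (chart_at \<A> x)"

text \<open>The same \<open>SOME\<close> term as in \<open>twisted_conn\<close>, so that
  \<open>twisted_conn\<close> unfolds literally to expressions in \<open>triv\<close>,
  \<open>spin_frame\<close> and \<open>coeff\<close>.\<close>

definition triv :: "'m \<Rightarrow> ('m, real^8) triv"
  where "triv x = (SOME T. T \<in> spin_triv S \<and> x \<in> fst T)"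

definition spin_frame :: "'m \<Rightarrow> 8 \<Rightarrow> 'm \<Rightarrow> real^8"
  where "spin_frame x i = (\<lambda>y. inv (snd (triv x) y) (axis i 1))"

lemma triv_in: "triv x \<in> spin_triv S" and in_triv: "x \<in> fst (triv x)"
proof -
  have "(\<Union>(U, \<tau>)\<in>spin_triv S. U) = UNIV" using spin_vector_bundle by (simp add: vector_bundle_def)
  then have "\<exists>T. T \<in> spin_triv S \<and> x \<in> fst T" by (metis UNIV_I UN_E case_prod_unfold)
  from someI_ex[OF this] show "triv x \<in> spin_triv S" "x \<in> fst (triv x)" by (simp_all add: triv_def)
qed

lemma open_triv: "open (fst (triv x))"
  and linear_triv: "y \<in> fst (triv x) \<Longrightarrow> linear (snd (triv x) y)"
  and bij_triv: "y \<in> fst (triv x) \<Longrightarrow> bij (snd (triv x) y)"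
proof -
  have "\<forall>(U, \<tau>)\<in>spin_triv S. open U \<and> (\<forall>x\<in>U. linear (\<tau> x) \<and> bij (\<tau> x))"
    using spin_vector_bundle by (simp add: vector_bundle_def)
  from bspec[OF this triv_in[of x]]
  show "open (fst (triv x))" "y \<in> fst (triv x) \<Longrightarrow> linear (snd (triv x) y)"
    "y \<in> fst (triv x) \<Longrightarrow> bij (snd (triv x) y)"
    by (simp_all add: case_prod_unfold)
qed

lemma linear_inv_triv:
  assumes "y \<in> fst (triv x)"
  shows "linear (inv (snd (triv x) y))"
  using linear_triv[OF assms] bij_triv[OF assms]
  by (simp add: bij_is_surj linear_inj_imp_surj bij_is_inj inj_linear_imp_inv_linear)

lemma smooth_spin_frame: "smooth_section \<A> (spin_triv S) (fst (triv x)) (spin_frame x i)"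
proof -
  have "\<forall>(U, \<tau>)\<in>spin_triv S. \<forall>(V, \<rho>)\<in>spin_triv S. \<forall>w. smooth_fun \<A> (U \<inter> V) (\<lambda>x. \<rho> x (inv (\<tau> x) w))"
    using spin_vector_bundle by (simp add: vector_bundle_def)
  from bspec[OF this triv_in[of x]] show ?thesis
    unfolding smooth_section_def spin_frame_def by (simp add: case_prod_unfold)
qed

lemma near_eta: "smooth_section_near \<A> (spin_triv S) x \<eta>"
  by (rule smooth_section_nearI[OF smooth_eta]) simp_all

lemma near_spin_frame: "smooth_section_near \<A> (spin_triv S) x (spin_frame x i)"
  by (rule smooth_section_nearI[OF smooth_spin_frame open_triv in_triv])

text \<open>Coordinate fields take any prescribed value at \<open>x\<close>, so these smooth
  sections stand in for the products of \<eta> with \<open>frame\<close>, whose regularity is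
  unknown.\<close>

lemma near_cfield_eta:
  "smooth_section_near \<A> (spin_triv S) x (\<lambda>y. clifford S y (cfield x w y) (\<eta> y))"
proof -
  have o: "open (fst (chart_at \<A> x))" by (rule open_chart[OF base chart_at_in_atlas[OF base]])
  have "smooth_section \<A> (spin_triv S) (fst (chart_at \<A> x)) (\<lambda>y. clifford S y (cfield x w y) (\<eta> y))"
    by (rule smooth_clifford[OF o smooth_section_coord_field[OF base chart_at_in_atlas[OF base]]
          smooth_section_subset[OF smooth_eta subset_UNIV]])
  then show ?thesis by (rule smooth_section_nearI[OF _ o in_chart_at[OF base]])
qed

lemma fdiff_spin_inner:
  assumes "smooth_section_near \<A> (spin_triv S) x s" "smooth_section_near \<A> (spin_triv S) x t"
  shows "fdiff \<A> (\<lambda>y. spin_inner S y (s y) (t y)) x"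
proof -
  obtain U where U: "open U" "x \<in> U" "smooth_section \<A> (spin_triv S) U s"
    using assms(1) unfolding smooth_section_near_def by blast
  obtain V where V: "open V" "x \<in> V" "smooth_section \<A> (spin_triv S) V t"
    using assms(2) unfolding smooth_section_near_def by blast
  have "smooth_fun \<A> (U \<inter> V) (\<lambda>y. spin_inner S y (s y) (t y))"
    by (rule smooth_spin_inner[OF open_Int[OF U(1) V(1)] smooth_section_subset[OF U(3) Int_lower1]
          smooth_section_subset[OF V(3) Int_lower2]])
  then show ?thesis by (rule smooth_fun_fdiff[OF base]) (use U V in simp)
qed

lemma fderiv_spin_inner:
  assumes "smooth_section_near \<A> (spin_triv S) x s" "smooth_section_near \<A> (spin_triv S) x t"
  shows "fderiv \<A> (\<lambda>y. spin_inner S y (s y) (t y)) x v =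
    spin_inner S x (spin_conn S x v s) (t x) + spin_inner S x (s x) (spin_conn S x v t)"
  using spin_metric_connection assms unfolding metric_connection_def by simp

text \<open>The Killing equation makes the derivative of \<eta> a multiple of
  \<open>v \<cdot> \<eta>\<close>, which is orthogonal to \<eta>. The square length of \<eta> thus
  behaves like a constant in later product rules.\<close>

lemma fderiv_norm_eta: "fderiv \<A> (\<lambda>y. spin_inner S y (\<eta> y) (\<eta> y)) x v = 0"
proof -
  have "spin_inner S x (\<eta> x) (clifford S x v (\<eta> x)) = 0" by (rule fibre.h_c_self)
  then show ?thesis
    by (simp add: fderiv_spin_inner[OF near_eta near_eta] spin_conn_eta fibre.h_simps
        fibre.h_sym[of x "clifford S x v (\<eta> x)" "\<eta> x"])
qed

lemma sum_spin_frame: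
  assumes "y \<in> fst (triv x)"
  shows "(\<Sum>i\<in>UNIV. tensor (spin_frame x i y) (map_left (snd (triv x) y) X $ i)) = X"
proof -
  let ?\<tau> = "snd (triv x) y"
  have "(\<Sum>i\<in>UNIV. tensor (spin_frame x i y) (map_left ?\<tau> X $ i)) = map_left (inv ?\<tau>) (map_left ?\<tau> X)"
    by (simp add: map_left_def[of "inv ?\<tau>"] spin_frame_def)
  also have "\<dots> = (\<Sum>i\<in>UNIV. map_left (inv ?\<tau>) (tensor (?\<tau> (axis i 1)) (X $ i)))"
    unfolding map_left_def[of ?\<tau>] by (rule linear_sum[OF linear_map_left])
  also have "\<dots> = (\<Sum>i\<in>UNIV. tensor (axis i 1) (X $ i))"
    by (simp add: map_left_tensor[OF linear_inv_triv[OF assms]] inv_f_f[OF bij_is_inj[OF bij_triv[OF assms]]])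
  finally show ?thesis by (simp add: tensor_expand)
qed

context
  fixes \<epsilon> :: "'p \<Rightarrow> real^7 \<Rightarrow> 'a"
  assumes \<epsilon>: "\<epsilon> \<in> ad_1forms \<A> P"
begin

lemma linear_form: "linear (\<epsilon> p)"
  using \<epsilon> by (simp add: ad_1forms_def)

abbreviation \<mu> :: "'p \<Rightarrow> 'a^8"
  where "\<mu> \<equiv> ad_clifford1 \<phi> S \<eta> P \<epsilon>"

definition coeff :: "'m \<Rightarrow> 8 \<Rightarrow> 'p \<Rightarrow> 'a"
  where "coeff x i = (\<lambda>q. map_left (snd (triv x) (proj P q)) (\<mu> q) $ i)"

lemma ad_clifford1_eq:
  "\<mu> q = (\<Sum>a=1..7. tensor (clifford S (proj P q) (frame (proj P q) a) (\<eta> (proj P q))) (\<epsilon> q (frame (proj P q) a)))"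
  by (simp add: ad_clifford1_def Let_def)

lemma pair_eta: "spinor_pair (spin_inner S (proj P q)) (\<eta> (proj P q)) (\<mu> q) = 0"
  unfolding ad_clifford1_eq linear_sum[OF linear_spinor_pair] spinor_pair_tensor[OF fibre.bilinear_h]
  by (simp add: fibre.h_c_self)

text \<open>Polarised isometry turns the pairing into the expansion of \<open>v\<close> in the
  frame, after which the frame has disappeared. The right-hand side is as regular as \<eta>,
  \<epsilon> and the field put for \<open>v\<close>.\<close>

lemma pair_clifford_eta:
  "spinor_pair (spin_inner S (proj P q)) (clifford S (proj P q) v (\<eta> (proj P q))) (\<mu> q) =
    spin_inner S (proj P q) (\<eta> (proj P q)) (\<eta> (proj P q)) *\<^sub>R \<epsilon> q v"
proof -
  let ?y = "proj P q"
  have "spinor_pair (spin_inner S ?y) (clifford S ?y v (\<eta> ?y)) (\<mu> q) =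
      (\<Sum>a=1..7. spin_inner S ?y (\<eta> ?y) (\<eta> ?y) *\<^sub>R g2_metric (\<phi> ?y) v (frame ?y a) *\<^sub>R \<epsilon> q (frame ?y a))"
    unfolding ad_clifford1_eq linear_sum[OF linear_spinor_pair] spinor_pair_tensor[OF fibre.bilinear_h]
    by (simp add: fibre.h_c_c mult.commute)
  also have "\<dots> = spin_inner S ?y (\<eta> ?y) (\<eta> ?y) *\<^sub>R
      \<epsilon> q (\<Sum>a=1..7. g2_metric (\<phi> ?y) v (frame ?y a) *\<^sub>R frame ?y a)"
    unfolding linear_sum[OF linear_form] linear_scale[OF linear_form] scaleR_sum_right ..
  finally show ?thesis by (simp only: fibre.frame_expand)
qed

lemma pair_coeff:
  assumes "proj P q \<in> fst (triv x)"
  shows "spinor_pair (spin_inner S (proj P q)) t (\<mu> q) =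
    (\<Sum>i\<in>UNIV. spin_inner S (proj P q) t (spin_frame x i (proj P q)) *\<^sub>R coeff x i q)"
  by (subst sum_spin_frame[OF assms, of "\<mu> q", symmetric])
    (simp add: linear_sum[OF linear_spinor_pair] spinor_pair_tensor[OF fibre.bilinear_h] coeff_def)

lemma eventually_proj_triv: "\<forall>\<^sub>F q in nhds p. proj P q \<in> fst (triv (proj P p))"
  by (rule eventually_proj[OF bundle_conn])
    (use open_triv[of "proj P p"] in_triv[of "proj P p"] in \<open>auto simp: eventually_nhds\<close>)

text \<open>The coefficients solve the linear system whose equations are the pairings with eight
  test sections. Matrix and right-hand side are differentiable, and the matrix is invertible at
  \<open>p\<close> because the test sections span the fibre there.\<close>

lemma fdiff_coeff: "fdiff (total P) (coeff (proj P p) k) p"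
proof -
  let ?x = "proj P p"
  \<comment> \<open>Index 0 stands for \<eta>, indices 1 to 7 for its products with coordinate
    fields that extend the frame at the fixed point \<open>?x\<close>.\<close>
  define t where "t k = (if k = 0 then \<eta> else (\<lambda>y. clifford S y (cfield ?x (frame ?x k) y) (\<eta> y)))" for k :: nat
  \<comment> \<open>The rows of the matrix are indexed by the type \<open>8\<close>, the test
    sections by 0 to 7.\<close>
  obtain f :: "8 \<Rightarrow> nat" where f: "bij_betw f UNIV {0..7}"
    using finite_same_card_bij[of "UNIV :: 8 set" "{0..7::nat}"] by auto
  define M :: "'p \<Rightarrow> real^8^8" where
    "M q = (\<chi> j i. spin_inner S (proj P q) (t (f j) (proj P q)) (spin_frame ?x i (proj P q)))" for q
  define m where "m j q = spinor_pair (spin_inner S (proj P q)) (t (f j) (proj P q)) (\<mu> q)" for j :: 8 and q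
  have near: "smooth_section_near \<A> (spin_triv S) ?x (t k)" for k
    by (simp add: t_def near_eta near_cfield_eta)
  show ?thesis
  proof (rule fdiff_linear_solution[OF total])
    show "fdiff (total P) (\<lambda>q. M q $ j $ i) p" for i j
      unfolding M_def using fdiff_proj[OF bundle_conn fdiff_spin_inner[OF near near_spin_frame]] by simp
    show "fdiff (total P) (m j) p" for j
    proof (cases "f j = 0")
      case True
      then have "m j = (\<lambda>q. 0)" by (simp add: m_def t_def pair_eta fun_eq_iff)
      then show ?thesis by (simp add: fdiff_const)
    next
      case False
      then have "m j = (\<lambda>q. spin_inner S (proj P q) (\<eta> (proj P q)) (\<eta> (proj P q)) *\<^sub>R
          \<epsilon> q (cfield ?x (frame ?x (f j)) (proj P q)))"
        by (simp add: m_def t_def pair_clifford_eta fun_eq_iff)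
      moreover have "fdiff (total P) \<dots> p"
        by (rule fdiff_scaleR[OF fdiff_proj[OF bundle_conn fdiff_spin_inner[OF near_eta near_eta]]
              fdiff_ad_1form[OF principal_bundle \<epsilon>] chart_inv_chart_at[OF total]])
      ultimately show ?thesis by simp
    qed
    \<comment> \<open>A kernel vector, read as a spinor through the trivialisation, is orthogonal to
      all eight test spinors.\<close>
    have "v = 0" if v: "M p *v v = 0" for v
    proof -
      let ?s = "inv (snd (triv ?x) ?x) v"
      have "?s = (\<Sum>i\<in>UNIV. v $ i *\<^sub>R spin_frame ?x i ?x)"
        using linear_sum[OF linear_inv_triv[OF in_triv], of ?x "\<lambda>i. v $ i *\<^sub>R axis i 1" UNIV]
        by (simp add: spinor_expand spin_frame_def linear_scale[OF linear_inv_triv[OF in_triv]])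
      then have s: "spin_inner S ?x u ?s = (\<Sum>i\<in>UNIV. spin_inner S ?x u (spin_frame ?x i ?x) * v $ i)" for u
        by (simp add: linear_sum[OF fibre.linear_h] linear_scale[OF fibre.linear_h] mult.commute)
      have "(M p *v v) $ j = 0" for j using v by simp
      then have j: "spin_inner S ?x (t (f j) ?x) ?s = 0" for j
        by (simp add: s matrix_vector_mult_def M_def)
      have k: "spin_inner S ?x (t k ?x) ?s = 0" if "k \<le> 7" for k
      proof -
        have "k \<in> range f" using bij_betw_imp_surj_on[OF f] that by simp
        then show ?thesis using j by auto
      qed
      have "?s = 0"
      proof (rule fibre.spinor_eq_0I[OF eta_nonzero])
        show "spin_inner S ?x (\<eta> ?x) ?s = 0" using k[of 0] by (simp add: t_def)
        show "spin_inner S ?x (clifford S ?x (frame ?x i) (\<eta> ?x)) ?s = 0" if "i \<in> {1..7}" for i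
          using k[of i] that by (simp add: t_def coord_field_self[OF base])
      qed
      then have "snd (triv ?x) ?x ?s = 0" using linear_0[OF linear_triv[OF in_triv]] by simp
      then show "v = 0" by (simp add: surj_f_inv_f[OF bij_is_surj[OF bij_triv[OF in_triv]]])
    qed
    then have "invertible (M p)"
      unfolding invertible_left_inverse matrix_left_invertible_ker by blast
    then show "det (M p) \<noteq> 0" by (simp add: invertible_det_nz)
    show "\<forall>\<^sub>F q in nhds p. \<forall>j. (\<Sum>i\<in>UNIV. M q $ j $ i *\<^sub>R coeff ?x i q) = m j q"
      using eventually_proj_triv[of p] by eventually_elim (simp add: M_def m_def pair_coeff)
  qed
qed

text \<open>The case \<open>t = 0\<close> of \<open>twisted_conn\<close>, on \<open>\<epsilon> \<cdot> \<eta>\<close>.\<close>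

definition conn :: "'p \<Rightarrow> real^7 \<Rightarrow> 'a^8"
  where "conn p v = (\<Sum>i\<in>UNIV. tensor (spin_conn S (proj P p) v (spin_frame (proj P p) i)) (coeff (proj P p) i p)
    + tensor (spin_frame (proj P p) i (proj P p)) (ad_deriv \<A> P \<theta> p v (coeff (proj P p) i)))"

text \<open>The Leibniz rule for the contraction, solved for the twisted derivative. The pairing is
  a sum of products of base functions \<open>h(t, s_i)\<close> with coefficients; metric
  compatibility splits the derivative of each base function into a part that differentiates
  \<open>t\<close> and a part that belongs to \<open>conn\<close>.\<close>

lemma pair_conn:
  assumes t: "smooth_section_near \<A> (spin_triv S) (proj P p) t"
  shows "spinor_pair (spin_inner S (proj P p)) (t (proj P p)) (conn p v) =
    ad_deriv \<A> P \<theta> p v (\<lambda>q. spinor_pair (spin_inner S (proj P q)) (t (proj P q)) (\<mu> q)) -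
    spinor_pair (spin_inner S (proj P p)) (spin_conn S (proj P p) v t) (\<mu> p)"
proof -
  let ?x = "proj P p" and ?w = "horizontal_lift \<A> P \<theta> p v"
  let ?F = "\<lambda>i y. spin_inner S y (t y) (spin_frame ?x i y)"
  have F: "fdiff \<A> (?F i) ?x" for i by (rule fdiff_spin_inner[OF t near_spin_frame])
  have FP: "fdiff (total P) (\<lambda>q. ?F i (proj P q)) p" for i by (rule fdiff_proj[OF bundle_conn F])
  have dF: "fderiv (total P) (\<lambda>q. ?F i (proj P q)) p ?w =
      spin_inner S ?x (spin_conn S ?x v t) (spin_frame ?x i ?x) +
      spin_inner S ?x (t ?x) (spin_conn S ?x v (spin_frame ?x i))" for i
    unfolding ad_deriv_proj[OF bundle_conn F] by (rule fderiv_spin_inner[OF t near_spin_frame])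
  have prod: "fdiff (total P) (\<lambda>q. ?F i (proj P q) *\<^sub>R coeff ?x i q) p" for i
    by (rule fdiff_scaleR[OF FP fdiff_coeff chart_inv_chart_at[OF total]])
  have ev: "\<forall>\<^sub>F q in nhds p. (\<Sum>i\<in>UNIV. ?F i (proj P q) *\<^sub>R coeff ?x i q) =
      spinor_pair (spin_inner S (proj P q)) (t (proj P q)) (\<mu> q)"
    using eventually_proj_triv[of p] by eventually_elim (simp add: pair_coeff)
  have "ad_deriv \<A> P \<theta> p v (\<lambda>q. spinor_pair (spin_inner S (proj P q)) (t (proj P q)) (\<mu> q)) =
      fderiv (total P) (\<lambda>q. \<Sum>i\<in>UNIV. ?F i (proj P q) *\<^sub>R coeff ?x i q) p ?w"
    unfolding ad_deriv_def fderiv_cong[OF total ev fdiff_sum[OF prod]] ..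
  also have "\<dots> = (\<Sum>i\<in>UNIV. fderiv (total P) (\<lambda>q. ?F i (proj P q)) p ?w *\<^sub>R coeff ?x i p +
      ?F i ?x *\<^sub>R fderiv (total P) (coeff ?x i) p ?w)"
    by (simp only: fderiv_sum[OF prod] fderiv_scaleR[OF FP fdiff_coeff chart_inv_chart_at[OF total]])
  also have "\<dots> = (\<Sum>i\<in>UNIV. spin_inner S ?x (t ?x) (spin_conn S ?x v (spin_frame ?x i)) *\<^sub>R coeff ?x i p +
      ?F i ?x *\<^sub>R ad_deriv \<A> P \<theta> p v (coeff ?x i)) +
      (\<Sum>i\<in>UNIV. spin_inner S ?x (spin_conn S ?x v t) (spin_frame ?x i ?x) *\<^sub>R coeff ?x i p)"
    unfolding dF sum.distrib[symmetric] by (rule sum.cong) (simp_all add: scaleR_left_distrib ad_deriv_def)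
  also have "(\<Sum>i\<in>UNIV. spin_inner S ?x (spin_conn S ?x v t) (spin_frame ?x i ?x) *\<^sub>R coeff ?x i p) =
      spinor_pair (spin_inner S ?x) (spin_conn S ?x v t) (\<mu> p)"
    by (rule pair_coeff[OF in_triv, symmetric])
  also have "(\<Sum>i\<in>UNIV. spin_inner S ?x (t ?x) (spin_conn S ?x v (spin_frame ?x i)) *\<^sub>R coeff ?x i p +
      ?F i ?x *\<^sub>R ad_deriv \<A> P \<theta> p v (coeff ?x i)) = spinor_pair (spin_inner S ?x) (t ?x) (conn p v)"
    by (simp add: conn_def linear_sum[OF linear_spinor_pair] linear_add[OF linear_spinor_pair]
        spinor_pair_tensor[OF fibre.bilinear_h])
  finally show ?thesis by simp
qed

end

end


section \<open>The Dirac operator on 1-forms\<close>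

context twisted_spinors
begin

context
  fixes \<epsilon> :: "'p \<Rightarrow> real^7 \<Rightarrow> 'a"
  assumes \<epsilon>: "\<epsilon> \<in> ad_1forms \<A> P"
begin

text \<open>The tensor \<open>(\<nabla>_v \<epsilon>)(w)\<close>, with the same coordinate extension
  of \<open>w\<close> as in \<open>ad_ext_deriv1\<close> and \<open>ad_codiff1\<close>, so that both
  can be read off from it.\<close>

definition nabla :: "'p \<Rightarrow> real^7 \<Rightarrow> real^7 \<Rightarrow> 'a"
  where "nabla p v w = ad_deriv \<A> P \<theta> p v (\<lambda>q. \<epsilon> q (cfield (proj P p) w (proj P q))) -
    \<epsilon> p (D (proj P p) v (cfield (proj P p) w))"

lemma ad_deriv_norm_eta_scaleR:
  "ad_deriv \<A> P \<theta> p v (\<lambda>q. spin_inner S (proj P q) (\<eta> (proj P q)) (\<eta> (proj P q)) *\<^sub>R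
      \<epsilon> q (cfield (proj P p) w (proj P q))) =
    spin_inner S (proj P p) (\<eta> (proj P p)) (\<eta> (proj P p)) *\<^sub>R
      ad_deriv \<A> P \<theta> p v (\<lambda>q. \<epsilon> q (cfield (proj P p) w (proj P q)))"
proof -
  have H: "fdiff \<A> (\<lambda>y. spin_inner S y (\<eta> y) (\<eta> y)) (proj P p)"
    by (rule fdiff_spin_inner[OF near_eta near_eta])
  have "fderiv (total P) (\<lambda>q. spin_inner S (proj P q) (\<eta> (proj P q)) (\<eta> (proj P q))) p
      (horizontal_lift \<A> P \<theta> p v) = 0"
    unfolding ad_deriv_proj[OF bundle_conn H] by (rule fderiv_norm_eta)
  then show ?thesis
    unfolding ad_deriv_def
    by (simp add: fderiv_scaleR[OF fdiff_proj[OF bundle_conn H] fdiff_ad_1form[OF principal_bundle \<epsilon>]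
          chart_inv_chart_at[OF total]])
qed

text \<open>The Leibniz rule for the Clifford product of \<epsilon> and \<eta>. Differentiating the
  defining sum would need a differentiable frame; instead both sides are shown to have the same
  pairings with \<eta> and with each \<open>e_k \<cdot> \<eta>\<close>, the latter extended by a
  coordinate field before differentiation.\<close>

lemma conn_eq:
  "conn \<epsilon> p v =
    (\<Sum>a=1..7. tensor (clifford S (proj P p) (frame (proj P p) a) (\<eta> (proj P p))) (nabla p v (frame (proj P p) a))) +
    (\<Sum>a=1..7. tensor (clifford S (proj P p) (frame (proj P p) a) (spin_conn S (proj P p) v \<eta>))
      (\<epsilon> p (frame (proj P p) a)))"
  (is "_ = ?R")
proof -
  let ?x = "proj P p" and ?\<nu> = "spin_conn S (proj P p) v \<eta>"
  let ?h = "spin_inner S ?x" and ?c = "clifford S ?x" and ?e = "frame ?x"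
  have R: "spinor_pair ?h u ?R = (\<Sum>a=1..7. ?h u (?c (?e a) (\<eta> ?x)) *\<^sub>R nabla p v (?e a)) +
      (\<Sum>a=1..7. ?h u (?c (?e a) ?\<nu>) *\<^sub>R \<epsilon> p (?e a))" for u
    by (simp only: linear_add[OF linear_spinor_pair] linear_sum[OF linear_spinor_pair]
        spinor_pair_tensor[OF fibre.bilinear_h])
  have \<mu>: "spinor_pair ?h u (\<mu> \<epsilon> p) = (\<Sum>a=1..7. ?h u (?c (?e a) (\<eta> ?x)) *\<^sub>R \<epsilon> p (?e a))" for u
    by (simp only: ad_clifford1_eq[OF \<epsilon>] linear_sum[OF linear_spinor_pair]
        spinor_pair_tensor[OF fibre.bilinear_h])
  have \<eta>\<nu>: "?h (\<eta> ?x) ?\<nu> = 0"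
    by (simp add: spin_conn_eta fibre.h_simps fibre.h_c_self)
  show ?thesis
  proof (rule fibre.spinor_pair_eqI[OF eta_nonzero])
    \<comment> \<open>\<open>\<mu>\<close> pairs to 0 with \<eta> at every point, so only the
      derivative of \<eta> survives in \<open>pair_conn\<close>.\<close>
    have "spinor_pair ?h (\<eta> ?x) (conn \<epsilon> p v) = - spinor_pair ?h ?\<nu> (\<mu> \<epsilon> p)"
      using pair_conn[OF \<epsilon> near_eta, of p v]
      by (simp add: pair_eta[OF \<epsilon>] ad_deriv_def fderiv_const)
    also have "\<dots> = (\<Sum>a=1..7. ?h (\<eta> ?x) (?c (?e a) ?\<nu>) *\<^sub>R \<epsilon> p (?e a))"
    proof -
      have "?h (\<eta> ?x) (?c u ?\<nu>) = - ?h ?\<nu> (?c u (\<eta> ?x))" for u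
        using fibre.c_skew[of ?x u ?\<nu> "\<eta> ?x"] fibre.h_sym[of ?x "?c u ?\<nu>" "\<eta> ?x"] by simp
      then show ?thesis by (simp add: \<mu> sum_negf)
    qed
    also have "\<dots> = spinor_pair ?h (\<eta> ?x) ?R"
      unfolding R by (simp add: fibre.h_c_self)
    finally show "spinor_pair ?h (\<eta> ?x) (conn \<epsilon> p v) = spinor_pair ?h (\<eta> ?x) ?R" .
  next
    fix k :: nat assume k: "k \<in> {1..7}"
    let ?w = "?e k"
    let ?t = "\<lambda>y. clifford S y (cfield ?x ?w y) (\<eta> y)"
    let ?H = "?h (\<eta> ?x) (\<eta> ?x)"
    have t: "spin_conn S ?x v ?t = ?c (D ?x v (cfield ?x ?w)) (\<eta> ?x) + ?c ?w ?\<nu>"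
      by (simp add: spin_conn_clifford[OF smooth_section_near_coord_field[OF base] near_eta] coord_field_self[OF base])
    have add: "spinor_pair ?h (s + s') X = spinor_pair ?h s X + spinor_pair ?h s' X" for s s' and X :: "'a^8"
      by (simp add: spinor_pair_def fibre.h_simps scaleR_left_distrib sum.distrib)
    have "spinor_pair ?h (?c ?w (\<eta> ?x)) (conn \<epsilon> p v) =
        ?H *\<^sub>R ad_deriv \<A> P \<theta> p v (\<lambda>q. \<epsilon> q (cfield ?x ?w (proj P q)))
        - (?H *\<^sub>R \<epsilon> p (D ?x v (cfield ?x ?w)) + spinor_pair ?h (?c ?w ?\<nu>) (\<mu> \<epsilon> p))"
      using pair_conn[OF \<epsilon> near_cfield_eta, of p ?w v]
      by (simp add: pair_clifford_eta[OF \<epsilon>] ad_deriv_norm_eta_scaleR t add coord_field_self[OF base])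
    also have "\<dots> = ?H *\<^sub>R nabla p v ?w - (\<Sum>a=1..7. ?h (?c ?w ?\<nu>) (?c (?e a) (\<eta> ?x)) *\<^sub>R \<epsilon> p (?e a))"
      by (simp add: nabla_def \<mu> scaleR_diff_right)
    also have "?H *\<^sub>R nabla p v ?w = (\<Sum>a=1..7. ?h (?c ?w (\<eta> ?x)) (?c (?e a) (\<eta> ?x)) *\<^sub>R nabla p v (?e a))"
    proof -
      have "(\<Sum>a=1..7. ?h (?c ?w (\<eta> ?x)) (?c (?e a) (\<eta> ?x)) *\<^sub>R nabla p v (?e a)) =
          (\<Sum>a=1..7. if a = k then ?H *\<^sub>R nabla p v ?w else 0)"
        by (rule sum.cong) (use k in \<open>auto simp: fibre.h_c_c fibre.orthonormal\<close>)
      then show ?thesis using k by simp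
    qed
    also have "\<dots> - (\<Sum>a=1..7. ?h (?c ?w ?\<nu>) (?c (?e a) (\<eta> ?x)) *\<^sub>R \<epsilon> p (?e a)) = spinor_pair ?h (?c ?w (\<eta> ?x)) ?R"
    proof -
      \<comment> \<open>Moving the two vectors past each other leaves a multiple of
        \<open>h(\<eta>, \<nu>)\<close>, where \<nu> is the derivative of \<eta>; it vanishes by the
        Killing equation.\<close>
      have "?h (?c ?w (\<eta> ?x)) (?c u ?\<nu>) = - ?h (?c ?w ?\<nu>) (?c u (\<eta> ?x))" for u
      proof -
        have "?h (?c ?w (\<eta> ?x)) (?c u ?\<nu>) = - ?h (\<eta> ?x) (?c ?w (?c u ?\<nu>))" by (rule fibre.c_skew)
        also have "\<dots> = ?h (\<eta> ?x) (?c u (?c ?w ?\<nu>))"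
          by (simp add: fibre.c_anticommute[of ?x ?w u] fibre.h_simps \<eta>\<nu>)
        also have "\<dots> = - ?h (?c u (\<eta> ?x)) (?c ?w ?\<nu>)" by (simp add: fibre.c_skew[of ?x u])
        also have "\<dots> = - ?h (?c ?w ?\<nu>) (?c u (\<eta> ?x))" by (simp add: fibre.h_sym[of ?x "?c u (\<eta> ?x)"])
        finally show ?thesis .
      qed
      then show ?thesis unfolding R by (simp add: sum_negf)
    qed
    finally show "spinor_pair ?h (?c ?w (\<eta> ?x)) (conn \<epsilon> p v) = spinor_pair ?h (?c ?w (\<eta> ?x)) ?R" .
  qed
qed

lemma linear_clifford_form2: "linear (clifford_form2 \<phi> S x \<beta>)"
  unfolding clifford_form2_def Let_def
  by (rule linearI) (simp_all add: fibre.c_simps scaleR_add_right sum.distrib scaleR_sum_right mult.commute)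

text \<open>The term with factor \<open>t/6\<close> involves no derivative. Its sum over the spin
  frame is the endomorphism \<open>clifford_form2\<close> applied to \<open>\<mu>\<close>, and can
  therefore be rewritten in the orthonormal frame.\<close>

lemma twisted_conn_eq:
  "twisted_conn \<A> \<phi> S P \<theta> t p v (\<mu> \<epsilon>) = conn \<epsilon> p v + (t/6) *\<^sub>R
    (\<Sum>a=1..7. tensor (clifford_form2 \<phi> S (proj P p) (\<phi> (proj P p) v)
      (clifford S (proj P p) (frame (proj P p) a) (\<eta> (proj P p)))) (\<epsilon> p (frame (proj P p) a)))"
proof -
  let ?x = "proj P p"
  let ?L = "clifford_form2 \<phi> S ?x (\<phi> ?x v)"
  have "twisted_conn \<A> \<phi> S P \<theta> t p v (\<mu> \<epsilon>) =
      (\<Sum>i\<in>UNIV. tensor (spin_conn_t \<phi> S t ?x v (spin_frame ?x i)) (coeff \<epsilon> ?x i p)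
        + tensor (spin_frame ?x i ?x) (ad_deriv \<A> P \<theta> p v (coeff \<epsilon> ?x i)))"
    by (simp only: twisted_conn_def Let_def triv_def spin_frame_def coeff_def[OF \<epsilon>])
  also have "\<dots> = conn \<epsilon> p v + (t/6) *\<^sub>R (\<Sum>i\<in>UNIV. tensor (?L (spin_frame ?x i ?x)) (coeff \<epsilon> ?x i p))"
    by (simp add: conn_def[OF \<epsilon>] spin_conn_t_def tensor_add_left tensor_scale_left sum.distrib scaleR_sum_right)
  also have "(\<Sum>i\<in>UNIV. tensor (?L (spin_frame ?x i ?x)) (coeff \<epsilon> ?x i p)) = map_left ?L (\<mu> \<epsilon> p)"
    by (subst sum_spin_frame[OF in_triv, of ?x "\<mu> \<epsilon> p", symmetric])
      (simp add: linear_sum[OF linear_map_left] map_left_tensor[OF linear_clifford_form2] coeff_def[OF \<epsilon>])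
  also have "\<dots> = (\<Sum>a=1..7. tensor (?L (clifford S ?x (frame ?x a) (\<eta> ?x))) (\<epsilon> p (frame ?x a)))"
    by (simp add: ad_clifford1_eq[OF \<epsilon>] linear_sum[OF linear_map_left] map_left_tensor[OF linear_clifford_form2])
  finally show ?thesis .
qed

text \<open>For coordinate fields the Levi-Civita corrections are symmetric in \<open>v\<close> and
  \<open>w\<close> and cancel.\<close>

lemma nabla_antisymmetrised: "nabla p v w - nabla p w v = ad_ext_deriv1 \<A> P \<theta> \<epsilon> p v w"
  by (simp add: nabla_def ad_ext_deriv1_def Let_def
      levi_civita_coord_field_commute[OF base levi_civita, of "proj P p" w v])

lemma twisted_dirac_eq:
  "twisted_dirac \<A> \<phi> S P \<theta> (- 1) (\<mu> \<epsilon>) p =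
    ad_clifford2 \<phi> S \<eta> P (ad_ext_deriv1 \<A> P \<theta> \<epsilon>) p +
    tensor (\<eta> (proj P p)) (ad_codiff1 \<A> \<phi> D P \<theta> \<epsilon> p) - 2 *\<^sub>R \<mu> \<epsilon> p"
proof -
  let ?x = "proj P p"
  let ?c = "\<lambda>a. clifford S ?x (frame ?x a)" and ?h = "\<eta> ?x" and ?f = "\<lambda>a. \<epsilon> p (frame ?x a)"
  let ?L = "\<lambda>b. clifford_form2 \<phi> S ?x (\<phi> ?x (frame ?x b))"
  let ?N = "\<lambda>b a. nabla p (frame ?x b) (frame ?x a)"
  have "twisted_dirac \<A> \<phi> S P \<theta> (- 1) (\<mu> \<epsilon>) p =
      (\<Sum>b=1..7. (\<Sum>a=1..7. tensor (?c b (?c a ?h)) (?N b a)) +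
        (\<Sum>a=1..7. tensor (?c b (?c a (spin_conn S ?x (frame ?x b) \<eta>))) (?f a)) +
        (- 1/6) *\<^sub>R (\<Sum>a=1..7. tensor (?c b (?L b (?c a ?h))) (?f a)))"
    unfolding twisted_dirac_def Let_def twisted_conn_eq conn_eq
    by (simp only: linear_add[OF linear_map_left] linear_scale[OF linear_map_left] linear_sum[OF linear_map_left]
        map_left_tensor[OF fibre.linear_c])
  also have "\<dots> = (\<Sum>b=1..7. \<Sum>a=1..7. tensor (?c b (?c a ?h)) (?N b a)) +
      (\<Sum>a=1..7. tensor (\<Sum>b=1..7. ?c b (?c a (spin_conn S ?x (frame ?x b) \<eta>))) (?f a)) +
      (- 1/6) *\<^sub>R (\<Sum>a=1..7. tensor (\<Sum>b=1..7. ?c b (?L b (?c a ?h))) (?f a))"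
    unfolding sum.distrib tensor_sum_left scaleR_sum_right[symmetric]
    by (intro arg_cong2[where f = "(+)"] refl arg_cong[where f = "(*\<^sub>R) _"] sum.swap)
  also have "(\<Sum>a=1..7. tensor (\<Sum>b=1..7. ?c b (?c a (spin_conn S ?x (frame ?x b) \<eta>))) (?f a)) =
      (- 5/2) *\<^sub>R \<mu> \<epsilon> p"
  proof -
    have "(\<Sum>b=1..7. ?c b (?c a (spin_conn S ?x (frame ?x b) \<eta>))) = (- 5/2) *\<^sub>R ?c a ?h" if "a \<in> {1..7}" for a
    proof -
      have "(\<Sum>b=1..7. ?c b (?c a (spin_conn S ?x (frame ?x b) \<eta>))) =
          (- 1/2) *\<^sub>R (\<Sum>b=1..7. ?c b (?c a (?c b ?h)))"
        by (simp add: spin_conn_eta fibre.c_simps scaleR_sum_right sum_negf)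
      then show ?thesis unfolding fibre.sum_c_frame_conjugate[OF that] by simp
    qed
    then have "(\<Sum>a=1..7. tensor (\<Sum>b=1..7. ?c b (?c a (spin_conn S ?x (frame ?x b) \<eta>))) (?f a)) =
        (\<Sum>a=1..7. (- 5/2) *\<^sub>R tensor (?c a ?h) (?f a))"
      by (intro sum.cong refl) (simp only: tensor_scale_left)
    then show ?thesis by (simp only: ad_clifford1_eq[OF \<epsilon>] scaleR_sum_right)
  qed
  also have "(\<Sum>a=1..7. tensor (\<Sum>b=1..7. ?c b (?L b (?c a ?h))) (?f a)) = (- 3) *\<^sub>R \<mu> \<epsilon> p"
  proof -
    have "(\<Sum>a=1..7. tensor (\<Sum>b=1..7. ?c b (?L b (?c a ?h))) (?f a)) =
        (\<Sum>a=1..7. (- 3) *\<^sub>R tensor (?c a ?h) (?f a))"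
      unfolding sum_clifford_form2
      by (intro sum.cong refl)
        (simp only: clifford_form3_killing tensor_scale_left tensor_minus_left scaleR_minus_left scaleR_minus_right)
    then show ?thesis by (simp only: ad_clifford1_eq[OF \<epsilon>] scaleR_sum_right)
  qed
  \<comment> \<open>On the diagonal \<open>e_a e_a = -1\<close> produces minus the trace, the
    codifferential. In each off-diagonal pair the Clifford product changes sign, which
    antisymmetrises the covariant derivative.\<close>
  also have "(\<Sum>b=1..7. \<Sum>a=1..7. tensor (?c b (?c a ?h)) (?N b a)) =
      (\<Sum>a=1..7. tensor (?c a (?c a ?h)) (?N a a)) +
      (\<Sum>b=1..7. \<Sum>a=b+1..7. tensor (?c b (?c a ?h)) (?N b a) + tensor (?c a (?c b ?h)) (?N a b))"
    by (rule sum_square_split)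
  also have "(\<Sum>a=1..7. tensor (?c a (?c a ?h)) (?N a a)) = tensor ?h (ad_codiff1 \<A> \<phi> D P \<theta> \<epsilon> p)"
  proof -
    have "(\<Sum>a=1..7. tensor (?c a (?c a ?h)) (?N a a)) = (\<Sum>a=1..7. - tensor ?h (?N a a))"
      by (intro sum.cong refl) (simp only: fibre.c_frame_square tensor_minus_left)
    also have "\<dots> = tensor ?h (- (\<Sum>a=1..7. ?N a a))"
      by (simp only: tensor_minus_right tensor_sum_right sum_negf)
    finally show ?thesis by (simp add: ad_codiff1_def Let_def nabla_def)
  qed
  also have "(\<Sum>b=1..7. \<Sum>a=b+1..7. tensor (?c b (?c a ?h)) (?N b a) + tensor (?c a (?c b ?h)) (?N a b)) =
      ad_clifford2 \<phi> S \<eta> P (ad_ext_deriv1 \<A> P \<theta> \<epsilon>) p"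
    unfolding ad_clifford2_def Let_def nabla_antisymmetrised[symmetric]
  proof (intro sum.cong refl)
    fix a b :: nat assume "b \<in> {1..7}" "a \<in> {b+1..7}"
    then have "?c a (?c b ?h) = - ?c b (?c a ?h)" by (intro fibre.c_frame_anticommute) auto
    then show "tensor (?c b (?c a ?h)) (?N b a) + tensor (?c a (?c b ?h)) (?N a b) =
        tensor (?c b (?c a ?h)) (?N b a - ?N a b)"
      by (simp add: tensor_minus_left tensor_diff_right)
  qed
  finally have "twisted_dirac \<A> \<phi> S P \<theta> (- 1) (\<mu> \<epsilon>) p =
      tensor ?h (ad_codiff1 \<A> \<phi> D P \<theta> \<epsilon> p) + ad_clifford2 \<phi> S \<eta> P (ad_ext_deriv1 \<A> P \<theta> \<epsilon>) p +
      ((- 5/2) *\<^sub>R \<mu> \<epsilon> p + (- 1/6) *\<^sub>R (- 3) *\<^sub>R \<mu> \<epsilon> p)"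
    by (simp only: add.assoc)
  also have "(- 5/2) *\<^sub>R \<mu> \<epsilon> p + (- 1/6) *\<^sub>R (- 3) *\<^sub>R \<mu> \<epsilon> p = - (2 *\<^sub>R \<mu> \<epsilon> p)"
    unfolding scaleR_scaleR scaleR_add_left[symmetric] by simp
  finally show ?thesis by (simp add: add.commute)
qed

text \<open>Skewness moves one factor across:
  \<open>h(\<eta>, e_b e_a \<eta>) = - h(e_b \<eta>, e_a \<eta>)\<close>, which is 0 for distinct
  frame vectors.\<close>

lemma pair_eta_clifford2:
  "spinor_pair (spin_inner S (proj P p)) (\<eta> (proj P p)) (ad_clifford2 \<phi> S \<eta> P \<beta> p) = 0"
proof -
  have "spin_inner S x (\<eta> x) (clifford S x (frame x b) (clifford S x (frame x a) (\<eta> x))) = 0"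
    if "b \<in> {1..7}" "a \<in> {b+1..7}" for x a b
    using fibre.c_skew[of x "frame x b" "\<eta> x" "clifford S x (frame x a) (\<eta> x)"] that
    by (simp add: fibre.h_c_c fibre.orthonormal)
  then show ?thesis
    unfolding ad_clifford2_def Let_def linear_sum[OF linear_spinor_pair] spinor_pair_tensor[OF fibre.bilinear_h]
    by (intro sum.neutral ballI) simp
qed

lemma dirac_eigenform_iff:
  "twisted_dirac \<A> \<phi> S P \<theta> (- 1) (\<mu> \<epsilon>) = (\<lambda>p. - 2 *\<^sub>R \<mu> \<epsilon> p) \<longleftrightarrow>
    ad_clifford2 \<phi> S \<eta> P (ad_ext_deriv1 \<A> P \<theta> \<epsilon>) = (\<lambda>p. 0) \<and> ad_codiff1 \<A> \<phi> D P \<theta> \<epsilon> = (\<lambda>p. 0)"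
proof -
  have "C + tensor (\<eta> (proj P p)) r = 0 \<longleftrightarrow> C = 0 \<and> r = 0"
    if C: "C = ad_clifford2 \<phi> S \<eta> P \<beta> p" for C r \<beta> p
  proof
    assume z: "C + tensor (\<eta> (proj P p)) r = 0"
    \<comment> \<open>Pairing with \<eta> removes \<open>C\<close> and leaves \<open>r\<close> times
      the square length of \<eta>; so \<open>r\<close> vanishes, and with it the second
      summand.\<close>
    have "spinor_pair (spin_inner S (proj P p)) (\<eta> (proj P p)) (C + tensor (\<eta> (proj P p)) r) = 0"
      unfolding z by (rule linear_0[OF linear_spinor_pair])
    then have "r = 0"
      by (simp add: C linear_add[OF linear_spinor_pair] pair_eta_clifford2 spinor_pair_tensor[OF fibre.bilinear_h]
          fibre.h_eq_0_iff eta_nonzero)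
    with z show "C = 0 \<and> r = 0" by (simp add: tensor_zero_right)
  qed (simp add: tensor_zero_right)
  from this[OF refl] show ?thesis
    by (auto simp: fun_eq_iff twisted_dirac_eq)
qed

end

lemma infinitesimal_deformations_eq:
  "infinitesimal_deformations \<A> \<phi> D S \<eta> P \<theta> = {\<epsilon> \<in> ad_1forms \<A> P.
    twisted_dirac \<A> \<phi> S P \<theta> (- 1) (ad_clifford1 \<phi> S \<eta> P \<epsilon>) = (\<lambda>p. - 2 *\<^sub>R ad_clifford1 \<phi> S \<eta> P \<epsilon> p)}"
  unfolding infinitesimal_deformations_def using dirac_eigenform_iff by blast

section \<open>The linear structure of the space of deformations\<close>

lemma ad_deriv_linear:
  assumes "\<epsilon> \<in> ad_1forms \<A> P" "\<epsilon>' \<in> ad_1forms \<A> P"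
  shows "ad_deriv \<A> P \<theta> p v (\<lambda>q. (r *\<^sub>R \<epsilon> + \<epsilon>') q (cfield (proj P p) w (proj P q))) =
    r *\<^sub>R ad_deriv \<A> P \<theta> p v (\<lambda>q. \<epsilon> q (cfield (proj P p) w (proj P q))) +
    ad_deriv \<A> P \<theta> p v (\<lambda>q. \<epsilon>' q (cfield (proj P p) w (proj P q)))"
proof -
  note d = fdiff_ad_1form[OF principal_bundle assms(1)] and d' = fdiff_ad_1form[OF principal_bundle assms(2)]
  note r = fdiff_scaleR[OF fdiff_const[where a = r] d chart_inv_chart_at[OF total]]
  show ?thesis
    by (simp add: ad_deriv_def scaleR_fun_def plus_fun_def fderiv_add[OF r d']
        fderiv_scaleR[OF fdiff_const[where a = r] d chart_inv_chart_at[OF total]] fderiv_const)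
qed

text \<open>\<open>isomorphic_spaces\<close> includes the subspace property. The combination
  \<open>r *\<^sub>R \<epsilon> + \<epsilon>'\<close> treats sums and multiples at once; membership
  in \<open>ad_1forms\<close> provides the differentiability under which the derivatives are
  additive.\<close>

lemma subspace_infinitesimal_deformations:
  "subspace (infinitesimal_deformations \<A> \<phi> D S \<eta> P \<theta>)"
proof -
  note sub = subspace_ad_1forms[OF principal_bundle]
  have comb: "r *\<^sub>R \<epsilon> + \<epsilon>' \<in> infinitesimal_deformations \<A> \<phi> D S \<eta> P \<theta>"
    if "\<epsilon> \<in> infinitesimal_deformations \<A> \<phi> D S \<eta> P \<theta>" "\<epsilon>' \<in> infinitesimal_deformations \<A> \<phi> D S \<eta> P \<theta>"
    for r \<epsilon> \<epsilon>'
  proof -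
    have \<epsilon>: "\<epsilon> \<in> ad_1forms \<A> P" "\<epsilon>' \<in> ad_1forms \<A> P"
      using that by (simp_all add: infinitesimal_deformations_def)
    have "ad_ext_deriv1 \<A> P \<theta> (r *\<^sub>R \<epsilon> + \<epsilon>') p v w =
        r *\<^sub>R ad_ext_deriv1 \<A> P \<theta> \<epsilon> p v w + ad_ext_deriv1 \<A> P \<theta> \<epsilon>' p v w" for p v w
      unfolding ad_ext_deriv1_def Let_def ad_deriv_linear[OF \<epsilon>] by (simp add: algebra_simps)
    then have "ad_clifford2 \<phi> S \<eta> P (ad_ext_deriv1 \<A> P \<theta> (r *\<^sub>R \<epsilon> + \<epsilon>')) p =
        r *\<^sub>R ad_clifford2 \<phi> S \<eta> P (ad_ext_deriv1 \<A> P \<theta> \<epsilon>) p + ad_clifford2 \<phi> S \<eta> P (ad_ext_deriv1 \<A> P \<theta> \<epsilon>') p" for p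
      by (simp only: ad_clifford2_def Let_def tensor_add_right tensor_scale_right sum.distrib scaleR_sum_right)
    moreover have "ad_codiff1 \<A> \<phi> D P \<theta> (r *\<^sub>R \<epsilon> + \<epsilon>') p =
        r *\<^sub>R ad_codiff1 \<A> \<phi> D P \<theta> \<epsilon> p + ad_codiff1 \<A> \<phi> D P \<theta> \<epsilon>' p" for p
    proof -
      have "(r *\<^sub>R \<epsilon> + \<epsilon>') p u = r *\<^sub>R \<epsilon> p u + \<epsilon>' p u" for u
        by (simp add: scaleR_fun_def plus_fun_def)
      then show ?thesis
        unfolding ad_codiff1_def Let_def ad_deriv_linear[OF \<epsilon>]
        by (simp add: scaleR_sum_right sum.distrib sum_subtractf algebra_simps)
    qed
    moreover have "r *\<^sub>R \<epsilon> + \<epsilon>' \<in> ad_1forms \<A> P"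
      by (intro subspace_add[OF sub] subspace_scale[OF sub] \<epsilon>)
    ultimately show ?thesis
      using that by (simp add: infinitesimal_deformations_def fun_eq_iff)
  qed
  have zero: "0 \<in> infinitesimal_deformations \<A> \<phi> D S \<eta> P \<theta>"
    using subspace_0[OF sub]
    by (simp add: infinitesimal_deformations_def fun_eq_iff ad_clifford2_def ad_ext_deriv1_def ad_codiff1_def
        Let_def ad_deriv_def fderiv_const tensor_zero_right)
  show ?thesis
  proof (rule subspaceI[OF zero])
    fix \<epsilon> \<epsilon>' :: "'p \<Rightarrow> real^7 \<Rightarrow> 'a" and r :: real
    assume \<epsilon>: "\<epsilon> \<in> infinitesimal_deformations \<A> \<phi> D S \<eta> P \<theta>"
    show "r *\<^sub>R \<epsilon> \<in> infinitesimal_deformations \<A> \<phi> D S \<eta> P \<theta>"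
      using comb[OF \<epsilon> zero, of r] by simp
    assume "\<epsilon>' \<in> infinitesimal_deformations \<A> \<phi> D S \<eta> P \<theta>"
    from comb[OF \<epsilon> this, of 1] show "\<epsilon> + \<epsilon>' \<in> infinitesimal_deformations \<A> \<phi> D S \<eta> P \<theta>" by simp
  qed
qed

end

theorem theorem3p2:
  fixes \<A> :: "('m::{t2_space, second_countable_topology}, real^7) chart set"
    and \<phi> :: "'m \<Rightarrow> form3"
    and D :: "'m \<Rightarrow> real^7 \<Rightarrow> ('m \<Rightarrow> real^7) \<Rightarrow> real^7"
    and S :: "'m spinors"
    and \<eta> :: "'m \<Rightarrow> real^8"
    and P :: "('m, 'p::{t2_space, second_countable_topology}, 'b::real_normed_vector,
      'g::{group_add, t2_space, second_countable_topology}, 'a::real_normed_vector) pbundle"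
    and A :: "'p \<Rightarrow> 'b \<Rightarrow> 'a"
  assumes "smooth_atlas \<A>"
    and "nearly_parallel \<A> \<phi>"
    and "levi_civita \<A> (\<lambda>x. g2_metric (\<phi> x)) D"
    and "spinor_bundle \<A> (\<lambda>x. g2_metric (\<phi> x)) D S"
    and "killing_spinor \<A> \<phi> S \<eta>"
    and "principal_bundle \<A> P"
    and "g2_instanton \<A> \<phi> S \<eta> P A"
  shows "isomorphic_spaces
    (infinitesimal_deformations \<A> \<phi> D S \<eta> P A)
    {\<epsilon> \<in> ad_1forms \<A> P.
       twisted_dirac \<A> \<phi> S P A (-1) (ad_clifford1 \<phi> S \<eta> P \<epsilon>) =
         (\<lambda>p. - 2 *\<^sub>R ad_clifford1 \<phi> S \<eta> P \<epsilon> p)}"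
proof -
  interpret twisted_spinors \<A> \<phi> D S \<eta> P A
    using assms by unfold_locales (simp_all add: nearly_parallel_def g2_instanton_def)
  have "isomorphic_spaces (infinitesimal_deformations \<A> \<phi> D S \<eta> P A)
      (infinitesimal_deformations \<A> \<phi> D S \<eta> P A)"
    unfolding isomorphic_spaces_def
    using subspace_infinitesimal_deformations linear_id bij_betw_id by blast
  then show ?thesis unfolding infinitesimal_deformations_eq .
qed

end
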